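(* Let $(M,g,\nabla,\nabla^* )$ be a statistical manifold, $U\subset M$ a dually convex set, and for $p,q\in U$ let $\mathcal D(p,q)$ be the canonical divergence. Then: (1) If $\nabla=\nabla^*=\overline\nabla$ is the Levi-Civita connection of $g$, then $\mathcal D(p,q)=\tfrac12 d(p,q)^2$, where $d(p,q)=\sqrt{\langle \overline{\exp}_p^{-1}(q),\overline{\exp}_p^{-1}(q)\rangle_p}$ is the Riemannian distance ($\overline{\exp}$ being the Levi-Civita exponential map). (2) If the curvature tensors of $\nabla$ and $\nabla^*$ both vanish, then $\mathcal D(p,q)=D[p:q]$, where $D[p:q]:=\phi(p)+\phi^*(q)-\sum_i\theta^i(p)\eta_i(q)$ is the canonical divergence of Bregman type. (3) If the curvature of $\nabla$ satisfies (i) $R(X,Y,Y,Y)=0$ for all vector fields $X,Y$ and (ii) $\nabla \mathcal R=0$, then $$\mathcal D(p,q)=D(p,q):=\int_0^1 t\,\|\dot\sigma(t)\|^2\,dt,$$ where $\sigma:[0,1]\to U$ is the $\nabla$-geodesic from $p$ to $q$; in addition $\mathcal D(p,q)=W^*(q\|p)$, where $$W^*(q\|p):=-\int_0^1\big\langle \dot\sigma^*(t),\exp_{\sigma^*(t)}^{-1}(p)\big\rangle_{\sigma^*(t)}\,dt$$ and $\sigma^*:[0,1]\to U$ is the $\nabla^*$-geodesic from $p$ to $q$.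
   Context: Statistical manifold: $M$ is a smooth manifold, $g=\langle\cdot,\cdot\rangle$ a Riemannian metric, and $\nabla,\nabla^*$ are torsion-free affine connections on $TM$, dual with respect to $g$: $X g(Y,Z)=g(\nabla_XY,Z)+g(Y,\nabla^*_XZ)$ for all vector fields $X,Y,Z$. $\exp$ and $\exp^*$ denote the exponential maps of $\nabla$ and $\nabla^*$. $\mathcal R(X,Y)Z=\nabla_X\nabla_YZ-\nabla_Y\nabla_XZ-\nabla_{[X,Y]}Z$ is the curvature tensor of $\nabla$ and $R(X,Y,Z,W)=g(\mathcal R(X,Y)Z,W)$. Dually convex set: $U\subset M$ such that for all $p,q\in U$ there are a unique $\nabla$-geodesic $\sigma:[0,1]\to U$ and a unique $\nabla^*$-geodesic $\sigma^*:[0,1]\to U$ with $\sigma(0)=\sigma^*(0)=p$, $\sigma(1)=\sigma^*(1)=q$. One writes $\exp_p^{-1}(q):=\dot\sigma(0)$ and $(\exp^*_p)^{-1}(q):=\dot\sigma^*(0)$. Standing convention: $U$ is open and for each $p\in U$ there is a neighbourhood $\mathcal E_p$ of $0$ in $T_pM$ on which $\exp_p$ and $\exp^*_p$ are diffeomorphisms onto images containing $U$, their inverses on $U$ being given respectively by the initial velocities $\dot\sigma(0)$ and $\dot\sigma^*(0)$ of the $\nabla$-geodesic $\sigma$ and the $\nabla^*$-geodesic $\sigma^*$ in $U$ from $p$ to $q$, which depend smoothly on $(p,q)\in U\times U$. Canonical divergence: for $p,q\in U$, $\Pi_q(p)\in T_qM$ is the $\nabla$-parallel transport of $\exp_p^{-1}(q)$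 along the $\nabla^*$-geodesic in $U$ from $p$ to $q$, and $$\mathcal D(p,q):=\int_0^1\langle \Pi_{\sigma(t)}(p),\dot\sigma(t)\rangle_{\sigma(t)}\,dt,$$ where $\sigma$ is the $\nabla$-geodesic in $U$ from $p$ to $q$. Dually flat case: when both curvatures vanish, one has a $\nabla$-affine coordinate system $(\theta^i)$ and a $\nabla^*$-affine coordinate system $(\eta_i)$, mutually dual in the sense $g(\partial/\partial\theta^i,\partial/\partial\eta_j)=\delta_i^j$, and potentials $\phi,\phi^*$ with $\partial\phi/\partial\theta^i=\eta_i$, $\partial\phi^*/\partial\eta_i=\theta^i$ and $\phi+\phi^*-\sum_i\theta^i\eta_i=0$ (all evaluated at the same point).
   Formalization: In (1), "the Riemannian distance" is taken as that of the Riemannian manifold U (infimum of lengths of curves inside U), not of M; with the distance of M the claim fails, e.g. for a flat cylinder minus a generator. *)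

theory Defs
  imports "HOL-Analysis.Analysis"
begin

section \<open>Smooth manifolds\<close>

primrec k_smooth_on ::
  "nat \<Rightarrow> 'a::real_normed_vector set \<Rightarrow> ('a \<Rightarrow> 'b::real_normed_vector) \<Rightarrow> bool" where
  "k_smooth_on 0 S f = continuous_on S f"
| "k_smooth_on (Suc k) S f =
     ((\<forall>x\<in>S. f differentiable (at x)) \<and>
      (\<forall>v. k_smooth_on k S (\<lambda>x. frechet_derivative f (at x) v)))"

text \<open>Only used for open \<open>S\<close>.\<close>

definition smooth_on ::
  "'a::real_normed_vector set \<Rightarrow> ('a \<Rightarrow> 'b::real_normed_vector) \<Rightarrow> bool" where
  "smooth_on S f \<longleftrightarrow> (\<forall>k. k_smooth_on k S f)"

text \<open>A chart is a pair of a domain and a coordinate map; the coordinate map is a total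
  function whose values outside the domain are irrelevant.\<close>

type_synonym ('m, 'n) chart = "'m set \<times> ('m \<Rightarrow> real ^ 'n)"

abbreviation cdom :: "('m, 'n) chart \<Rightarrow> 'm set" where "cdom c \<equiv> fst c"
abbreviation cmap :: "('m, 'n) chart \<Rightarrow> 'm \<Rightarrow> real ^ 'n" where "cmap c \<equiv> snd c"

definition cinv :: "('m, 'n) chart \<Rightarrow> real ^ 'n \<Rightarrow> 'm" where
  "cinv c = inv_into (cdom c) (cmap c)"

definition is_chart :: "('m::topological_space, 'n::finite) chart \<Rightarrow> bool" where
  "is_chart c \<longleftrightarrow> open (cdom c) \<and> open (cmap c ` cdom c) \<and>
     homeomorphism (cdom c) (cmap c ` cdom c) (cmap c) (cinv c)"

definition compatible :: "('m, 'n::finite) chart \<Rightarrow> ('m, 'n) chart \<Rightarrow> bool" where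
  "compatible c d \<longleftrightarrow>
     smooth_on (cmap c ` (cdom c \<inter> cdom d)) (cmap d \<circ> cinv c) \<and>
     smooth_on (cmap d ` (cdom c \<inter> cdom d)) (cmap c \<circ> cinv d)"

text \<open>A smooth structure is a maximal smooth atlas on the whole type \<open>'m\<close>. The dimension is
  \<open>CARD('n)\<close>.\<close>

definition smooth_manifold ::
  "('m::{t2_space, second_countable_topology}, 'n::finite) chart set \<Rightarrow> bool" where
  "smooth_manifold A \<longleftrightarrow>
     (\<forall>c\<in>A. is_chart c) \<and>
     (\<Union>c\<in>A. cdom c) = UNIV \<and>
     (\<forall>c\<in>A. \<forall>d\<in>A. compatible c d) \<and>
     (\<forall>c. is_chart c \<and> (\<forall>d\<in>A. compatible c d) \<longrightarrow> c \<in> A)"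

definition smooth_fun ::
  "('m, 'n::finite) chart set \<Rightarrow> 'm set \<Rightarrow> ('m \<Rightarrow> 'b::real_normed_vector) \<Rightarrow> bool" where
  "smooth_fun A W f \<longleftrightarrow> (\<forall>c\<in>A. smooth_on (cmap c ` (W \<inter> cdom c)) (f \<circ> cinv c))"

definition smooth_map_into ::
  "('m::topological_space, 'n::finite) chart set \<Rightarrow> 'a::real_normed_vector set \<Rightarrow>
     ('a \<Rightarrow> 'm) \<Rightarrow> bool" where
  "smooth_map_into A S f \<longleftrightarrow> continuous_on S f \<and>
     (\<forall>d\<in>A. smooth_on {x \<in> S. f x \<in> cdom d} (cmap d \<circ> f))"


section \<open>Tangent vectors and vector fields\<close>

text \<open>A tangent vector at \<open>p\<close> is the family of its component vectors in all charts around
  \<open>p\<close>, related by the derivatives of the coordinate changes (and \<open>0\<close> at the other charts, so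
  that equality of tangent vectors is equality of families).\<close>

type_synonym ('m, 'n) tvec = "('m, 'n) chart \<Rightarrow> real ^ 'n"
type_synonym ('m, 'n) vfield = "'m \<Rightarrow> ('m, 'n) tvec"

definition tangent_space ::
  "('m, 'n::finite) chart set \<Rightarrow> 'm \<Rightarrow> ('m, 'n) tvec set" where
  "tangent_space A p = {v.
     (\<forall>c. \<not> (c \<in> A \<and> p \<in> cdom c) \<longrightarrow> v c = 0) \<and>
     (\<forall>c\<in>A. \<forall>d\<in>A. p \<in> cdom c \<and> p \<in> cdom d \<longrightarrow>
        v d = frechet_derivative (cmap d \<circ> cinv c) (at (cmap c p)) (v c))}"

abbreviation tzero :: "('m, 'n::finite) tvec" where "tzero \<equiv> (\<lambda>c. 0)"
abbreviation tadd :: "('m, 'n::finite) tvec \<Rightarrow> ('m, 'n) tvec \<Rightarrow> ('m, 'n) tvec" where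
  "tadd u v \<equiv> (\<lambda>c. u c + v c)"
abbreviation tdiff :: "('m, 'n::finite) tvec \<Rightarrow> ('m, 'n) tvec \<Rightarrow> ('m, 'n) tvec" where
  "tdiff u v \<equiv> (\<lambda>c. u c - v c)"
abbreviation tscale :: "real \<Rightarrow> ('m, 'n::finite) tvec \<Rightarrow> ('m, 'n) tvec" where
  "tscale a v \<equiv> (\<lambda>c. a *\<^sub>R v c)"

text \<open>The tangent vector at \<open>p\<close> with components \<open>u\<close> in the chart \<open>c\<close>. In particular
  \<open>\<lambda>p. coord_vec A c p (axis i 1)\<close> is the \<open>i\<close>-th coordinate vector field of \<open>c\<close>.\<close>

definition coord_vec ::
  "('m, 'n::finite) chart set \<Rightarrow> ('m, 'n) chart \<Rightarrow> 'm \<Rightarrow> real ^ 'n \<Rightarrow> ('m, 'n) tvec" where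
  "coord_vec A c p u = (\<lambda>d. if d \<in> A \<and> p \<in> cdom d
     then frechet_derivative (cmap d \<circ> cinv c) (at (cmap c p)) u else 0)"

definition smooth_vfield ::
  "('m, 'n::finite) chart set \<Rightarrow> 'm set \<Rightarrow> ('m, 'n) vfield \<Rightarrow> bool" where
  "smooth_vfield A W X \<longleftrightarrow> (\<forall>p\<in>W. X p \<in> tangent_space A p) \<and>
     (\<forall>c\<in>A. smooth_on (cmap c ` (W \<inter> cdom c)) (\<lambda>x. X (cinv c x) c))"

text \<open>The derivative \<open>v f\<close> of \<open>f\<close> in the direction of a tangent vector \<open>v\<close> at \<open>p\<close>; by the chain
  rule it does not depend on the chosen chart.\<close>

definition dir_deriv ::
  "('m, 'n::finite) chart set \<Rightarrow> 'm \<Rightarrow> ('m, 'n) tvec \<Rightarrow> ('m \<Rightarrow> real) \<Rightarrow> real" where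
  "dir_deriv A p v f = (let c = (SOME c. c \<in> A \<and> p \<in> cdom c)
     in frechet_derivative (f \<circ> cinv c) (at (cmap c p)) (v c))"

text \<open>The components of \<open>[X,Y]\<close> are \<open>X(Y x\<^sup>k) - Y(X x\<^sup>k)\<close>.\<close>

definition lie_bracket ::
  "('m, 'n::finite) chart set \<Rightarrow> ('m, 'n) vfield \<Rightarrow> ('m, 'n) vfield \<Rightarrow> ('m, 'n) vfield" where
  "lie_bracket A X Y p = (\<lambda>c. if c \<in> A \<and> p \<in> cdom c then
       frechet_derivative (\<lambda>x. Y (cinv c x) c) (at (cmap c p)) (X p c)
       - frechet_derivative (\<lambda>x. X (cinv c x) c) (at (cmap c p)) (Y p c)
     else 0)"


section \<open>Metrics, connections, curvature\<close>

type_synonym ('m, 'n) metric = "'m \<Rightarrow> ('m, 'n) tvec \<Rightarrow> ('m, 'n) tvec \<Rightarrow> real"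
type_synonym ('m, 'n) connection = "('m, 'n) vfield \<Rightarrow> ('m, 'n) vfield \<Rightarrow> ('m, 'n) vfield"

definition riemannian_metric ::
  "('m::topological_space, 'n::finite) chart set \<Rightarrow> ('m, 'n) metric \<Rightarrow> bool" where
  "riemannian_metric A g \<longleftrightarrow>
     (\<forall>p. \<forall>u\<in>tangent_space A p. \<forall>v\<in>tangent_space A p. \<forall>w\<in>tangent_space A p. \<forall>a b.
        g p (tadd (tscale a u) (tscale b v)) w = a * g p u w + b * g p v w) \<and>
     (\<forall>p. \<forall>u\<in>tangent_space A p. \<forall>v\<in>tangent_space A p. g p u v = g p v u) \<and>
     (\<forall>p. \<forall>u\<in>tangent_space A p. u \<noteq> tzero \<longrightarrow> 0 < g p u u) \<and>
     (\<forall>W X Y. open W \<and> smooth_vfield A W X \<and> smooth_vfield A W Y \<longrightarrow>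
        smooth_fun A W (\<lambda>p. g p (X p) (Y p)))"

text \<open>A connection acts on the smooth vector fields over every open set \<open>W\<close>, compatibly with
  restriction: this is how a connection on the tangent bundle, a local operator, is applied to
  fields such as the coordinate fields of a chart. The values of the total function \<open>N X Y\<close>
  outside \<open>W\<close> are irrelevant.\<close>

definition affine_connection ::
  "('m::topological_space, 'n::finite) chart set \<Rightarrow> ('m, 'n) connection \<Rightarrow> bool" where
  "affine_connection A N \<longleftrightarrow>
     (\<forall>W X Y. open W \<and> smooth_vfield A W X \<and> smooth_vfield A W Y \<longrightarrow>
        smooth_vfield A W (N X Y) \<and>
        (\<forall>X' Y'. smooth_vfield A W X' \<and> smooth_vfield A W Y' \<and>
            (\<forall>p\<in>W. X' p = X p \<and> Y' p = Y p) \<longrightarrow> (\<forall>p\<in>W. N X' Y' p = N X Y p)) \<and>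
        (\<forall>X'. smooth_vfield A W X' \<longrightarrow>
            (\<forall>p\<in>W. N (\<lambda>q. tadd (X q) (X' q)) Y p = tadd (N X Y p) (N X' Y p))) \<and>
        (\<forall>Y'. smooth_vfield A W Y' \<longrightarrow>
            (\<forall>p\<in>W. N X (\<lambda>q. tadd (Y q) (Y' q)) p = tadd (N X Y p) (N X Y' p))) \<and>
        (\<forall>f :: 'm \<Rightarrow> real. smooth_fun A W f \<longrightarrow>
            (\<forall>p\<in>W. N (\<lambda>q. tscale (f q) (X q)) Y p = tscale (f p) (N X Y p)) \<and>
            (\<forall>p\<in>W. N X (\<lambda>q. tscale (f q) (Y q)) p =
               tadd (tscale (dir_deriv A p (X p) f) (Y p)) (tscale (f p) (N X Y p)))))"

definition torsion_free ::
  "('m::topological_space, 'n::finite) chart set \<Rightarrow> ('m, 'n) connection \<Rightarrow> bool" where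
  "torsion_free A N \<longleftrightarrow>
     (\<forall>W X Y. open W \<and> smooth_vfield A W X \<and> smooth_vfield A W Y \<longrightarrow>
        (\<forall>p\<in>W. tdiff (N X Y p) (N Y X p) = lie_bracket A X Y p))"

definition dual_connections ::
  "('m::topological_space, 'n::finite) chart set \<Rightarrow> ('m, 'n) metric \<Rightarrow>
     ('m, 'n) connection \<Rightarrow> ('m, 'n) connection \<Rightarrow> bool" where
  "dual_connections A g N Ns \<longleftrightarrow>
     (\<forall>W X Y Z. open W \<and> smooth_vfield A W X \<and> smooth_vfield A W Y \<and> smooth_vfield A W Z \<longrightarrow>
        (\<forall>p\<in>W. dir_deriv A p (X p) (\<lambda>q. g q (Y q) (Z q)) =
           g p (N X Y p) (Z p) + g p (Y p) (Ns X Z p)))"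

definition statistical_manifold ::
  "('m::{t2_space, second_countable_topology}, 'n::finite) chart set \<Rightarrow> ('m, 'n) metric \<Rightarrow>
     ('m, 'n) connection \<Rightarrow> ('m, 'n) connection \<Rightarrow> bool" where
  "statistical_manifold A g N Ns \<longleftrightarrow>
     smooth_manifold A \<and> riemannian_metric A g \<and>
     affine_connection A N \<and> affine_connection A Ns \<and>
     torsion_free A N \<and> torsion_free A Ns \<and> dual_connections A g N Ns"

text \<open>Metric compatibility is self-duality.\<close>

definition levi_civita ::
  "('m::topological_space, 'n::finite) chart set \<Rightarrow> ('m, 'n) metric \<Rightarrow>
     ('m, 'n) connection \<Rightarrow> bool" where
  "levi_civita A g N \<longleftrightarrow>
     affine_connection A N \<and> torsion_free A N \<and> dual_connections A g N N"

definition same_connection ::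
  "('m::topological_space, 'n::finite) chart set \<Rightarrow> ('m, 'n) connection \<Rightarrow>
     ('m, 'n) connection \<Rightarrow> bool" where
  "same_connection A N N' \<longleftrightarrow>
     (\<forall>W X Y. open W \<and> smooth_vfield A W X \<and> smooth_vfield A W Y \<longrightarrow>
        (\<forall>p\<in>W. N X Y p = N' X Y p))"

definition curvature ::
  "('m, 'n::finite) chart set \<Rightarrow> ('m, 'n) connection \<Rightarrow>
     ('m, 'n) vfield \<Rightarrow> ('m, 'n) vfield \<Rightarrow> ('m, 'n) vfield \<Rightarrow> ('m, 'n) vfield" where
  "curvature A N X Y Z p =
     tdiff (tdiff (N X (N Y Z) p) (N Y (N X Z) p)) (N (lie_bracket A X Y) Z p)"

definition curvature4 ::
  "('m, 'n::finite) chart set \<Rightarrow> ('m, 'n) metric \<Rightarrow> ('m, 'n) connection \<Rightarrow>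
     ('m, 'n) vfield \<Rightarrow> ('m, 'n) vfield \<Rightarrow> ('m, 'n) vfield \<Rightarrow> ('m, 'n) vfield \<Rightarrow> 'm \<Rightarrow> real" where
  "curvature4 A g N X Y Z V p = g p (curvature A N X Y Z p) (V p)"

definition flat_connection ::
  "('m::topological_space, 'n::finite) chart set \<Rightarrow> ('m, 'n) connection \<Rightarrow> bool" where
  "flat_connection A N \<longleftrightarrow>
     (\<forall>W X Y Z. open W \<and> smooth_vfield A W X \<and> smooth_vfield A W Y \<and> smooth_vfield A W Z \<longrightarrow>
        (\<forall>p\<in>W. curvature A N X Y Z p = tzero))"

definition cov_deriv_curvature ::
  "('m, 'n::finite) chart set \<Rightarrow> ('m, 'n) connection \<Rightarrow> ('m, 'n) vfield \<Rightarrow>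
     ('m, 'n) vfield \<Rightarrow> ('m, 'n) vfield \<Rightarrow> ('m, 'n) vfield \<Rightarrow> ('m, 'n) vfield" where
  "cov_deriv_curvature A N V X Y Z p =
     tdiff (tdiff (tdiff (N V (curvature A N X Y Z) p)
       (curvature A N (N V X) Y Z p))
       (curvature A N X (N V Y) Z p))
       (curvature A N X Y (N V Z) p)"

definition parallel_curvature ::
  "('m::topological_space, 'n::finite) chart set \<Rightarrow> ('m, 'n) connection \<Rightarrow> bool" where
  "parallel_curvature A N \<longleftrightarrow>
     (\<forall>W V X Y Z. open W \<and> smooth_vfield A W V \<and> smooth_vfield A W X \<and>
        smooth_vfield A W Y \<and> smooth_vfield A W Z \<longrightarrow>
        (\<forall>p\<in>W. cov_deriv_curvature A N V X Y Z p = tzero))"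


section \<open>Geodesics, parallel transport, exponential map\<close>

text \<open>All curves are parametrised on \<open>[0,1]\<close>, with one-sided derivatives at the end points.\<close>

definition velocity ::
  "('m, 'n::finite) chart set \<Rightarrow> (real \<Rightarrow> 'm) \<Rightarrow> real \<Rightarrow> ('m, 'n) tvec" where
  "velocity A \<gamma> t = (\<lambda>c. if c \<in> A \<and> \<gamma> t \<in> cdom c
     then vector_derivative (cmap c \<circ> \<gamma>) (at t within {0..1}) else 0)"

text \<open>\<open>christoffel A N c p u w\<close> is the vector of the \<open>\<Gamma>\<^sup>k\<^sub>i\<^sub>j u\<^sup>i w\<^sup>j\<close> of the chart \<open>c\<close> at \<open>p\<close>.\<close>

definition christoffel ::
  "('m, 'n::finite) chart set \<Rightarrow> ('m, 'n) connection \<Rightarrow> ('m, 'n) chart \<Rightarrow> 'm \<Rightarrow>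
     real ^ 'n \<Rightarrow> real ^ 'n \<Rightarrow> real ^ 'n" where
  "christoffel A N c p u w = N (\<lambda>q. coord_vec A c q u) (\<lambda>q. coord_vec A c q w) p c"

text \<open>\<open>V\<close> is a parallel vector field along \<open>\<gamma>\<close>: in every chart,
  \<open>dV\<^sup>k/dt + \<Gamma>\<^sup>k\<^sub>i\<^sub>j \<gamma>'\<^sup>i V\<^sup>j = 0\<close>.\<close>

definition parallel_along ::
  "('m, 'n::finite) chart set \<Rightarrow> ('m, 'n) connection \<Rightarrow> (real \<Rightarrow> 'm) \<Rightarrow>
     (real \<Rightarrow> ('m, 'n) tvec) \<Rightarrow> bool" where
  "parallel_along A N \<gamma> V \<longleftrightarrow>
     (\<forall>t\<in>{0..1}. V t \<in> tangent_space A (\<gamma> t) \<and>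
        (\<forall>c\<in>A. \<gamma> t \<in> cdom c \<longrightarrow>
           ((\<lambda>s. V s c) has_vector_derivative
              - christoffel A N c (\<gamma> t) (velocity A \<gamma> t c) (V t c)) (at t within {0..1})))"

definition differentiable_curve ::
  "('m::topological_space, 'n::finite) chart set \<Rightarrow> (real \<Rightarrow> 'm) \<Rightarrow> bool" where
  "differentiable_curve A \<gamma> \<longleftrightarrow> continuous_on {0..1} \<gamma> \<and>
     (\<forall>t\<in>{0..1}. \<forall>c\<in>A. \<gamma> t \<in> cdom c \<longrightarrow> (cmap c \<circ> \<gamma>) differentiable (at t within {0..1}))"

text \<open>Solutions of the geodesic equation are automatically smooth.\<close>

definition is_geodesic ::
  "('m::topological_space, 'n::finite) chart set \<Rightarrow> ('m, 'n) connection \<Rightarrow>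
     (real \<Rightarrow> 'm) \<Rightarrow> bool" where
  "is_geodesic A N \<gamma> \<longleftrightarrow>
     differentiable_curve A \<gamma> \<and> parallel_along A N \<gamma> (velocity A \<gamma>)"

definition parallel_transport ::
  "('m, 'n::finite) chart set \<Rightarrow> ('m, 'n) connection \<Rightarrow> (real \<Rightarrow> 'm) \<Rightarrow>
     ('m, 'n) tvec \<Rightarrow> ('m, 'n) tvec" where
  "parallel_transport A N \<gamma> v =
     (THE w. \<exists>V. parallel_along A N \<gamma> V \<and> V 0 = v \<and> V 1 = w)"

definition exp_domain ::
  "('m::topological_space, 'n::finite) chart set \<Rightarrow> ('m, 'n) connection \<Rightarrow> 'm \<Rightarrow>
     ('m, 'n) tvec set" where
  "exp_domain A N p = {v. \<exists>\<gamma>. is_geodesic A N \<gamma> \<and> \<gamma> 0 = p \<and> velocity A \<gamma> 0 = v}"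

definition exp_map ::
  "('m::topological_space, 'n::finite) chart set \<Rightarrow> ('m, 'n) connection \<Rightarrow> 'm \<Rightarrow>
     ('m, 'n) tvec \<Rightarrow> 'm" where
  "exp_map A N p v =
     (THE q. \<exists>\<gamma>. is_geodesic A N \<gamma> \<and> \<gamma> 0 = p \<and> velocity A \<gamma> 0 = v \<and> \<gamma> 1 = q)"

text \<open>Extensionality on \<open>[0,1]\<close> makes uniqueness of the connecting geodesic meaningful.\<close>

definition joins_in ::
  "('m::topological_space, 'n::finite) chart set \<Rightarrow> ('m, 'n) connection \<Rightarrow> 'm set \<Rightarrow>
     'm \<Rightarrow> 'm \<Rightarrow> (real \<Rightarrow> 'm) \<Rightarrow> bool" where
  "joins_in A N U p q \<sigma> \<longleftrightarrow>
     \<sigma> \<in> {0..1} \<rightarrow>\<^sub>E U \<and> is_geodesic A N \<sigma> \<and> \<sigma> 0 = p \<and> \<sigma> 1 = q"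

definition dually_convex ::
  "('m::topological_space, 'n::finite) chart set \<Rightarrow> ('m, 'n) connection \<Rightarrow>
     ('m, 'n) connection \<Rightarrow> 'm set \<Rightarrow> bool" where
  "dually_convex A N Ns U \<longleftrightarrow>
     (\<forall>p\<in>U. \<forall>q\<in>U. (\<exists>!\<sigma>. joins_in A N U p q \<sigma>) \<and> (\<exists>!\<sigma>. joins_in A Ns U p q \<sigma>))"

definition geod ::
  "('m::topological_space, 'n::finite) chart set \<Rightarrow> ('m, 'n) connection \<Rightarrow> 'm set \<Rightarrow>
     'm \<Rightarrow> 'm \<Rightarrow> real \<Rightarrow> 'm" where
  "geod A N U p q = (THE \<sigma>. joins_in A N U p q \<sigma>)"

text \<open>The tangent vector written \<open>exp\<^sub>p\<^sup>-\<^sup>1(q)\<close>: the initial velocity of the geodesic in \<open>U\<close>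
  from \<open>p\<close> to \<open>q\<close>.\<close>

definition exp_inv ::
  "('m::topological_space, 'n::finite) chart set \<Rightarrow> ('m, 'n) connection \<Rightarrow> 'm set \<Rightarrow>
     'm \<Rightarrow> 'm \<Rightarrow> ('m, 'n) tvec" where
  "exp_inv A N U p q = velocity A (geod A N U p q) 0"

text \<open>\<open>exp_map A N p\<close> is a diffeomorphism from the open set \<open>E\<close> of the tangent space at \<open>p\<close>
  onto its (open) image; the tangent space carries the topology and smooth structure of
  \<open>real ^ 'n\<close> given by the components in any chart \<open>c\<close> around \<open>p\<close>.\<close>

definition exp_diffeo_on ::
  "('m::topological_space, 'n::finite) chart set \<Rightarrow> ('m, 'n) connection \<Rightarrow> 'm \<Rightarrow>
     ('m, 'n) tvec set \<Rightarrow> bool" where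
  "exp_diffeo_on A N p E \<longleftrightarrow>
     E \<subseteq> tangent_space A p \<and> E \<subseteq> exp_domain A N p \<and>
     (\<forall>c\<in>A. p \<in> cdom c \<longrightarrow>
        (let S = (\<lambda>v. v c) ` E; e = (\<lambda>u. exp_map A N p (coord_vec A c p u)) in
           open S \<and> inj_on e S \<and> open (e ` S) \<and>
           smooth_map_into A S e \<and> smooth_fun A (e ` S) (inv_into S e)))"

definition smooth_exp_inv ::
  "('m::topological_space, 'n::finite) chart set \<Rightarrow> ('m, 'n) connection \<Rightarrow> 'm set \<Rightarrow> bool" where
  "smooth_exp_inv A N U \<longleftrightarrow>
     (\<forall>c\<in>A. \<forall>d\<in>A. smooth_on ((cmap c ` (U \<inter> cdom c)) \<times> (cmap d ` (U \<inter> cdom d)))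
        (\<lambda>z. exp_inv A N U (cinv c (fst z)) (cinv d (snd z)) c))"

definition normal_convention ::
  "('m::topological_space, 'n::finite) chart set \<Rightarrow> ('m, 'n) connection \<Rightarrow>
     ('m, 'n) connection \<Rightarrow> 'm set \<Rightarrow> bool" where
  "normal_convention A N Ns U \<longleftrightarrow>
     open U \<and>
     (\<forall>p\<in>U. \<exists>E. tzero \<in> E \<and> exp_diffeo_on A N p E \<and> exp_diffeo_on A Ns p E \<and>
        U \<subseteq> exp_map A N p ` E \<and> U \<subseteq> exp_map A Ns p ` E \<and>
        (\<forall>q\<in>U. inv_into E (exp_map A N p) q = exp_inv A N U p q \<and>
                inv_into E (exp_map A Ns p) q = exp_inv A Ns U p q)) \<and>
     smooth_exp_inv A N U \<and> smooth_exp_inv A Ns U"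


section \<open>Divergences and distance\<close>

definition transported_exp_inv ::
  "('m::topological_space, 'n::finite) chart set \<Rightarrow> ('m, 'n) connection \<Rightarrow>
     ('m, 'n) connection \<Rightarrow> 'm set \<Rightarrow> 'm \<Rightarrow> 'm \<Rightarrow> ('m, 'n) tvec" where
  "transported_exp_inv A N Ns U q p =
     parallel_transport A N (geod A Ns U p q) (exp_inv A N U p q)"

definition canonical_divergence ::
  "('m::topological_space, 'n::finite) chart set \<Rightarrow> ('m, 'n) metric \<Rightarrow> ('m, 'n) connection \<Rightarrow>
     ('m, 'n) connection \<Rightarrow> 'm set \<Rightarrow> 'm \<Rightarrow> 'm \<Rightarrow> real" where
  "canonical_divergence A g N Ns U p q =
     (let \<sigma> = geod A N U p q in
        integral {0..1} (\<lambda>t. g (\<sigma> t) (transported_exp_inv A N Ns U (\<sigma> t) p) (velocity A \<sigma> t)))"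

definition energy_divergence ::
  "('m::topological_space, 'n::finite) chart set \<Rightarrow> ('m, 'n) metric \<Rightarrow> ('m, 'n) connection \<Rightarrow>
     'm set \<Rightarrow> 'm \<Rightarrow> 'm \<Rightarrow> real" where
  "energy_divergence A g N U p q =
     (let \<sigma> = geod A N U p q in
        integral {0..1} (\<lambda>t. t * (sqrt (g (\<sigma> t) (velocity A \<sigma> t) (velocity A \<sigma> t)))\<^sup>2))"

text \<open>\<open>dual_work A g N Ns U q p\<close> is \<open>W\<^sup>*(q\<parallel>p)\<close>; note the order of the points.\<close>

definition dual_work ::
  "('m::topological_space, 'n::finite) chart set \<Rightarrow> ('m, 'n) metric \<Rightarrow> ('m, 'n) connection \<Rightarrow>
     ('m, 'n) connection \<Rightarrow> 'm set \<Rightarrow> 'm \<Rightarrow> 'm \<Rightarrow> real" where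
  "dual_work A g N Ns U q p =
     (let \<sigma> = geod A Ns U p q in
        - integral {0..1} (\<lambda>t. g (\<sigma> t) (velocity A \<sigma> t) (exp_inv A N U (\<sigma> t) p)))"

definition C1_curve ::
  "('m::topological_space, 'n::finite) chart set \<Rightarrow> (real \<Rightarrow> 'm) \<Rightarrow> bool" where
  "C1_curve A \<gamma> \<longleftrightarrow> differentiable_curve A \<gamma> \<and>
     (\<forall>c\<in>A. continuous_on {t \<in> {0..1}. \<gamma> t \<in> cdom c} (\<lambda>t. velocity A \<gamma> t c))"

definition curve_length ::
  "('m, 'n::finite) chart set \<Rightarrow> ('m, 'n) metric \<Rightarrow> (real \<Rightarrow> 'm) \<Rightarrow> real" where
  "curve_length A g \<gamma> =
     integral {0..1} (\<lambda>t. sqrt (g (\<gamma> t) (velocity A \<gamma> t) (velocity A \<gamma> t)))"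

text \<open>The Riemannian distance of the Riemannian manifold \<open>U\<close>. It can exceed the distance of the
  ambient manifold: take for \<open>U\<close> the complement of a generator in a flat cylinder.\<close>

definition riemannian_distance ::
  "('m::topological_space, 'n::finite) chart set \<Rightarrow> ('m, 'n) metric \<Rightarrow> 'm set \<Rightarrow>
     'm \<Rightarrow> 'm \<Rightarrow> real" where
  "riemannian_distance A g U p q =
     Inf {curve_length A g \<gamma> |\<gamma>. C1_curve A \<gamma> \<and> \<gamma> ` {0..1} \<subseteq> U \<and> \<gamma> 0 = p \<and> \<gamma> 1 = q}"


section \<open>Dually flat structures\<close>

definition affine_coordinates ::
  "('m, 'n::finite) chart set \<Rightarrow> ('m, 'n) connection \<Rightarrow> 'm set \<Rightarrow> ('m \<Rightarrow> real ^ 'n) \<Rightarrow> bool" where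
  "affine_coordinates A N U x \<longleftrightarrow>
     (U, x) \<in> A \<and>
     (\<forall>p\<in>U. \<forall>i j. N (\<lambda>q. coord_vec A (U, x) q (axis i 1)) (\<lambda>q. coord_vec A (U, x) q (axis j 1)) p
        = tzero)"

definition dually_flat_coordinates ::
  "('m, 'n::finite) chart set \<Rightarrow> ('m, 'n) metric \<Rightarrow> ('m, 'n) connection \<Rightarrow>
     ('m, 'n) connection \<Rightarrow> 'm set \<Rightarrow> ('m \<Rightarrow> real ^ 'n) \<Rightarrow> ('m \<Rightarrow> real ^ 'n) \<Rightarrow>
     ('m \<Rightarrow> real) \<Rightarrow> ('m \<Rightarrow> real) \<Rightarrow> bool" where
  "dually_flat_coordinates A g N Ns U \<theta> \<eta> \<phi> \<phi>s \<longleftrightarrow>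
     affine_coordinates A N U \<theta> \<and> affine_coordinates A Ns U \<eta> \<and>
     smooth_fun A U \<phi> \<and> smooth_fun A U \<phi>s \<and>
     (\<forall>p\<in>U.
        (\<forall>i j. g p (coord_vec A (U, \<theta>) p (axis i 1)) (coord_vec A (U, \<eta>) p (axis j 1))
           = (if i = j then 1 else 0)) \<and>
        (\<forall>i. dir_deriv A p (coord_vec A (U, \<theta>) p (axis i 1)) \<phi> = \<eta> p $ i) \<and>
        (\<forall>i. dir_deriv A p (coord_vec A (U, \<eta>) p (axis i 1)) \<phi>s = \<theta> p $ i) \<and>
        \<phi> p + \<phi>s p - (\<Sum>i\<in>UNIV. \<theta> p $ i * \<eta> p $ i) = 0)"

definition bregman_divergence ::
  "('m \<Rightarrow> real ^ 'n::finite) \<Rightarrow> ('m \<Rightarrow> real ^ 'n) \<Rightarrow> ('m \<Rightarrow> real) \<Rightarrow> ('m \<Rightarrow> real) \<Rightarrow>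
     'm \<Rightarrow> 'm \<Rightarrow> real" where
  "bregman_divergence \<theta> \<eta> \<phi> \<phi>s p q = \<phi> p + \<phi>s q - (\<Sum>i\<in>UNIV. \<theta> p $ i * \<eta> q $ i)"

end

theory Submission
  imports Defs
begin

text \<open>Around a point \<open>p\<close> of \<open>U\<close> the map \<open>exp\<^sub>p\<^sup>-\<^sup>1\<close> is a chart with domain \<open>U\<close>: its image is star-shaped and the
  \<open>\<nabla>\<close>-geodesics from \<open>p\<close> are rays. If the constant vector \<open>x(q)\<close> is parallel along the
  \<open>\<nabla>\<^sup>*\<close>-geodesic from \<open>p\<close> to \<open>q\<close>, for every \<open>q\<close>, then \<open>\<Pi>\<^sub>q(p)\<close> is the end velocity of the
  \<open>\<nabla>\<close>-geodesic and \<open>\<D>(p,q) = D(p,q)\<close>. In the self-dual case both geodesics agree; the distance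
  formula is the Gauss lemma. In the dually flat case the chart \<open>\<theta>\<close> plays the same role, and an
  integration by parts gives the Bregman divergence.

  For (3), \<open>R(X,Y,Y,Y) = 0\<close> and the Bianchi identities of both curvatures make \<open>R(X,Y)\<close> skew for the
  metric. Differentiating this with \<open>\<nabla>\<R> = 0\<close> shows \<open>R K = 0\<close> for \<open>K = \<nabla>\<^sup>* - \<nabla>\<close>, so that \<open>K\<close> takes its
  values in the kernel \<open>F\<close> of \<open>X \<mapsto> R(X,\<cdot>)\<cdot>\<close>. In normal coordinates \<open>F\<close> is a constant subspace that is
  annihilated by the Christoffel symbols, hence \<open>\<nabla>\<close>- and \<open>\<nabla>\<^sup>*\<close>-geodesics from \<open>p\<close> differ only within
  \<open>F\<close> and \<open>x(q)\<close> is parallel along both. Moreover \<open>\<Gamma>(x,\<cdot>)\<close> is self-adjoint, so the one-form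
  \<open>g(x,\<cdot>)\<close> is closed and its integrals along the two geodesics, \<open>D\<close> and \<open>W\<^sup>*\<close>, coincide.\<close>

text \<open>Case (3) has two obstacles. Neither connection need be metric, so the skewness of the
  curvature has to be manufactured; and transport runs along a curve that need not be straight in
  \<nabla>-normal coordinates. The only initial information about the Christoffel symbols there is
  \<open>\<Gamma> x x x = 0\<close>. Its derivative turns curvature along a ray into a Riccati
  equation for t^2 \<open>\<Gamma> (t x) x\<close>. For an argument transported inside F the
  curvature term drops out and a linear equation with initial value 0 remains; for two arguments
  moved by -K, the failure of self-adjointness is conserved, and it is 0 at the centre. The weight
  t^2 hides the singularity of polar coordinates; after dividing it out, the value at t = 0 is
  regained by continuity. The local arguments live on an open set of a Euclidean space, where a
  connection is a family of bilinear maps; the manifold part shows that every chart supplies such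
  data. Maximality of the atlas makes the normal coordinates at \<open>p\<close> a chart on all of
  \<open>U\<close>, so each base point needs only one chart.\<close>

section \<open>Linear ordinary differential equations\<close>

text \<open>Gronwall's argument: exp(-2Ct) |u|^2 is nonincreasing and starts at 0. The bound is
  asked on the open interval only, so it may come from an equation that has been divided by
  t.\<close>

lemma vanishing_derivative_bound_right:
  fixes u :: "real \<Rightarrow> 'a::real_inner"
  assumes cont: "continuous_on {a..b} u"
    and der: "\<And>t. t \<in> {a<..<b} \<Longrightarrow> (u has_vector_derivative F t) (at t)"
    and bound: "\<And>t. t \<in> {a<..<b} \<Longrightarrow> norm (F t) \<le> C * norm (u t)"
    and zero: "u a = 0" and t: "t \<in> {a..b}"
  shows "u t = 0"
proof -
  define \<phi> where "\<phi> s = exp (-2 * C * s) * (u s \<bullet> u s)" for s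
  have "\<phi> t \<le> \<phi> a"
  proof (rule DERIV_nonpos_imp_decreasing_open[where f = \<phi> and a = a and b = t])
    show "a \<le> t" using t by simp
    show "continuous_on {a..t} \<phi>"
      unfolding \<phi>_def using t by (auto intro!: continuous_intros continuous_on_subset[OF cont])
    fix s assume s: "a < s" "s < t"
    then have s': "s \<in> {a<..<b}" using t by auto
    have d: "(u has_derivative (\<lambda>h. h *\<^sub>R F s)) (at s)"
      using der[OF s'] by (simp add: has_vector_derivative_def)
    have "((\<lambda>s. u s \<bullet> u s) has_derivative (\<lambda>h. u s \<bullet> (h *\<^sub>R F s) + (h *\<^sub>R F s) \<bullet> u s)) (at s)"
      by (rule has_derivative_inner[OF d d])
    then have d2: "((\<lambda>s. u s \<bullet> u s) has_real_derivative 2 * (u s \<bullet> F s)) (at s)"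
      unfolding has_field_derivative_def
      by (rule has_derivative_eq_rhs) (auto simp: inner_commute)
    have "(\<phi> has_real_derivative exp (-2 * C * s) * (2 * (u s \<bullet> F s))
        + exp (-2 * C * s) * (-2 * C) * (u s \<bullet> u s)) (at s)"
      unfolding \<phi>_def by (rule d2 derivative_eq_intros | simp)+
    moreover have "exp (-2 * C * s) * (2 * (u s \<bullet> F s))
        + exp (-2 * C * s) * (-2 * C) * (u s \<bullet> u s) \<le> 0"
    proof -
      have "u s \<bullet> F s \<le> norm (u s) * norm (F s)" by (rule norm_cauchy_schwarz)
      also have "\<dots> \<le> norm (u s) * (C * norm (u s))" by (intro mult_left_mono bound s') auto
      also have "\<dots> = C * (u s \<bullet> u s)" by (simp add: power2_norm_eq_inner[symmetric] power2_eq_square)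
      finally have "exp (-2 * C * s) * (2 * (u s \<bullet> F s) - 2 * C * (u s \<bullet> u s)) \<le> 0"
        by (intro mult_nonneg_nonpos) auto
      then show ?thesis by (simp add: algebra_simps)
    qed
    ultimately show "\<exists>y. DERIV \<phi> s :> y \<and> y \<le> 0" by blast
  qed
  then have "exp (-2 * C * t) * (u t \<bullet> u t) \<le> 0" by (simp add: \<phi>_def zero)
  then have "u t \<bullet> u t \<le> 0" by (simp add: mult_le_0_iff)
  then show ?thesis by (metis inner_ge_zero inner_eq_zero_iff order_antisym)
qed

lemma vanishing_derivative_bound:
  fixes u :: "real \<Rightarrow> 'a::real_inner"
  assumes cont: "continuous_on {0..1} u"
    and der: "\<And>t. t \<in> {0<..<1} \<Longrightarrow> (u has_vector_derivative F t) (at t)"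
    and bound: "\<And>t. t \<in> {0<..<1} \<Longrightarrow> norm (F t) \<le> C * norm (u t)"
    and zero: "u t0 = 0" and t0: "t0 \<in> {0..1}" and t: "t \<in> {0..1}"
  shows "u t = 0"
proof (cases "t0 \<le> t")
  case True
  show ?thesis
  proof (rule vanishing_derivative_bound_right[where a = t0 and b = 1 and u = u and F = F and C = C])
    show "continuous_on {t0..1} u" using t0 by (auto intro: continuous_on_subset[OF cont])
  qed (use True t t0 zero in \<open>auto intro!: der bound\<close>)
next
  case False
  \<comment> \<open>To the left of \<open>t0\<close> time is run backwards; reflection changes the
    sign of the derivative and keeps the bound.\<close>
  have "(u \<circ> uminus) (-t) = 0"
  proof (rule vanishing_derivative_bound_right
      [where a = "-t0" and b = 0 and u = "u \<circ> uminus" and F = "\<lambda>s. - F (-s)" and C = C])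
    show "continuous_on {-t0..0} (u \<circ> uminus)"
      using t0 by (intro continuous_on_compose continuous_intros continuous_on_subset[OF cont]) auto
    fix s assume s: "s \<in> {-t0<..<0}"
    then have s': "-s \<in> {0<..<1}" using t0 by auto
    have "((u \<circ> uminus) has_vector_derivative ((-1) *\<^sub>R F (-s))) (at s)"
      by (rule vector_diff_chain_at) (auto intro!: derivative_eq_intros der s')
    then show "((u \<circ> uminus) has_vector_derivative - F (-s)) (at s)" by simp
    show "norm (- F (-s)) \<le> C * norm ((u \<circ> uminus) s)" using bound[OF s'] by simp
  qed (use False t t0 zero in auto)
  then show ?thesis by simp
qed

text \<open>The families \<open>t \<mapsto> L t\<close> of linear maps below are continuous in the strong sense, which in
  finite dimension is continuity in operator norm.\<close>

lemma linear_family_expand: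
  fixes v :: "'a::euclidean_space"
  assumes "linear L"
  shows "L v = (\<Sum>i\<in>Basis. (v \<bullet> i) *\<^sub>R L i)"
proof -
  have "L v = L (\<Sum>i\<in>Basis. (v \<bullet> i) *\<^sub>R i)" by (simp add: euclidean_representation)
  also have "\<dots> = (\<Sum>i\<in>Basis. (v \<bullet> i) *\<^sub>R L i)"
    using assms by (simp add: linear_sum linear_cmul)
  finally show ?thesis .
qed

lemma continuous_on_linear_family:
  fixes L :: "'p::topological_space \<Rightarrow> 'a::euclidean_space \<Rightarrow> 'b::real_normed_vector"
  assumes "\<And>t. t \<in> T \<Longrightarrow> linear (L t)" and "\<And>v. continuous_on T (\<lambda>t. L t v)"
    and "continuous_on T f"
  shows "continuous_on T (\<lambda>t. L t (f t))"
proof -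
  have "continuous_on T (\<lambda>t. \<Sum>i\<in>Basis. (f t \<bullet> i) *\<^sub>R L t i)"
    by (intro continuous_intros assms)
  then show ?thesis
    by (rule continuous_on_cong[THEN iffD1, rotated -1]) (auto simp: linear_family_expand[OF assms(1)])
qed

lemma linear_family_bounded:
  fixes L :: "'p::topological_space \<Rightarrow> 'a::euclidean_space \<Rightarrow> 'b::real_normed_vector"
  assumes lin: "\<And>t. t \<in> T \<Longrightarrow> linear (L t)" and cont: "\<And>v. continuous_on T (\<lambda>t. L t v)"
    and "compact T"
  shows "\<exists>C>0. \<forall>t\<in>T. \<forall>v. norm (L t v) \<le> C * norm v"
proof -
  have "\<exists>M. \<forall>t\<in>T. norm (L t i) \<le> M" for i
  proof -
    have "bounded ((\<lambda>t. L t i) ` T)"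
      by (intro compact_imp_bounded compact_continuous_image cont \<open>compact T\<close>)
    then show ?thesis by (auto simp: bounded_iff)
  qed
  then obtain M where M: "\<And>i t. t \<in> T \<Longrightarrow> norm (L t i) \<le> M i" by metis
  \<comment> \<open>The summand 1 makes \<open>C\<close> strictly positive, so that one may divide
    by it in the existence proof below.\<close>
  define C where "C = (\<Sum>i\<in>Basis. \<bar>M i\<bar>) + 1"
  show ?thesis
  proof (intro exI conjI ballI allI)
    show "0 < C" unfolding C_def by (simp add: sum_nonneg add_nonneg_pos)
    fix t v assume t: "t \<in> T"
    have "norm (L t v) = norm (\<Sum>i\<in>Basis. (v \<bullet> i) *\<^sub>R L t i)"
      by (subst linear_family_expand[OF lin[OF t]]) simp
    also have "\<dots> \<le> (\<Sum>i\<in>Basis. norm ((v \<bullet> i) *\<^sub>R L t i))" by (rule norm_sum)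
    also have "\<dots> \<le> (\<Sum>i\<in>Basis. norm v * \<bar>M i\<bar>)"
    proof (rule sum_mono)
      fix i :: 'a assume i: "i \<in> Basis"
      have "norm (L t i) \<le> \<bar>M i\<bar>" using M[OF t, of i] by linarith
      then show "norm ((v \<bullet> i) *\<^sub>R L t i) \<le> norm v * \<bar>M i\<bar>"
        using Basis_le_norm[OF i, of v] by (simp add: mult_mono)
    qed
    also have "\<dots> \<le> C * norm v" by (simp add: C_def sum_distrib_left[symmetric] algebra_simps)
    finally show "norm (L t v) \<le> C * norm v" .
  qed
qed

lemma linear_ode_unique:
  fixes u :: "real \<Rightarrow> 'a::euclidean_space"
  assumes lin: "\<And>t. t \<in> {0..1} \<Longrightarrow> linear (L t)" and cont: "\<And>v. continuous_on {0..1} (\<lambda>t. L t v)"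
    and u: "continuous_on {0..1} u"
    and der: "\<And>t. t \<in> {0<..<1} \<Longrightarrow> (u has_vector_derivative L t (u t)) (at t)"
    and zero: "u t0 = 0" and t0: "t0 \<in> {0..1}" and t: "t \<in> {0..1}"
  shows "u t = 0"
proof -
  obtain C where "0 < C" "\<And>t v. t \<in> {0..1} \<Longrightarrow> norm (L t v) \<le> C * norm v"
    using linear_family_bounded[OF lin cont compact_Icc] by blast
  then show ?thesis
    by (intro vanishing_derivative_bound[OF u der _ zero t0 t, of C]) auto
qed

lemma vector_derivative_at_interior:
  fixes u :: "real \<Rightarrow> 'a::real_normed_vector"
  assumes "(u has_vector_derivative D) (at t within {0..1})" and "t \<in> {0<..<1}"
  shows "(u has_vector_derivative D) (at t)"
  using assms by (simp add: at_within_Icc_at)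

lemma continuous_on_if_vector_derivative:
  fixes u :: "real \<Rightarrow> 'a::real_normed_vector"
  assumes "\<And>t. t \<in> T \<Longrightarrow> (u has_vector_derivative D t) (at t within T)"
  shows "continuous_on T u"
  unfolding continuous_on_eq_continuous_within
  using has_vector_derivative_continuous[OF assms] by blast

text \<open>Picard's fixed point argument in Bielecki's weighted norm: the unknown is w =
  exp(-\<Lambda>t) u, and the weight makes the integral operator a contraction on all of [0,1] at
  once, so no local solutions have to be glued.\<close>

lemma linear_ode_exists_zero:
  fixes L :: "real \<Rightarrow> 'a::euclidean_space \<Rightarrow> 'a"
  assumes lin: "\<And>t. t \<in> {0..1} \<Longrightarrow> linear (L t)" and cont: "\<And>v. continuous_on {0..1} (\<lambda>t. L t v)"
  shows "\<exists>u. u 0 = v \<and>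
    (\<forall>t\<in>{0..1}. (u has_vector_derivative L t (u t)) (at t within {0..1}))"
proof -
  obtain C where C0: "0 < C" and C: "\<And>t v. t \<in> {0..1} \<Longrightarrow> norm (L t v) \<le> C * norm v"
    using linear_family_bounded[OF lin cont compact_Icc] by blast
  \<comment> \<open>Integrating C exp(\<Lambda>\<tau>) gives at most (C/\<Lambda>) exp(\<Lambda>s),
    so this value yields the contraction factor 1/2.\<close>
  define \<Lambda> where "\<Lambda> = 2 * C"
  have \<Lambda>: "0 < \<Lambda>" using C0 by (simp add: \<Lambda>_def)
  \<comment> \<open>Bounded continuous functions form a complete space of functions on the whole
    line; clamping the time extends a function on [0,1] constantly beyond both ends.\<close>
  define cl where "cl t = max 0 (min 1 t)" for t :: real
  have cl: "cl t \<in> {0..1}" "t \<in> {0..1} \<Longrightarrow> cl t = t" for t by (auto simp: cl_def)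
  have cl_cont: "continuous_on UNIV cl" unfolding cl_def by (intro continuous_intros)
  define I where "I w s = integral {0..s} (\<lambda>\<tau>. L \<tau> (exp (\<Lambda> * \<tau>) *\<^sub>R w \<tau>))" for w :: "real \<Rightarrow> 'a" and s
  have ci: "continuous_on {0..1} (\<lambda>\<tau>. L \<tau> (exp (\<Lambda> * \<tau>) *\<^sub>R w \<tau>))"
    if "continuous_on {0..1} w" for w
    by (rule continuous_on_linear_family[OF lin cont]) (auto intro!: continuous_intros that)
  have Ic: "continuous_on {0..1} (I w)" if "continuous_on {0..1} w" for w
    unfolding I_def
    by (rule indefinite_integral_continuous_1[OF integrable_continuous_interval[OF ci[OF that]]])
  define T0 where "T0 w t = exp (- (\<Lambda> * cl t)) *\<^sub>R (v + I w (cl t))" for w :: "real \<Rightarrow> 'a" and t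
  have T0: "T0 (apply_bcontfun w) \<in> bcontfun" for w :: "real \<Rightarrow>\<^sub>C 'a"
  proof -
    have 1: "continuous_on {0..1} (\<lambda>s. exp (- (\<Lambda> * s)) *\<^sub>R (v + I (apply_bcontfun w) s))"
      by (intro continuous_intros Ic) auto
    have "continuous_on UNIV (T0 w)"
      unfolding T0_def
      by (rule continuous_on_compose2[OF 1 cl_cont]) (use cl in auto)
    moreover have "bounded (range (T0 w))"
    proof -
      have "bounded ((\<lambda>s. exp (- (\<Lambda> * s)) *\<^sub>R (v + I (apply_bcontfun w) s)) ` {0..1})"
        by (intro compact_imp_bounded compact_continuous_image 1) auto
      then show ?thesis by (rule bounded_subset) (use cl in \<open>auto simp: T0_def\<close>)
    qed
    ultimately show ?thesis by (simp add: bcontfun_def)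
  qed
  define T where "T w = Bcontfun (T0 (apply_bcontfun w))" for w
  have T: "apply_bcontfun (T w) = T0 (apply_bcontfun w)" for w
    unfolding T_def by (rule Bcontfun_inverse[OF T0])
  have contr: "dist (T w) (T w') \<le> 1/2 * dist w w'" for w w'
  proof (rule dist_bound)
    fix t
    let ?s = "cl t" let ?d = "dist w w'"
    have s: "0 \<le> ?s" "?s \<le> 1" using cl(1)[of t] by auto
    have int: "(\<lambda>\<tau>. L \<tau> (exp (\<Lambda> * \<tau>) *\<^sub>R z \<tau>)) integrable_on {0..?s}"
      if "continuous_on {0..1} z" for z
      using s by (intro integrable_continuous_interval continuous_on_subset[OF ci[OF that]]) auto
    have "I w ?s - I w' ?s = integral {0..?s}
        (\<lambda>\<tau>. L \<tau> (exp (\<Lambda> * \<tau>) *\<^sub>R w \<tau>) - L \<tau> (exp (\<Lambda> * \<tau>) *\<^sub>R w' \<tau>))"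
      unfolding I_def by (intro integral_diff[symmetric] int) auto
    also have "norm \<dots> \<le> integral {0..?s} (\<lambda>\<tau>. C * (exp (\<Lambda> * \<tau>) * ?d))"
    proof (rule integral_norm_bound_integral)
      show "(\<lambda>\<tau>. L \<tau> (exp (\<Lambda> * \<tau>) *\<^sub>R w \<tau>) - L \<tau> (exp (\<Lambda> * \<tau>) *\<^sub>R w' \<tau>)) integrable_on {0..?s}"
        by (intro integrable_diff int) auto
      show "(\<lambda>\<tau>. C * (exp (\<Lambda> * \<tau>) * ?d)) integrable_on {0..?s}"
        by (intro integrable_continuous_interval continuous_intros)
      fix \<tau> assume "\<tau> \<in> {0..?s}"
      then have \<tau>: "\<tau> \<in> {0..1}" using s by auto
      have "L \<tau> (exp (\<Lambda> * \<tau>) *\<^sub>R w \<tau>) - L \<tau> (exp (\<Lambda> * \<tau>) *\<^sub>R w' \<tau>)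
          = L \<tau> (exp (\<Lambda> * \<tau>) *\<^sub>R (w \<tau> - w' \<tau>))"
        using lin[OF \<tau>] by (simp add: linear_diff scaleR_diff_right)
      also have "norm \<dots> \<le> C * (exp (\<Lambda> * \<tau>) * norm (w \<tau> - w' \<tau>))"
        using C[OF \<tau>, of "exp (\<Lambda> * \<tau>) *\<^sub>R (w \<tau> - w' \<tau>)"] by simp
      also have "\<dots> \<le> C * (exp (\<Lambda> * \<tau>) * ?d)"
        using C0 dist_bounded[of w \<tau> w'] by (simp add: dist_norm)
      finally show "norm (L \<tau> (exp (\<Lambda> * \<tau>) *\<^sub>R w \<tau>) - L \<tau> (exp (\<Lambda> * \<tau>) *\<^sub>R w' \<tau>))
          \<le> C * (exp (\<Lambda> * \<tau>) * ?d)" .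
    qed
    also have "\<dots> = C * ?d / \<Lambda> * exp (\<Lambda> * ?s) - C * ?d / \<Lambda> * exp (\<Lambda> * 0)"
    proof (rule integral_unique, rule fundamental_theorem_of_calculus)
      fix \<tau> :: real
      have "((\<lambda>\<tau>. C * ?d / \<Lambda> * exp (\<Lambda> * \<tau>)) has_real_derivative C * (exp (\<Lambda> * \<tau>) * ?d)) (at \<tau> within {0..?s})"
        using \<Lambda> by (auto intro!: derivative_eq_intros simp: field_simps)
      then show "((\<lambda>\<tau>. C * ?d / \<Lambda> * exp (\<Lambda> * \<tau>)) has_vector_derivative C * (exp (\<Lambda> * \<tau>) * ?d)) (at \<tau> within {0..?s})"
        by (simp add: has_real_derivative_iff_has_vector_derivative)
    qed (use s in auto)
    also have "\<dots> \<le> 1/2 * ?d * exp (\<Lambda> * ?s)"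
      using C0 by (simp add: \<Lambda>_def field_simps)
    finally have *: "norm (I w ?s - I w' ?s) \<le> 1/2 * ?d * exp (\<Lambda> * ?s)" .
    have "dist (T w t) (T w' t) = exp (- (\<Lambda> * ?s)) * norm (I w ?s - I w' ?s)"
      by (simp add: T T0_def dist_norm scaleR_diff_right[symmetric])
    also have "\<dots> \<le> exp (- (\<Lambda> * ?s)) * (1/2 * ?d * exp (\<Lambda> * ?s))"
      using * by simp
    also have "\<dots> = 1/2 * ?d" by (simp add: exp_minus)
    finally show "dist (T w t) (T w' t) \<le> 1/2 * ?d" .
  qed
  have "\<exists>!w. T w = w"
    by (rule banach_fix_type[where c = "1/2"]) (use contr in auto)
  then obtain w where w: "T w = w" by blast
  define u where "u t = exp (\<Lambda> * t) *\<^sub>R w t" for t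
  have u: "u t = v + integral {0..t} (\<lambda>\<tau>. L \<tau> (u \<tau>))" if t: "t \<in> {0..1}" for t
  proof -
    have "w t = exp (- (\<Lambda> * t)) *\<^sub>R (v + I w t)"
      using T[of w] cl(2)[OF t] unfolding w by (metis T0_def)
    then have "u t = (exp (\<Lambda> * t) * exp (- (\<Lambda> * t))) *\<^sub>R (v + I w t)" by (simp add: u_def)
    also have "exp (\<Lambda> * t) * exp (- (\<Lambda> * t)) = 1" by (simp add: exp_minus)
    finally show ?thesis by (simp add: I_def u_def)
  qed
  have uc: "continuous_on {0..1} u" unfolding u_def by (intro continuous_intros) auto
  have "(u has_vector_derivative L t (u t)) (at t within {0..1})" if t: "t \<in> {0..1}" for t
  proof -
    have "((\<lambda>x. integral {0..x} (\<lambda>\<tau>. L \<tau> (u \<tau>))) has_vector_derivative L t (u t)) (at t within {0..1})"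
      by (rule integral_has_vector_derivative[OF _ t])
        (rule continuous_on_linear_family[OF lin cont uc])
    then have "((\<lambda>x. v + integral {0..x} (\<lambda>\<tau>. L \<tau> (u \<tau>))) has_vector_derivative L t (u t)) (at t within {0..1})"
      by (auto intro!: derivative_eq_intros)
    then show ?thesis by (rule has_vector_derivative_transform[OF t, rotated]) (use u in auto)
  qed
  moreover have "u 0 = v" using u[of 0] by simp
  ultimately show ?thesis by blast
qed

text \<open>The map from the value at 0 to the value at \<open>t0\<close> is linear, and injective
  by uniqueness; in finite dimension it is then onto, so every value at \<open>t0\<close> is
  attained.\<close>

lemma linear_ode_exists:
  fixes L :: "real \<Rightarrow> 'a::euclidean_space \<Rightarrow> 'a"
  assumes lin: "\<And>t. t \<in> {0..1} \<Longrightarrow> linear (L t)" and cont: "\<And>v. continuous_on {0..1} (\<lambda>t. L t v)"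
    and t0: "t0 \<in> {0..1}"
  shows "\<exists>u. u t0 = v \<and>
    (\<forall>t\<in>{0..1}. (u has_vector_derivative L t (u t)) (at t within {0..1}))"
proof -
  obtain E where E0: "\<And>v. E v 0 = v"
    and E: "\<And>v t. t \<in> {0..1} \<Longrightarrow> (E v has_vector_derivative L t (E v t)) (at t within {0..1})"
    using linear_ode_exists_zero[OF lin cont] by metis
  have uniq: "z t = 0" if "\<And>t. t \<in> {0..1} \<Longrightarrow> (z has_vector_derivative L t (z t)) (at t within {0..1})"
    and "z s = 0" "s \<in> {0..1}" "t \<in> {0..1}" for z s t
  proof (rule linear_ode_unique[where L = L and u = z, OF lin cont _ _ that(2-4)])
    show "continuous_on {0..1} z" by (rule continuous_on_if_vector_derivative[OF that(1)])
    show "(z has_vector_derivative L t (z t)) (at t)" if "t \<in> {0<..<1}" for t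
      using vector_derivative_at_interior[OF \<open>\<And>t. t \<in> {0..1} \<Longrightarrow> (z has_vector_derivative L t (z t)) (at t within {0..1})\<close>] that
      by auto
  qed auto
  have "E (a + b) t0 = E a t0 + E b t0" for a b
  proof -
    have "E (a + b) t0 - (E a t0 + E b t0) = 0"
    proof (rule uniq[where s = 0 and t = t0 and z = "\<lambda>t. E (a + b) t - (E a t + E b t)"])
      fix t :: real assume t: "t \<in> {0..1}"
      have "L t (E (a + b) t - (E a t + E b t)) = L t (E (a + b) t) - (L t (E a t) + L t (E b t))"
        using lin[OF t] by (simp add: linear_diff linear_add)
      then show "((\<lambda>t. E (a + b) t - (E a t + E b t)) has_vector_derivative
          L t (E (a + b) t - (E a t + E b t))) (at t within {0..1})"
        by (auto intro!: derivative_eq_intros E t)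
    qed (use t0 E0 in auto)
    then show ?thesis by simp
  qed
  moreover have "E (r *\<^sub>R a) t0 = r *\<^sub>R E a t0" for r a
  proof -
    have "E (r *\<^sub>R a) t0 - r *\<^sub>R E a t0 = 0"
    proof (rule uniq[where s = 0 and t = t0 and z = "\<lambda>t. E (r *\<^sub>R a) t - r *\<^sub>R E a t"])
      fix t :: real assume t: "t \<in> {0..1}"
      have "L t (E (r *\<^sub>R a) t - r *\<^sub>R E a t) = L t (E (r *\<^sub>R a) t) - r *\<^sub>R L t (E a t)"
        using lin[OF t] by (simp add: linear_diff linear_cmul)
      then show "((\<lambda>t. E (r *\<^sub>R a) t - r *\<^sub>R E a t) has_vector_derivative
          L t (E (r *\<^sub>R a) t - r *\<^sub>R E a t)) (at t within {0..1})"
        by (auto intro!: derivative_eq_intros E t)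
    qed (use t0 E0 in auto)
    then show ?thesis by simp
  qed
  ultimately have linE: "linear (\<lambda>v. E v t0)" by (intro linearI)
  have "inj (\<lambda>v. E v t0)"
    unfolding linear_injective_0[OF linE]
    using uniq[of "E _" t0 0] E t0 E0 by (metis atLeastAtMost_iff order_refl zero_le_one)
  then have "surj (\<lambda>v. E v t0)" by (rule linear_injective_imp_surjective[OF linE _ refl])
  then obtain v0 where "E v0 t0 = v" by (metis surjD)
  then show ?thesis using E by (intro exI[of _ "E v0"]) auto
qed

section \<open>Calculus in finite dimension: product rules, mixed derivatives, smoothness\<close>

section \<open>Derivatives of families of linear maps\<close>

text \<open>Differentiability of \<open>L y v\<close> for each fixed \<open>v\<close> is enough: in
  a basis, \<open>L y (f y)\<close> is a finite sum of coordinates of \<open>f y\<close> times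
  vectors \<open>L y i\<close>.\<close>

lemma has_derivative_linear_family:
  fixes L :: "'p::real_normed_vector \<Rightarrow> 'a::euclidean_space \<Rightarrow> 'b::real_normed_vector"
  assumes lin: "\<And>y. y \<in> T \<Longrightarrow> linear (L y)" and x: "x \<in> T" and lin': "\<And>w. linear (L' w)"
    and L: "\<And>v. ((\<lambda>y. L y v) has_derivative (\<lambda>w. L' w v)) (at x within T)"
    and f: "(f has_derivative f') (at x within T)"
  shows "((\<lambda>y. L y (f y)) has_derivative (\<lambda>w. L' w (f x) + L x (f' w))) (at x within T)"
proof -
  have "((\<lambda>y. \<Sum>i\<in>Basis. (f y \<bullet> i) *\<^sub>R L y i) has_derivative
      (\<lambda>w. \<Sum>i\<in>Basis. (f x \<bullet> i) *\<^sub>R L' w i + (f' w \<bullet> i) *\<^sub>R L x i)) (at x within T)"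
    by (intro has_derivative_sum has_derivative_scaleR has_derivative_inner_left f L)
  then have "((\<lambda>y. \<Sum>i\<in>Basis. (f y \<bullet> i) *\<^sub>R L y i) has_derivative
      (\<lambda>w. L' w (f x) + L x (f' w))) (at x within T)"
    by (simp add: linear_family_expand[OF lin', of _ "f x"] linear_family_expand[OF lin[OF x], of "f' _"]
        sum.distrib)
  then show ?thesis
    by (rule has_derivative_transform[OF x, rotated])
      (use linear_family_expand[OF lin] in auto)
qed

lemma derivative_linear_in_parameter:
  fixes L :: "'p::real_normed_vector \<Rightarrow> 'a::real_normed_vector \<Rightarrow> 'b::real_normed_vector"
  assumes lin: "\<And>y. y \<in> S \<Longrightarrow> linear (L y)" and S: "open S" "x \<in> S"
    and L: "\<And>v. ((\<lambda>y. L y v) has_derivative L' v) (at x)"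
  shows "linear (\<lambda>v. L' v w)"
proof (rule linearI)
  fix a b
  have "((\<lambda>y. L y a + L y b) has_derivative (\<lambda>w. L' a w + L' b w)) (at x)"
    by (intro derivative_intros L)
  then have "((\<lambda>y. L y (a + b)) has_derivative (\<lambda>w. L' a w + L' b w)) (at x)"
    by (rule has_derivative_transform_within_open[OF _ S]) (auto simp: linear_add[OF lin])
  then have "L' (a + b) = (\<lambda>w. L' a w + L' b w)" by (rule has_derivative_unique[OF L])
  then show "L' (a + b) w = L' a w + L' b w" by simp
next
  fix r a
  have "((\<lambda>y. r *\<^sub>R L y a) has_derivative (\<lambda>w. r *\<^sub>R L' a w)) (at x)"
    by (intro derivative_intros L)
  then have "((\<lambda>y. L y (r *\<^sub>R a)) has_derivative (\<lambda>w. r *\<^sub>R L' a w)) (at x)"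
    by (rule has_derivative_transform_within_open[OF _ S]) (auto simp: linear_cmul[OF lin])
  then have "L' (r *\<^sub>R a) = (\<lambda>w. r *\<^sub>R L' a w)" by (rule has_derivative_unique[OF L])
  then show "L' (r *\<^sub>R a) w = r *\<^sub>R L' a w" by simp
qed

section \<open>Symmetry of second derivatives\<close>

text \<open>The second difference is symmetric in \<open>a\<close> and \<open>b\<close>, so it can
  be evaluated in both orders; this is what identifies the two mixed derivatives. The mean value
  theorem is used first in direction \<open>a\<close>, then in direction \<open>b\<close>.\<close>

lemma second_difference_mvt:
  fixes f :: "'a::real_normed_vector \<Rightarrow> real"
  assumes h: "0 < h"
    and P: "\<And>s t. s \<in> {0..h} \<Longrightarrow> t \<in> {0..h} \<Longrightarrow> x + s *\<^sub>R a + t *\<^sub>R b \<in> S"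
    and f: "\<And>y. y \<in> S \<Longrightarrow> (f has_derivative Df y) (at y)"
    and fa: "\<And>y. y \<in> S \<Longrightarrow> ((\<lambda>z. Df z a) has_derivative Da y) (at y)"
  shows "\<exists>s\<in>{0..h}. \<exists>t\<in>{0..h}.
    f (x + h *\<^sub>R a + h *\<^sub>R b) - f (x + h *\<^sub>R a) - f (x + h *\<^sub>R b) + f x
      = h * h * Da (x + s *\<^sub>R a + t *\<^sub>R b) b"
proof -
  have line: "((\<lambda>s. F (c + s *\<^sub>R d)) has_real_derivative D d) (at s)"
    if "(F has_derivative D) (at (c + s *\<^sub>R d))" for F :: "'a \<Rightarrow> real" and D c d s
  proof -
    have "((\<lambda>s. c + s *\<^sub>R d) has_derivative (\<lambda>r. r *\<^sub>R d)) (at s)"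
      by (auto intro!: derivative_eq_intros)
    from has_derivative_compose[OF this that]
    have "((\<lambda>s. F (c + s *\<^sub>R d)) has_derivative (\<lambda>r. D (r *\<^sub>R d))) (at s)" .
    moreover have "D (r *\<^sub>R d) = D d * r" for r
      using linear_cmul[OF has_derivative_linear[OF that]] by simp
    ultimately show ?thesis by (simp add: has_field_derivative_def)
  qed
  let ?\<phi> = "\<lambda>s. f ((x + h *\<^sub>R b) + s *\<^sub>R a) - f (x + s *\<^sub>R a)"
  have "\<exists>s. 0 < s \<and> s < h \<and> ?\<phi> h - ?\<phi> 0
      = (h - 0) * (Df ((x + h *\<^sub>R b) + s *\<^sub>R a) a - Df (x + s *\<^sub>R a) a)"
  proof (rule MVT2[OF h])
    fix s assume s: "0 \<le> s" "s \<le> h"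
    show "(?\<phi> has_real_derivative Df ((x + h *\<^sub>R b) + s *\<^sub>R a) a - Df (x + s *\<^sub>R a) a) (at s)"
      using P[of s h] P[of s 0] s h by (intro DERIV_diff line f) (auto simp: algebra_simps)
  qed
  then obtain s where s: "0 < s" "s < h"
    and 1: "?\<phi> h - ?\<phi> 0 = h * (Df ((x + h *\<^sub>R b) + s *\<^sub>R a) a - Df (x + s *\<^sub>R a) a)" by auto
  have "\<exists>t. 0 < t \<and> t < h \<and> Df ((x + s *\<^sub>R a) + h *\<^sub>R b) a - Df ((x + s *\<^sub>R a) + 0 *\<^sub>R b) a
      = (h - 0) * Da ((x + s *\<^sub>R a) + t *\<^sub>R b) b"
  proof (rule MVT2[OF h])
    fix t assume t: "0 \<le> t" "t \<le> h"
    show "((\<lambda>t. Df ((x + s *\<^sub>R a) + t *\<^sub>R b) a) has_real_derivative Da ((x + s *\<^sub>R a) + t *\<^sub>R b) b) (at t)"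
      using P[of s t] s t by (intro line fa) auto
  qed
  then obtain t where t: "0 < t" "t < h"
    and 2: "Df ((x + s *\<^sub>R a) + h *\<^sub>R b) a - Df (x + s *\<^sub>R a) a = h * Da ((x + s *\<^sub>R a) + t *\<^sub>R b) b" by auto
  have 3: "(x + h *\<^sub>R b) + r *\<^sub>R a = (x + r *\<^sub>R a) + h *\<^sub>R b" for r by simp
  have "?\<phi> h - ?\<phi> 0 = h * (h * Da (x + s *\<^sub>R a + t *\<^sub>R b) b)"
    using 1 2 by (simp add: 3)
  then show ?thesis
    using s t by (intro bexI[of _ s] bexI[of _ t]) (auto simp: 3)
qed

lemma second_derivative_symmetric_real:
  fixes f :: "'a::real_normed_vector \<Rightarrow> real"
  assumes S: "open S" "x \<in> S"
    and f: "\<And>y. y \<in> S \<Longrightarrow> (f has_derivative Df y) (at y)"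
    and fa: "\<And>y. y \<in> S \<Longrightarrow> ((\<lambda>z. Df z a) has_derivative Da y) (at y)"
    and fb: "\<And>y. y \<in> S \<Longrightarrow> ((\<lambda>z. Df z b) has_derivative Db y) (at y)"
    and ca: "continuous_on S (\<lambda>y. Da y b)" and cb: "continuous_on S (\<lambda>y. Db y a)"
  shows "Da x b = Db x a"
proof (rule ccontr)
  assume ne: "Da x b \<noteq> Db x a"
  define e where "e = \<bar>Da x b - Db x a\<bar> / 2"
  have e: "0 < e" using ne by (simp add: e_def)
  obtain d0 where d0: "0 < d0" "ball x d0 \<subseteq> S" using S open_contains_ball by blast
  obtain d1 where d1: "0 < d1" "\<And>y. y \<in> S \<Longrightarrow> dist y x < d1 \<Longrightarrow> dist (Da y b) (Da x b) < e"
    using ca S(2) e unfolding continuous_on_iff by metis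
  obtain d2 where d2: "0 < d2" "\<And>y. y \<in> S \<Longrightarrow> dist y x < d2 \<Longrightarrow> dist (Db y a) (Db x a) < e"
    using cb S(2) e unfolding continuous_on_iff by metis
  define d where "d = Min {d0, d1, d2}"
  have d: "0 < d" "d \<le> d0" "d \<le> d1" "d \<le> d2" using d0 d1 d2 by (auto simp: d_def)
  \<comment> \<open>With this side length the whole parallelogram spanned at \<open>x\<close> stays
    within distance \<open>d\<close> of \<open>x\<close>.\<close>
  define h where "h = d / (norm a + norm b + 1)"
  have n1: "0 < norm a + norm b + 1" by (simp add: add_nonneg_pos)
  have h: "0 < h" using d n1 by (simp add: h_def)
  have near: "norm (s *\<^sub>R a + t *\<^sub>R b) < d" if "s \<in> {0..h}" "t \<in> {0..h}" for s t
  proof -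
    have "norm (s *\<^sub>R a + t *\<^sub>R b) \<le> norm (s *\<^sub>R a) + norm (t *\<^sub>R b)" by (rule norm_triangle_ineq)
    also have "\<dots> \<le> h * norm a + h * norm b" using that by (auto intro!: add_mono mult_right_mono)
    also have "\<dots> < h * (norm a + norm b + 1)" using h by (simp add: algebra_simps)
    also have "\<dots> = d" using n1 by (simp add: h_def)
    finally show ?thesis .
  qed
  have dst: "dist (x + s *\<^sub>R a + t *\<^sub>R b) x < d" if "s \<in> {0..h}" "t \<in> {0..h}" for s t
    using near[OF that] by (simp add: dist_norm add.assoc)
  have P: "x + s *\<^sub>R a + t *\<^sub>R b \<in> S" if "s \<in> {0..h}" "t \<in> {0..h}" for s t
    using dst[OF that] d d0 by (auto simp: dist_commute subset_iff)
  obtain s t where st: "s \<in> {0..h}" "t \<in> {0..h}"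
    and 1: "f (x + h *\<^sub>R a + h *\<^sub>R b) - f (x + h *\<^sub>R a) - f (x + h *\<^sub>R b) + f x
      = h * h * Da (x + s *\<^sub>R a + t *\<^sub>R b) b"
    using second_difference_mvt[OF h P f fa] by metis
  have P': "x + s *\<^sub>R b + t *\<^sub>R a \<in> S" if "s \<in> {0..h}" "t \<in> {0..h}" for s t
    using P[OF that(2,1)] by (simp add: algebra_simps)
  obtain s' t' where st': "s' \<in> {0..h}" "t' \<in> {0..h}"
    and 2: "f (x + h *\<^sub>R b + h *\<^sub>R a) - f (x + h *\<^sub>R b) - f (x + h *\<^sub>R a) + f x
      = h * h * Db (x + s' *\<^sub>R b + t' *\<^sub>R a) a"
    using second_difference_mvt[OF h P' f fb] by metis
  have sw: "x + h *\<^sub>R b + h *\<^sub>R a = x + h *\<^sub>R a + h *\<^sub>R b"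
    "x + s' *\<^sub>R b + t' *\<^sub>R a = x + t' *\<^sub>R a + s' *\<^sub>R b" by simp_all
  have "h * h * Da (x + s *\<^sub>R a + t *\<^sub>R b) b = h * h * Db (x + t' *\<^sub>R a + s' *\<^sub>R b) a"
    using 1 2 unfolding sw by linarith
  then have eq: "Da (x + s *\<^sub>R a + t *\<^sub>R b) b = Db (x + t' *\<^sub>R a + s' *\<^sub>R b) a" using h by simp
  have "dist (Da (x + s *\<^sub>R a + t *\<^sub>R b) b) (Da x b) < e"
    using P[OF st] dst[OF st] d by (intro d1) auto
  moreover have "dist (Db (x + t' *\<^sub>R a + s' *\<^sub>R b) a) (Db x a) < e"
    using P[OF st'(2,1)] dst[OF st'(2,1)] d by (intro d2) auto
  ultimately have "dist (Da x b) (Db x a) < e + e"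
    unfolding eq by (metis add_strict_mono dist_commute dist_triangle order_le_less_trans)
  then show False by (simp add: dist_real_def e_def)
qed

lemma second_derivative_symmetric:
  fixes f :: "'a::real_normed_vector \<Rightarrow> 'b::euclidean_space"
  assumes S: "open S" "x \<in> S"
    and f: "\<And>y. y \<in> S \<Longrightarrow> (f has_derivative Df y) (at y)"
    and fa: "\<And>y. y \<in> S \<Longrightarrow> ((\<lambda>z. Df z a) has_derivative Da y) (at y)"
    and fb: "\<And>y. y \<in> S \<Longrightarrow> ((\<lambda>z. Df z b) has_derivative Db y) (at y)"
    and ca: "continuous_on S (\<lambda>y. Da y b)" and cb: "continuous_on S (\<lambda>y. Db y a)"
  shows "Da x b = Db x a"
proof (rule euclidean_eqI)
  fix i :: 'b
  show "Da x b \<bullet> i = Db x a \<bullet> i"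
    by (rule second_derivative_symmetric_real[OF S, where f = "\<lambda>y. f y \<bullet> i" and Df = "\<lambda>y w. Df y w \<bullet> i"
          and Da = "\<lambda>y w. Da y w \<bullet> i" and Db = "\<lambda>y w. Db y w \<bullet> i"])
      (intro has_derivative_inner_left f fa fb continuous_intros ca cb; assumption)+
qed

section \<open>Smooth maps\<close>

text \<open>\<open>k_smooth_on\<close> uses full derivatives at points of \<open>S\<close>; since
  \<open>S\<close> is open, they depend only on the values in \<open>S\<close>.\<close>

lemma k_smooth_on_cong:
  assumes "open S" "\<And>x. x \<in> S \<Longrightarrow> f x = g x" "k_smooth_on k S f"
  shows "k_smooth_on k S g"
  using assms(2,3)
proof (induction k arbitrary: f g)
  case 0
  then show ?case by (simp cong: continuous_on_cong)
next
  case (Suc k)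
  have d: "(g has_derivative frechet_derivative f (at x)) (at x)" if x: "x \<in> S" for x
  proof -
    have "(f has_derivative frechet_derivative f (at x)) (at x)"
      using Suc.prems x by (auto simp: frechet_derivative_works[symmetric])
    then show ?thesis
      by (rule has_derivative_transform_within_open[OF _ \<open>open S\<close> x]) (use Suc.prems in auto)
  qed
  then have e: "frechet_derivative g (at x) = frechet_derivative f (at x)" if "x \<in> S" for x
    using that frechet_derivative_at by metis
  show ?case
  proof (simp, intro conjI ballI allI)
    show "g differentiable at x" if "x \<in> S" for x using d[OF that] differentiableI by blast
    fix v
    show "k_smooth_on k S (\<lambda>x. frechet_derivative g (at x) v)"
      by (rule Suc.IH[of "\<lambda>x. frechet_derivative f (at x) v"]) (use e Suc.prems in auto)
  qed
qed

lemma k_smooth_on_Suc_I: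
  assumes "open S" "\<And>x. x \<in> S \<Longrightarrow> (f has_derivative f' x) (at x)"
    "\<And>v. k_smooth_on k S (\<lambda>x. f' x v)"
  shows "k_smooth_on (Suc k) S f"
proof -
  have e: "f' x = frechet_derivative f (at x)" if "x \<in> S" for x
    using assms(2)[OF that] by (rule frechet_derivative_at)
  have "k_smooth_on k S (\<lambda>x. frechet_derivative f (at x) v)" for v
    by (rule k_smooth_on_cong[OF assms(1) _ assms(3)[of v]]) (simp add: e)
  then show ?thesis using assms(2) by (auto intro: differentiableI)
qed

lemma k_smooth_on_SucD:
  assumes "k_smooth_on (Suc k) S f"
  shows "x \<in> S \<Longrightarrow> (f has_derivative frechet_derivative f (at x)) (at x)"
    "k_smooth_on k S (\<lambda>x. frechet_derivative f (at x) v)"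
  using assms by (auto simp: frechet_derivative_works[symmetric])

lemma k_smooth_on_less: "k_smooth_on (Suc k) S f \<Longrightarrow> k_smooth_on k S f"
proof (induction k arbitrary: f)
  case 0
  then show ?case
    by (auto intro!: continuous_at_imp_continuous_on differentiable_imp_continuous_within)
next
  case (Suc k)
  then show ?case by simp
qed

lemma k_smooth_on_subset: "T \<subseteq> S \<Longrightarrow> k_smooth_on k S f \<Longrightarrow> k_smooth_on k T f"
  by (induction k arbitrary: f) (auto intro: continuous_on_subset)

lemma k_smooth_on_const: "open S \<Longrightarrow> k_smooth_on k S (\<lambda>x. c)"
proof (induction k arbitrary: c)
  case (Suc k)
  show ?case by (rule k_smooth_on_Suc_I[OF Suc.prems has_derivative_const Suc.IH[OF Suc.prems]])
qed auto

lemma k_smooth_on_add: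
  assumes "open S"
  shows "k_smooth_on k S f \<Longrightarrow> k_smooth_on k S g \<Longrightarrow> k_smooth_on k S (\<lambda>x. f x + g x)"
proof (induction k arbitrary: f g)
  case 0 then show ?case by (auto intro: continuous_intros)
next
  case (Suc k)
  note D = k_smooth_on_SucD[OF Suc.prems(1)] k_smooth_on_SucD[OF Suc.prems(2)]
  show ?case
    by (rule k_smooth_on_Suc_I[OF assms has_derivative_add[OF D(1,3)]], assumption, assumption)
      (intro Suc.IH D)
qed

lemma k_smooth_on_bilinear:
  assumes "bounded_bilinear pr" "open S"
  shows "k_smooth_on k S f \<Longrightarrow> k_smooth_on k S g \<Longrightarrow> k_smooth_on k S (\<lambda>x. pr (f x) (g x))"
proof (induction k arbitrary: f g)
  case 0 then show ?case using bounded_bilinear.continuous_on[OF assms(1)] by auto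
next
  case (Suc k)
  note D = k_smooth_on_SucD[OF Suc.prems(1)] k_smooth_on_SucD[OF Suc.prems(2)]
  show ?case
    by (rule k_smooth_on_Suc_I[OF assms(2) bounded_bilinear.FDERIV[OF assms(1) D(1,3)]], assumption, assumption)
      (intro k_smooth_on_add assms Suc.IH D k_smooth_on_less[OF Suc.prems(1)] k_smooth_on_less[OF Suc.prems(2)])
qed

lemma k_smooth_on_bounded_linear_comp:
  assumes "bounded_linear h" "open S"
  shows "k_smooth_on k S f \<Longrightarrow> k_smooth_on k S (\<lambda>x. h (f x))"
proof (induction k arbitrary: f)
  case 0 then show ?case using bounded_linear.continuous_on[OF assms(1)] by auto
next
  case (Suc k)
  note D = k_smooth_on_SucD[OF Suc.prems(1)]
  show ?case
    by (rule k_smooth_on_Suc_I[OF assms(2) bounded_linear.has_derivative[OF assms(1) D(1)]], assumption)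
      (intro Suc.IH D)
qed

lemma k_smooth_on_sum:
  assumes "open S"
  shows "(\<And>i. i \<in> I \<Longrightarrow> k_smooth_on k S (f i)) \<Longrightarrow> k_smooth_on k S (\<lambda>x. \<Sum>i\<in>I. f i x)"
  by (induction I rule: infinite_finite_induct) (auto intro!: k_smooth_on_const k_smooth_on_add assms)

text \<open>The chain rule feeds a moving vector into the derivative of \<open>f\<close>. Expanding
  that vector in a basis leaves products of coordinates with compositions of one order less, to
  which the induction hypothesis applies.\<close>

lemma k_smooth_on_comp:
  fixes g :: "'a::real_normed_vector \<Rightarrow> 'b::euclidean_space"
    and f :: "'b \<Rightarrow> 'c::real_normed_vector"
  assumes "open S" "open T" "g ` S \<subseteq> T"
  shows "k_smooth_on k T f \<Longrightarrow> k_smooth_on k S g \<Longrightarrow> k_smooth_on k S (\<lambda>x. f (g x))"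
proof (induction k arbitrary: f)
  case 0 then show ?case using assms by (auto intro: continuous_on_compose2)
next
  case (Suc k)
  note D = k_smooth_on_SucD[OF Suc.prems(1)] k_smooth_on_SucD[OF Suc.prems(2)]
  show ?case
  proof (rule k_smooth_on_Suc_I[OF assms(1)])
    fix x assume x: "x \<in> S"
    then have "g x \<in> T" using assms by auto
    from has_derivative_compose[OF D(3)[OF x] D(1)[OF this]]
    have 1: "((\<lambda>x. f (g x)) has_derivative
        (\<lambda>v. frechet_derivative f (at (g x)) (frechet_derivative g (at x) v))) (at x)" .
    have 2: "frechet_derivative f (at (g x)) w = (\<Sum>i\<in>Basis. (w \<bullet> i) *\<^sub>R frechet_derivative f (at (g x)) i)" for w
      by (rule linear_family_expand[OF has_derivative_linear[OF D(1)[OF \<open>g x \<in> T\<close>]]])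
    show "((\<lambda>x. f (g x)) has_derivative
        (\<lambda>v. \<Sum>i\<in>Basis. (frechet_derivative g (at x) v \<bullet> i) *\<^sub>R frechet_derivative f (at (g x)) i)) (at x)"
      by (rule has_derivative_eq_rhs[OF 1], rule ext, rule 2)
  next
    fix v
    show "k_smooth_on k S (\<lambda>x. \<Sum>i\<in>Basis. (frechet_derivative g (at x) v \<bullet> i) *\<^sub>R frechet_derivative f (at (g x)) i)"
      by (intro k_smooth_on_sum assms k_smooth_on_bilinear[OF bounded_bilinear_scaleR]
          k_smooth_on_bounded_linear_comp[OF bounded_linear_inner_left] D
          Suc.IH[of "\<lambda>y. frechet_derivative f (at y) _"] k_smooth_on_less[OF Suc.prems(2)])
  qed
qed

lemma smooth_on_cong: "open S \<Longrightarrow> (\<And>x. x \<in> S \<Longrightarrow> f x = g x) \<Longrightarrow> smooth_on S f \<Longrightarrow> smooth_on S g"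
  unfolding smooth_on_def by (rule allI, rule k_smooth_on_cong[of S f g]) auto

lemma smooth_on_subset: "T \<subseteq> S \<Longrightarrow> smooth_on S f \<Longrightarrow> smooth_on T f"
  unfolding smooth_on_def by (intro allI k_smooth_on_subset[of T S]) auto

lemma smooth_on_const: "open S \<Longrightarrow> smooth_on S (\<lambda>x. c)"
  unfolding smooth_on_def by (intro allI k_smooth_on_const)

lemma smooth_on_add: "open S \<Longrightarrow> smooth_on S f \<Longrightarrow> smooth_on S g \<Longrightarrow> smooth_on S (\<lambda>x. f x + g x)"
  unfolding smooth_on_def by (intro allI k_smooth_on_add) auto

lemma smooth_on_scaleR: "open S \<Longrightarrow> smooth_on S f \<Longrightarrow> smooth_on S g \<Longrightarrow> smooth_on S (\<lambda>x. f x *\<^sub>R g x)"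
  unfolding smooth_on_def by (intro allI k_smooth_on_bilinear[OF bounded_bilinear_scaleR]) auto

lemma smooth_on_bounded_linear_comp:
  "bounded_linear h \<Longrightarrow> open S \<Longrightarrow> smooth_on S f \<Longrightarrow> smooth_on S (\<lambda>x. h (f x))"
  unfolding smooth_on_def by (rule allI, rule k_smooth_on_bounded_linear_comp) auto

lemma smooth_on_sum:
  "open S \<Longrightarrow> (\<And>i. i \<in> I \<Longrightarrow> smooth_on S (f i)) \<Longrightarrow> smooth_on S (\<lambda>x. \<Sum>i\<in>I. f i x)"
  unfolding smooth_on_def by (intro allI k_smooth_on_sum) auto

lemma smooth_on_comp:
  fixes g :: "'a::real_normed_vector \<Rightarrow> 'b::euclidean_space"
  shows "open S \<Longrightarrow> open T \<Longrightarrow> g ` S \<subseteq> T \<Longrightarrow> smooth_on T f \<Longrightarrow> smooth_on S g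
    \<Longrightarrow> smooth_on S (\<lambda>x. f (g x))"
  unfolding smooth_on_def by (rule allI, rule k_smooth_on_comp[of S T g]) auto

lemma smooth_on_has_derivative:
  "smooth_on S f \<Longrightarrow> x \<in> S \<Longrightarrow> (f has_derivative frechet_derivative f (at x)) (at x)"
  unfolding smooth_on_def by (rule k_smooth_on_SucD(1)[of 0]) auto

lemma smooth_on_frechet_derivative:
  "smooth_on S f \<Longrightarrow> smooth_on S (\<lambda>x. frechet_derivative f (at x) v)"
  unfolding smooth_on_def by (rule allI, rule k_smooth_on_SucD(2)) auto

lemma smooth_on_imp_continuous_on: "smooth_on S f \<Longrightarrow> continuous_on S f"
  unfolding smooth_on_def by (drule spec[of _ 0]) simp

lemma smooth_on_frechet_derivative_family:
  fixes f :: "'a::euclidean_space \<Rightarrow> 'b::real_normed_vector"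
  assumes "open S" "smooth_on S f" "smooth_on S v"
  shows "smooth_on S (\<lambda>x. frechet_derivative f (at x) (v x))"
proof (rule smooth_on_cong[OF assms(1)])
  show "smooth_on S (\<lambda>x. \<Sum>i\<in>Basis. (v x \<bullet> i) *\<^sub>R frechet_derivative f (at x) i)"
    by (intro smooth_on_sum assms smooth_on_scaleR smooth_on_frechet_derivative
        smooth_on_bounded_linear_comp[OF bounded_linear_inner_left])
  show "(\<Sum>i\<in>Basis. (v x \<bullet> i) *\<^sub>R frechet_derivative f (at x) i) = frechet_derivative f (at x) (v x)"
    if "x \<in> S" for x
    by (rule linear_family_expand[symmetric, OF has_derivative_linear[OF smooth_on_has_derivative[OF assms(2) that]]])
qed

lemma smooth_on_second_derivative_symmetric:
  fixes f :: "'a::real_normed_vector \<Rightarrow> 'b::euclidean_space"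
  assumes "open S" "smooth_on S f" "x \<in> S"
  shows "frechet_derivative (\<lambda>y. frechet_derivative f (at y) a) (at x) b
    = frechet_derivative (\<lambda>y. frechet_derivative f (at y) b) (at x) a"
  by (rule second_derivative_symmetric[OF assms(1,3), where f = f
        and Df = "\<lambda>y. frechet_derivative f (at y)"
        and Da = "\<lambda>y. frechet_derivative (\<lambda>y. frechet_derivative f (at y) a) (at y)"
        and Db = "\<lambda>y. frechet_derivative (\<lambda>y. frechet_derivative f (at y) b) (at y)"])
    (intro smooth_on_has_derivative[of S] smooth_on_frechet_derivative smooth_on_imp_continuous_on assms; assumption)+

section \<open>Families of bilinear maps\<close>

lemmas bilinear_simps = bilinear_ladd bilinear_radd bilinear_lmul bilinear_rmul bilinear_lneg
  bilinear_rneg bilinear_lsub bilinear_rsub bilinear_lzero bilinear_rzero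

lemma bilinear_linear1: "bilinear B \<Longrightarrow> linear (\<lambda>a. B a b)"
  and bilinear_linear2: "bilinear B \<Longrightarrow> linear (B a)"
  by (auto simp: bilinear_def)

text \<open>Currying: the product rule for linear families is applied once in each slot.\<close>

lemma has_derivative_bilinear_family:
  fixes B :: "'p::real_normed_vector \<Rightarrow> 'a::euclidean_space \<Rightarrow> 'b::euclidean_space \<Rightarrow> 'c::real_normed_vector"
    and z :: "'q::real_normed_vector \<Rightarrow> 'p"
  assumes S: "open S" and bil: "\<And>y. y \<in> S \<Longrightarrow> bilinear (B y)"
    and der: "\<And>y a b. y \<in> S \<Longrightarrow> ((\<lambda>y. B y a b) has_derivative dB y a b) (at y)"
    and zS: "\<And>s. s \<in> T \<Longrightarrow> z s \<in> S" and t: "t \<in> T"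
    and z: "(z has_derivative z') (at t within T)"
    and f: "(f has_derivative f') (at t within T)"
    and g: "(g has_derivative g') (at t within T)"
  shows "((\<lambda>s. B (z s) (f s) (g s)) has_derivative
    (\<lambda>h. dB (z t) (f t) (g t) (z' h) + B (z t) (f' h) (g t) + B (z t) (f t) (g' h))) (at t within T)"
proof -
  have zt: "z t \<in> S" by (rule zS[OF t])
  have 0: "((\<lambda>s. B (z s) a b) has_derivative (\<lambda>h. dB (z t) a b (z' h))) (at t within T)" for a b
    by (rule has_derivative_compose[OF z der[OF zt]])
  have d1: "linear (\<lambda>a. dB (z t) a b w)" for b w
    by (rule derivative_linear_in_parameter[OF bilinear_linear1[OF bil] S zt der[OF zt]])
  have d2: "linear (\<lambda>b. dB (z t) a b w)" for a w
    by (rule derivative_linear_in_parameter[OF bilinear_linear2[OF bil] S zt der[OF zt]])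
  have 1: "((\<lambda>s. B (z s) (f s) b) has_derivative
      (\<lambda>h. dB (z t) (f t) b (z' h) + B (z t) (f' h) b)) (at t within T)" for b
    by (rule has_derivative_linear_family[where L = "\<lambda>s a. B (z s) a b"
          and L' = "\<lambda>h a. dB (z t) a b (z' h)", OF bilinear_linear1[OF bil[OF zS]] t d1 0 f])
  have l: "linear (\<lambda>b. dB (z t) (f t) b (z' h) + B (z t) (f' h) b)" for h
    by (rule linear_compose_add[OF d2 bilinear_linear2[OF bil[OF zt]]])
  have "((\<lambda>s. B (z s) (f s) (g s)) has_derivative
    (\<lambda>h. (dB (z t) (f t) (g t) (z' h) + B (z t) (f' h) (g t)) + B (z t) (f t) (g' h))) (at t within T)"
    by (rule has_derivative_linear_family[where L = "\<lambda>s b. B (z s) (f s) b"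
          and L' = "\<lambda>h b. dB (z t) (f t) b (z' h) + B (z t) (f' h) b",
          OF bilinear_linear2[OF bil[OF zS]] t l 1 g])
  then show ?thesis .
qed

lemma has_vector_derivative_bilinear_family:
  fixes B :: "'p::real_normed_vector \<Rightarrow> 'a::euclidean_space \<Rightarrow> 'b::euclidean_space \<Rightarrow> 'c::real_normed_vector"
  assumes S: "open S" and bil: "\<And>y. y \<in> S \<Longrightarrow> bilinear (B y)"
    and der: "\<And>y a b. y \<in> S \<Longrightarrow> ((\<lambda>y. B y a b) has_derivative dB y a b) (at y)"
    and zS: "\<And>s. s \<in> T \<Longrightarrow> z s \<in> S" and t: "t \<in> T"
    and z: "(z has_vector_derivative z') (at t within T)"
    and f: "(f has_vector_derivative f') (at t within T)"
    and g: "(g has_vector_derivative g') (at t within T)"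
  shows "((\<lambda>s. B (z s) (f s) (g s)) has_vector_derivative
    dB (z t) (f t) (g t) z' + B (z t) f' (g t) + B (z t) (f t) g') (at t within T)"
proof -
  have zt: "z t \<in> S" by (rule zS[OF t])
  have "linear (dB (z t) (f t) (g t))" by (rule has_derivative_linear[OF der[OF zt]])
  then have "dB (z t) (f t) (g t) (h *\<^sub>R z') + B (z t) (h *\<^sub>R f') (g t) + B (z t) (f t) (h *\<^sub>R g')
    = h *\<^sub>R (dB (z t) (f t) (g t) z' + B (z t) f' (g t) + B (z t) (f t) g')" for h
    by (simp add: linear_cmul bilinear_simps[OF bil[OF zt]] scaleR_add_right)
  then show ?thesis
    using has_derivative_bilinear_family[OF S bil der zS t z[unfolded has_vector_derivative_def]
        f[unfolded has_vector_derivative_def] g[unfolded has_vector_derivative_def]]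
    by (simp add: has_vector_derivative_def)
qed

lemma continuous_on_bilinear_family:
  fixes B :: "'p::topological_space \<Rightarrow> 'a::euclidean_space \<Rightarrow> 'b::euclidean_space \<Rightarrow> 'c::real_normed_vector"
  assumes bil: "\<And>y. y \<in> S \<Longrightarrow> bilinear (B y)" and cont: "\<And>a b. continuous_on S (\<lambda>y. B y a b)"
    and zS: "\<And>s. s \<in> T \<Longrightarrow> z s \<in> S"
    and z: "continuous_on T z" and f: "continuous_on T f" and g: "continuous_on T g"
  shows "continuous_on T (\<lambda>s. B (z s) (f s) (g s))"
proof -
  have 0: "continuous_on T (\<lambda>s. B (z s) a b)" for a b
    by (rule continuous_on_compose2[OF cont z]) (use zS in auto)
  have 1: "continuous_on T (\<lambda>s. B (z s) (f s) b)" for b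
    by (rule continuous_on_linear_family[where L = "\<lambda>s a. B (z s) a b",
          OF bilinear_linear1[OF bil[OF zS]] 0 f])
  show ?thesis
    by (rule continuous_on_linear_family[where L = "\<lambda>s b. B (z s) (f s) b",
          OF bilinear_linear2[OF bil[OF zS]] 1 g])
qed

lemma bilinear_family_bounded:
  fixes B :: "'p::topological_space \<Rightarrow> 'a::euclidean_space \<Rightarrow> 'b::euclidean_space \<Rightarrow> 'c::real_normed_vector"
  assumes bil: "\<And>y. y \<in> T \<Longrightarrow> bilinear (B y)" and cont: "\<And>a b. continuous_on T (\<lambda>y. B y a b)"
    and "compact T"
  shows "\<exists>C>0. \<forall>t\<in>T. \<forall>a b. norm (B t a b) \<le> C * norm a * norm b"
proof -
  have "\<exists>C>0. \<forall>t\<in>T. \<forall>b. norm (B t i b) \<le> C * norm b" for i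
    by (rule linear_family_bounded[OF bilinear_linear2[OF bil] cont \<open>compact T\<close>])
  then obtain M where M: "\<And>i. 0 < M i" "\<And>i t b. t \<in> T \<Longrightarrow> norm (B t i b) \<le> M i * norm b" by metis
  define C where "C = (\<Sum>i\<in>Basis. M i) + 1"
  have C: "0 < C" unfolding C_def using M(1) by (simp add: sum_nonneg less_imp_le add_nonneg_pos)
  moreover have "norm (B t a b) \<le> C * norm a * norm b" if t: "t \<in> T" for t a b
  proof -
    have "norm (B t a b) = norm (\<Sum>i\<in>Basis. (a \<bullet> i) *\<^sub>R B t i b)"
      by (subst linear_family_expand[OF bilinear_linear1[OF bil[OF t]], of a b]) simp
    also have "\<dots> \<le> (\<Sum>i\<in>Basis. norm ((a \<bullet> i) *\<^sub>R B t i b))" by (rule norm_sum)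
    also have "\<dots> \<le> (\<Sum>i\<in>Basis. norm a * (M i * norm b))"
    proof (rule sum_mono)
      fix i :: 'a assume i: "i \<in> Basis"
      show "norm ((a \<bullet> i) *\<^sub>R B t i b) \<le> norm a * (M i * norm b)"
        using Basis_le_norm[OF i, of a] M(2)[OF t, of i b] by (simp add: mult_mono)
    qed
    also have "\<dots> = (\<Sum>i\<in>Basis. M i) * norm a * norm b"
      by (simp add: sum_distrib_left sum_distrib_right algebra_simps)
    also have "\<dots> \<le> C * norm a * norm b" by (simp add: C_def algebra_simps)
    finally show ?thesis .
  qed
  ultimately show ?thesis by blast
qed

lemma constant_on_unit_interval:
  fixes u :: "real \<Rightarrow> 'a::real_inner"
  assumes "continuous_on {0..1} u"
    and "\<And>t. t \<in> {0<..<1} \<Longrightarrow> (u has_vector_derivative 0) (at t)"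
    and "s \<in> {0..1}" "t \<in> {0..1}"
  shows "u s = u t"
proof -
  have "u s - u t = 0"
  proof (rule vanishing_derivative_bound[where u = "\<lambda>s. u s - u t" and F = "\<lambda>_. 0" and C = 0
        and ?t0.0 = t and t = s])
    show "((\<lambda>s. u s - u t) has_vector_derivative 0) (at r)" if "r \<in> {0<..<1}" for r
      using has_vector_derivative_diff[OF assms(2)[OF that] has_vector_derivative_const] by simp
  qed (use assms in \<open>auto intro!: continuous_intros\<close>)
  then show ?thesis by simp
qed

text \<open>For identities that hold away from t = 0 because a power of t was divided out:
  continuity gives them at 0 as well.\<close>

lemma zero_at_left_end:
  fixes u :: "real \<Rightarrow> 'a::real_normed_vector"
  assumes "continuous_on {0..1} u" and "\<And>t. t \<in> {0<..1} \<Longrightarrow> u t = 0" and "t \<in> {0..1}"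
  shows "u t = 0"
proof -
  have "closure {0<..<1::real} = {0..1}" by simp
  moreover have "u t = 0" if "t \<in> {0..1}" for t
    using continuous_constant_on_closure[of "{0<..<1::real}" u 0] assms(1,2) that by (auto simp: calculation)
  ultimately show ?thesis using assms(3) by blast
qed

section \<open>Differential geometry on an open subset of a Euclidean space\<close>

section \<open>Connections in coordinates\<close>

text \<open>\<open>\<Gamma> x a b\<close> is the vector with components \<open>\<Gamma>\<^sup>k\<^sub>i\<^sub>j(x) a\<^sup>i b\<^sup>j\<close> and \<open>d\<Gamma> x a b w\<close> is the
  derivative of \<open>\<Gamma>\<^sup>k\<^sub>i\<^sub>j a\<^sup>i b\<^sup>j\<close> at \<open>x\<close> in the direction \<open>w\<close>.\<close>

locale affine_chart =
  fixes S :: "'a::euclidean_space set" and \<Gamma> :: "'a \<Rightarrow> 'a \<Rightarrow> 'a \<Rightarrow> 'a"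
    and d\<Gamma> :: "'a \<Rightarrow> 'a \<Rightarrow> 'a \<Rightarrow> 'a \<Rightarrow> 'a"
  assumes open_S: "open S"
    and bilin: "x \<in> S \<Longrightarrow> bilinear (\<Gamma> x)"
    and sym: "x \<in> S \<Longrightarrow> \<Gamma> x a b = \<Gamma> x b a"
    and deriv: "x \<in> S \<Longrightarrow> ((\<lambda>y. \<Gamma> y a b) has_derivative d\<Gamma> x a b) (at x)"
    and deriv_cont: "continuous_on S (\<lambda>y. d\<Gamma> y a b w)"
begin

text \<open>The curvature R(a,b)c of constant fields, whose bracket is zero.\<close>

definition R :: "'a \<Rightarrow> 'a \<Rightarrow> 'a \<Rightarrow> 'a \<Rightarrow> 'a" where
  "R x a b c = d\<Gamma> x b c a - d\<Gamma> x a c b + \<Gamma> x a (\<Gamma> x b c) - \<Gamma> x b (\<Gamma> x a c)"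

lemma cont: "continuous_on S (\<lambda>y. \<Gamma> y a b)"
  by (intro continuous_at_imp_continuous_on ballI has_derivative_continuous[OF deriv])

lemmas \<Gamma>_simps = bilinear_simps[OF bilin]

lemma d\<Gamma>_linear:
  assumes x: "x \<in> S"
  shows "linear (\<lambda>a. d\<Gamma> x a b w)" "linear (\<lambda>b. d\<Gamma> x a b w)" "linear (d\<Gamma> x a b)"
proof -
  show "linear (\<lambda>a. d\<Gamma> x a b w)"
    by (rule derivative_linear_in_parameter[where L = "\<lambda>y a. \<Gamma> y a b" and L' = "\<lambda>a. d\<Gamma> x a b",
          OF bilinear_linear1[OF bilin] open_S x deriv[OF x]])
  show "linear (\<lambda>b. d\<Gamma> x a b w)"
    by (rule derivative_linear_in_parameter[where L = "\<lambda>y b. \<Gamma> y a b" and L' = "\<lambda>b. d\<Gamma> x a b",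
          OF bilinear_linear2[OF bilin] open_S x deriv[OF x]])
  show "linear (d\<Gamma> x a b)" by (rule has_derivative_linear[OF deriv[OF x]])
qed

lemma d\<Gamma>_simps:
  assumes x: "x \<in> S"
  shows "d\<Gamma> x (a + a') b w = d\<Gamma> x a b w + d\<Gamma> x a' b w" "d\<Gamma> x (r *\<^sub>R a) b w = r *\<^sub>R d\<Gamma> x a b w"
    "d\<Gamma> x a (b + b') w = d\<Gamma> x a b w + d\<Gamma> x a b' w" "d\<Gamma> x a (r *\<^sub>R b) w = r *\<^sub>R d\<Gamma> x a b w"
    "d\<Gamma> x a b (w + w') = d\<Gamma> x a b w + d\<Gamma> x a b w'" "d\<Gamma> x a b (r *\<^sub>R w) = r *\<^sub>R d\<Gamma> x a b w"
  using linear_add[OF d\<Gamma>_linear(1)[OF x]] linear_cmul[OF d\<Gamma>_linear(1)[OF x]]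
    linear_add[OF d\<Gamma>_linear(2)[OF x]] linear_cmul[OF d\<Gamma>_linear(2)[OF x]]
    linear_add[OF d\<Gamma>_linear(3)[OF x]] linear_cmul[OF d\<Gamma>_linear(3)[OF x]]
  by auto

lemma d\<Gamma>_sym: assumes x: "x \<in> S" shows "d\<Gamma> x a b w = d\<Gamma> x b a w"
proof -
  have "((\<lambda>y. \<Gamma> y b a) has_derivative d\<Gamma> x a b) (at x)"
    by (rule has_derivative_transform_within_open[OF deriv[OF x] open_S x]) (rule sym)
  then have "d\<Gamma> x a b = d\<Gamma> x b a" by (rule has_derivative_unique[OF _ deriv[OF x]])
  then show ?thesis by simp
qed

lemma R_linear:
  assumes x: "x \<in> S"
  shows "linear (\<lambda>a. R x a b c)" "linear (\<lambda>b. R x a b c)" "linear (R x a b)"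
  by (intro linearI; simp add: R_def \<Gamma>_simps[OF x] d\<Gamma>_simps[OF x] algebra_simps)+

lemmas R_simps = linear_add[OF R_linear(1)] linear_add[OF R_linear(2)] linear_add[OF R_linear(3)]
  linear_cmul[OF R_linear(1)] linear_cmul[OF R_linear(2)] linear_cmul[OF R_linear(3)]
  linear_neg[OF R_linear(1)] linear_neg[OF R_linear(2)] linear_neg[OF R_linear(3)]
  linear_0[OF R_linear(1)] linear_0[OF R_linear(2)] linear_0[OF R_linear(3)]

lemma R_antisym: "R x a b c = - R x b a c"
  by (simp add: R_def)

lemma R_bianchi: assumes x: "x \<in> S" shows "R x a b c + R x b c a + R x c a b = 0"
  unfolding R_def
  by (simp add: d\<Gamma>_sym[OF x, of c a] d\<Gamma>_sym[OF x, of c b] d\<Gamma>_sym[OF x, of b a]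
      sym[OF x, of c a] sym[OF x, of c b] sym[OF x, of b a])

lemma has_vector_derivative_\<Gamma>:
  assumes "\<And>s. s \<in> T \<Longrightarrow> z s \<in> S" "t \<in> T" "(z has_vector_derivative z') (at t within T)"
    "(f has_vector_derivative f') (at t within T)" "(g has_vector_derivative g') (at t within T)"
  shows "((\<lambda>s. \<Gamma> (z s) (f s) (g s)) has_vector_derivative
    d\<Gamma> (z t) (f t) (g t) z' + \<Gamma> (z t) f' (g t) + \<Gamma> (z t) (f t) g') (at t within T)"
  by (rule has_vector_derivative_bilinear_family[OF open_S bilin deriv assms])

lemma has_derivative_\<Gamma>:
  assumes "x \<in> S" "(f has_derivative f') (at x)" "(g has_derivative g') (at x)"
  shows "((\<lambda>y. \<Gamma> y (f y) (g y)) has_derivative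
    (\<lambda>w. d\<Gamma> x (f x) (g x) w + \<Gamma> x (f' w) (g x) + \<Gamma> x (f x) (g' w))) (at x)"
proof -
  have "((\<lambda>y. \<Gamma> y (f y) (g y)) has_derivative
    (\<lambda>w. d\<Gamma> x (f x) (g x) w + \<Gamma> x (f' w) (g x) + \<Gamma> x (f x) (g' w))) (at x within S)"
  proof (rule has_derivative_bilinear_family[where B = \<Gamma> and dB = d\<Gamma> and S = S and T = S
        and z = "\<lambda>y. y" and z' = "\<lambda>w. w" and t = x])
    show "(f has_derivative f') (at x within S)" "(g has_derivative g') (at x within S)"
      by (rule has_derivative_at_withinI, rule assms)+
  qed (use assms(1) in \<open>auto intro: open_S bilin deriv\<close>)
  then show ?thesis by (simp only: at_within_open[OF assms(1) open_S])
qed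

lemma continuous_on_\<Gamma>:
  assumes "\<And>s. s \<in> T \<Longrightarrow> z s \<in> S" "continuous_on T z" "continuous_on T f" "continuous_on T g"
  shows "continuous_on T (\<lambda>s. \<Gamma> (z s) (f s) (g s))"
  by (rule continuous_on_bilinear_family[OF bilin cont assms])

end

section \<open>Normal coordinates\<close>

text \<open>On a star-shaped set, \<open>radial\<close> expresses that the rays from the origin, run
  through with constant coordinate velocity, are geodesics.\<close>

locale normal_chart = affine_chart +
  assumes star: "x \<in> S \<Longrightarrow> t \<in> {0..1} \<Longrightarrow> t *\<^sub>R x \<in> S"
    and radial: "x \<in> S \<Longrightarrow> \<Gamma> x x x = 0"
    and nonempty: "S \<noteq> {}"
begin

lemma zero_in: "0 \<in> S"
  using star[of _ 0] nonempty by auto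

lemma ray_derivative: "((\<lambda>s. s *\<^sub>R x) has_vector_derivative x) (at t within T)"
  by (auto intro!: derivative_eq_intros)

text \<open>This differentiates the identity \<open>\<Gamma> y y y = 0\<close>, whose two vector
  slots contribute equally. It trades a derivative of \<Gamma> for \<Gamma> itself.\<close>

lemma radial_derivative:
  assumes x: "x \<in> S"
  shows "d\<Gamma> x x x w + 2 *\<^sub>R \<Gamma> x w x = 0"
proof -
  have "((\<lambda>y. \<Gamma> y y y) has_derivative (\<lambda>w. d\<Gamma> x x x w + \<Gamma> x w x + \<Gamma> x x w)) (at x)"
    by (rule has_derivative_\<Gamma>[OF x]) (auto intro: derivative_intros)
  moreover have "((\<lambda>y. \<Gamma> y y y) has_derivative (\<lambda>w. 0)) (at x)"
    by (rule has_derivative_transform_within_open[OF has_derivative_const open_S x])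
      (use radial in auto)
  ultimately have "(\<lambda>w. d\<Gamma> x x x w + \<Gamma> x w x + \<Gamma> x x w) = (\<lambda>w. 0)" by (rule has_derivative_unique)
  then have "d\<Gamma> x x x w + \<Gamma> x w x + \<Gamma> x x w = 0" by metis
  then show ?thesis using sym[OF x, of x w] by (simp add: scaleR_2 add.assoc)
qed

lemma \<Gamma>_ray_scaled: "x \<in> S \<Longrightarrow> t \<in> {0..1} \<Longrightarrow> t *\<^sub>R (t *\<^sub>R \<Gamma> (t *\<^sub>R x) x x) = 0"
  using radial[OF star[of x t]] by (simp add: \<Gamma>_simps[OF star])

lemma \<Gamma>_ray_continuous: "x \<in> S \<Longrightarrow> continuous_on {0..1} (\<lambda>t. \<Gamma> (t *\<^sub>R x) a b)"
  by (rule continuous_on_\<Gamma>) (auto intro!: star continuous_intros)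

lemma \<Gamma>_ray: assumes x: "x \<in> S" and t: "t \<in> {0..1}" shows "\<Gamma> (t *\<^sub>R x) x x = 0"
proof (rule zero_at_left_end[where u = "\<lambda>t. \<Gamma> (t *\<^sub>R x) x x", OF \<Gamma>_ray_continuous[OF x] _ t])
  show "\<Gamma> (t *\<^sub>R x) x x = 0" if "t \<in> {0<..1}" for t
    using \<Gamma>_ray_scaled[OF x, of t] that by simp
qed

text \<open>The curvature \<open>R x w x\<close> contains \<open>d\<Gamma> x x w\<close>, which
  \<open>radial_derivative\<close> at the point t x turns into -(2/t) \<Gamma>. The weight t^2 is
  chosen because its derivative 2t produces exactly this term.\<close>

lemma \<Gamma>_ray_riccati:
  assumes x: "x \<in> S" and t: "t \<in> {0..1}"
  shows "((\<lambda>t. t\<^sup>2 *\<^sub>R \<Gamma> (t *\<^sub>R x) x w) has_vector_derivative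
    t\<^sup>2 *\<^sub>R R (t *\<^sub>R x) x w x - t\<^sup>2 *\<^sub>R \<Gamma> (t *\<^sub>R x) x (\<Gamma> (t *\<^sub>R x) x w)) (at t within {0..1})"
proof -
  let ?y = "t *\<^sub>R x"
  have y: "?y \<in> S" by (rule star[OF x t])
  have "((\<lambda>t. \<Gamma> (t *\<^sub>R x) x w) has_vector_derivative d\<Gamma> ?y x w x + \<Gamma> ?y 0 w + \<Gamma> ?y x 0) (at t within {0..1})"
    by (rule has_vector_derivative_\<Gamma>[OF star[OF x] t ray_derivative]) auto
  then have 1: "((\<lambda>t. \<Gamma> (t *\<^sub>R x) x w) has_vector_derivative d\<Gamma> ?y x w x) (at t within {0..1})"
    by (simp add: \<Gamma>_simps[OF y])
  have 2: "((\<lambda>t. t\<^sup>2) has_real_derivative 2 * t) (at t within {0..1})"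
    by (auto intro!: derivative_eq_intros)
  have "((\<lambda>t. t\<^sup>2 *\<^sub>R \<Gamma> (t *\<^sub>R x) x w) has_vector_derivative
      t\<^sup>2 *\<^sub>R d\<Gamma> ?y x w x + (2 * t) *\<^sub>R \<Gamma> ?y x w) (at t within {0..1})"
    by (rule has_vector_derivative_scaleR[OF 2 1])
  moreover have "t\<^sup>2 *\<^sub>R R ?y x w x = t\<^sup>2 *\<^sub>R d\<Gamma> ?y x w x + (2 * t) *\<^sub>R \<Gamma> ?y x w
      + t\<^sup>2 *\<^sub>R \<Gamma> ?y x (\<Gamma> ?y x w)"
  proof -
    have "t\<^sup>2 *\<^sub>R d\<Gamma> ?y x x w = d\<Gamma> ?y ?y ?y w" by (simp add: d\<Gamma>_simps[OF y] power2_eq_square)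
    also have "\<dots> = - (2 *\<^sub>R \<Gamma> ?y w ?y)" using radial_derivative[OF y, of w] by (simp add: eq_neg_iff_add_eq_0)
    also have "\<dots> = - ((2 * t) *\<^sub>R \<Gamma> ?y x w)" by (simp add: \<Gamma>_simps[OF y] sym[OF y, of w x])
    finally have "t\<^sup>2 *\<^sub>R d\<Gamma> ?y x x w = - ((2 * t) *\<^sub>R \<Gamma> ?y x w)" .
    then show ?thesis
      unfolding R_def
      by (simp add: \<Gamma>_ray[OF x t] \<Gamma>_simps[OF y] d\<Gamma>_sym[OF y, of w x] sym[OF y, of w x]
          scaleR_diff_right scaleR_add_right)
  qed
  ultimately show ?thesis by (simp add: algebra_simps)
qed

lemma \<Gamma>_ray_riccati_along:
  assumes x: "x \<in> S" and t: "t \<in> {0..1}" and f: "(f has_vector_derivative f') (at t within {0..1})"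
  shows "((\<lambda>t. t\<^sup>2 *\<^sub>R \<Gamma> (t *\<^sub>R x) x (f t)) has_vector_derivative
    t\<^sup>2 *\<^sub>R R (t *\<^sub>R x) x (f t) x - t\<^sup>2 *\<^sub>R \<Gamma> (t *\<^sub>R x) x (\<Gamma> (t *\<^sub>R x) x (f t))
      + t\<^sup>2 *\<^sub>R \<Gamma> (t *\<^sub>R x) x f') (at t within {0..1})"
proof -
  let ?y = "t *\<^sub>R x"
  have y: "?y \<in> S" by (rule star[OF x t])
  let ?L' = "\<lambda>h v. h *\<^sub>R (t\<^sup>2 *\<^sub>R R ?y x v x - t\<^sup>2 *\<^sub>R \<Gamma> ?y x (\<Gamma> ?y x v))"
  have "((\<lambda>t. t\<^sup>2 *\<^sub>R \<Gamma> (t *\<^sub>R x) x (f t)) has_derivative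
      (\<lambda>h. ?L' h (f t) + t\<^sup>2 *\<^sub>R \<Gamma> ?y x (h *\<^sub>R f'))) (at t within {0..1})"
  proof (rule has_derivative_linear_family[where L = "\<lambda>t v. t\<^sup>2 *\<^sub>R \<Gamma> (t *\<^sub>R x) x v" and L' = ?L'])
    show "linear (\<lambda>v. s\<^sup>2 *\<^sub>R \<Gamma> (s *\<^sub>R x) x v)" if "s \<in> {0..1}" for s
      by (intro linear_compose_scale_right bilinear_linear2[OF bilin] star[OF x] that)
    show "linear (?L' h)" for h
      by (intro linearI; simp add: R_simps[OF y] \<Gamma>_simps[OF y] algebra_simps)
    show "((\<lambda>s. s\<^sup>2 *\<^sub>R \<Gamma> (s *\<^sub>R x) x v) has_derivative (\<lambda>h. ?L' h v)) (at t within {0..1})" for v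
      using \<Gamma>_ray_riccati[OF x t, of v] by (simp add: has_vector_derivative_def)
    show "(f has_derivative (\<lambda>h. h *\<^sub>R f')) (at t within {0..1})"
      using f unfolding has_vector_derivative_def .
  qed (rule t)
  then show ?thesis
    by (simp add: has_vector_derivative_def \<Gamma>_simps[OF y] scaleR_add_right mult.commute)
qed

definition transport :: "'a \<Rightarrow> (real \<Rightarrow> 'a) \<Rightarrow> bool" where
  "transport x f \<longleftrightarrow> (\<forall>t\<in>{0..1}. (f has_vector_derivative - \<Gamma> (t *\<^sub>R x) x (f t)) (at t within {0..1}))"

lemma \<Gamma>_ray_linear: "x \<in> S \<Longrightarrow> t \<in> {0..1} \<Longrightarrow> linear (\<lambda>v. - \<Gamma> (t *\<^sub>R x) x v)"
  by (intro linear_compose_neg bilinear_linear2[OF bilin] star)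

lemma transport_exists:
  assumes "x \<in> S" "s \<in> {0..1}"
  shows "\<exists>f. transport x f \<and> f s = v"
proof -
  have "\<exists>f. f s = v \<and> (\<forall>t\<in>{0..1}. (f has_vector_derivative - \<Gamma> (t *\<^sub>R x) x (f t)) (at t within {0..1}))"
    by (rule linear_ode_exists[where L = "\<lambda>t v. - \<Gamma> (t *\<^sub>R x) x v", OF \<Gamma>_ray_linear[OF assms(1)]
          continuous_on_minus[OF \<Gamma>_ray_continuous[OF assms(1)]] assms(2)])
  then show ?thesis unfolding transport_def by blast
qed

lemma transport_zero:
  assumes "x \<in> S" "transport x f" "f s = 0" "s \<in> {0..1}" "t \<in> {0..1}"
  shows "f t = 0"
proof (rule linear_ode_unique[where L = "\<lambda>t v. - \<Gamma> (t *\<^sub>R x) x v" and u = f and ?t0.0 = s])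
  show "continuous_on {0..1} f"
    by (rule continuous_on_if_vector_derivative) (use assms(2) in \<open>auto simp: transport_def\<close>)
  show "(f has_vector_derivative - \<Gamma> (t *\<^sub>R x) x (f t)) (at t)" if "t \<in> {0<..<1}" for t
    by (rule vector_derivative_at_interior[OF _ that]) (use assms(2) that in \<open>auto simp: transport_def\<close>)
qed (use assms in \<open>auto intro!: \<Gamma>_ray_linear continuous_intros \<Gamma>_ray_continuous\<close>)

text \<open>If \<open>R(f, \<cdot>)\<cdot> = 0\<close> along the ray, the Riccati equation makes \<open>u = t\<^sup>2 \<Gamma>(x, f)\<close> a solution of
  the linear equation \<open>u' = -2 \<Gamma>(x, u)\<close>.\<close>

lemma transport_constant:
  assumes x: "x \<in> S" and f: "transport x f"
    and ker: "\<And>t b c. t \<in> {0..1} \<Longrightarrow> R (t *\<^sub>R x) (f t) b c = 0"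
  shows "t \<in> {0..1} \<Longrightarrow> \<Gamma> (t *\<^sub>R x) x (f t) = 0" "s \<in> {0..1} \<Longrightarrow> t \<in> {0..1} \<Longrightarrow> f s = f t"
proof -
  define u where "u t = t\<^sup>2 *\<^sub>R \<Gamma> (t *\<^sub>R x) x (f t)" for t
  have fd: "(f has_vector_derivative - \<Gamma> (t *\<^sub>R x) x (f t)) (at t within {0..1})" if "t \<in> {0..1}" for t
    using f that by (simp add: transport_def)
  have fc: "continuous_on {0..1} f" by (rule continuous_on_if_vector_derivative[OF fd])
  have Nc: "continuous_on {0..1} (\<lambda>t. \<Gamma> (t *\<^sub>R x) x (f t))"
    by (rule continuous_on_\<Gamma>) (auto intro!: star[OF x] continuous_intros fc)
  have ud: "(u has_vector_derivative - (2 *\<^sub>R \<Gamma> (t *\<^sub>R x) x (u t))) (at t within {0..1})" if t: "t \<in> {0..1}" for t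
  proof -
    let ?y = "t *\<^sub>R x"
    have y: "?y \<in> S" by (rule star[OF x t])
    have "R ?y x (f t) x = 0" using ker[OF t, of x x] R_antisym[of ?y x "f t" x] by simp
    then show ?thesis
      using \<Gamma>_ray_riccati_along[OF x t fd[OF t]] unfolding u_def[abs_def] scaleR_2
      by (simp add: \<Gamma>_simps[OF y])
  qed
  have u0: "u t = 0" if "t \<in> {0..1}" for t
  proof (rule linear_ode_unique[where L = "\<lambda>t v. - (2 *\<^sub>R \<Gamma> (t *\<^sub>R x) x v)" and u = u and ?t0.0 = 0])
    show "linear (\<lambda>v. - (2 *\<^sub>R \<Gamma> (t *\<^sub>R x) x v))" if "t \<in> {0..1}" for t
      by (intro linear_compose_neg linear_compose_scale_right bilinear_linear2[OF bilin] star[OF x] that)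
    show "continuous_on {0..1} (\<lambda>t. - (2 *\<^sub>R \<Gamma> (t *\<^sub>R x) x v))" for v
      by (intro continuous_intros \<Gamma>_ray_continuous x)
    show "continuous_on {0..1} u" by (rule continuous_on_if_vector_derivative[OF ud])
    show "(u has_vector_derivative - (2 *\<^sub>R \<Gamma> (t *\<^sub>R x) x (u t))) (at t)" if "t \<in> {0<..<1}" for t
      by (rule vector_derivative_at_interior[OF ud that]) (use that in auto)
  qed (use that in \<open>auto simp: u_def\<close>)
  show N0: "\<Gamma> (t *\<^sub>R x) x (f t) = 0" if "t \<in> {0..1}" for t
  proof (rule zero_at_left_end[OF Nc _ that])
    show "\<Gamma> (t *\<^sub>R x) x (f t) = 0" if "t \<in> {0<..1}" for t
      using u0[of t] that by (simp add: u_def)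
  qed
  show "f s = f t" if "s \<in> {0..1}" "t \<in> {0..1}"
  proof (rule constant_on_unit_interval[OF fc _ that])
    show "(f has_vector_derivative 0) (at t)" if "t \<in> {0<..<1}" for t
      using vector_derivative_at_interior[OF fd that] N0[of t] that by simp
  qed
qed

end

section \<open>Parallel curvature in normal coordinates\<close>

text \<open>\<open>R_parallel\<close> is the vanishing of \<nabla>R on constant fields, solved for
  the coordinate derivative of R.\<close>

locale symmetric_chart = normal_chart +
  assumes R_parallel: "x \<in> S \<Longrightarrow> ((\<lambda>y. R y a b c) has_derivative
    (\<lambda>w. - \<Gamma> x w (R x a b c) + R x (\<Gamma> x w a) b c + R x a (\<Gamma> x w b) c + R x a b (\<Gamma> x w c))) (at x)"
begin

text \<open>A parallel tensor applied to parallel fields is parallel: with the product rule taken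
  slot by slot, the motion of each argument cancels the corresponding \<Gamma>-term of the
  derivative of R.\<close>

lemma transport_R:
  assumes x: "x \<in> S" and a: "transport x a" and b: "transport x b" and c: "transport x c"
  shows "transport x (\<lambda>t. R (t *\<^sub>R x) (a t) (b t) (c t))"
  unfolding transport_def
proof
  fix t :: real assume t: "t \<in> {0..1}"
  let ?y = "t *\<^sub>R x"
  have y: "?y \<in> S" by (rule star[OF x t])
  note d = a[unfolded transport_def has_vector_derivative_def, rule_format, OF t]
    b[unfolded transport_def has_vector_derivative_def, rule_format, OF t]
    c[unfolded transport_def has_vector_derivative_def, rule_format, OF t]
  let ?D = "\<lambda>u v w. - \<Gamma> ?y x (R ?y u v w) + R ?y (\<Gamma> ?y x u) v w + R ?y u (\<Gamma> ?y x v) w + R ?y u v (\<Gamma> ?y x w)"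
  have ray: "((\<lambda>s. s *\<^sub>R x) has_derivative (\<lambda>h. h *\<^sub>R x)) (at t within {0..1})"
    by (auto intro!: derivative_eq_intros)
  have 0: "((\<lambda>s. R (s *\<^sub>R x) u v w) has_derivative (\<lambda>h. h *\<^sub>R ?D u v w)) (at t within {0..1})" for u v w
    using has_derivative_compose[OF ray R_parallel[OF y, of u v w]]
    by (rule has_derivative_eq_rhs) (auto simp: \<Gamma>_simps[OF y] R_simps[OF y] fun_eq_iff algebra_simps)
  have 1: "((\<lambda>s. R (s *\<^sub>R x) (a s) v w) has_derivative
      (\<lambda>h. h *\<^sub>R ?D (a t) v w + R ?y (h *\<^sub>R - \<Gamma> ?y x (a t)) v w)) (at t within {0..1})" for v w
    by (rule has_derivative_linear_family[where L = "\<lambda>s u. R (s *\<^sub>R x) u v w"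
          and L' = "\<lambda>h u. h *\<^sub>R ?D u v w", OF R_linear(1)[OF star[OF x]] t _ 0 d(1)], assumption)
      (intro linearI; simp add: R_simps[OF y] \<Gamma>_simps[OF y] algebra_simps)
  have 2: "((\<lambda>s. R (s *\<^sub>R x) (a s) (b s) w) has_derivative
      (\<lambda>h. (h *\<^sub>R ?D (a t) (b t) w + R ?y (h *\<^sub>R - \<Gamma> ?y x (a t)) (b t) w)
        + R ?y (a t) (h *\<^sub>R - \<Gamma> ?y x (b t)) w)) (at t within {0..1})" for w
    by (rule has_derivative_linear_family[where L = "\<lambda>s v. R (s *\<^sub>R x) (a s) v w"
          and L' = "\<lambda>h v. h *\<^sub>R ?D (a t) v w + R ?y (h *\<^sub>R - \<Gamma> ?y x (a t)) v w",
          OF R_linear(2)[OF star[OF x]] t _ 1 d(2)], assumption)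
      (intro linearI; simp add: R_simps[OF y] \<Gamma>_simps[OF y] algebra_simps)
  have 3: "((\<lambda>s. R (s *\<^sub>R x) (a s) (b s) (c s)) has_derivative
      (\<lambda>h. (h *\<^sub>R ?D (a t) (b t) (c t) + R ?y (h *\<^sub>R - \<Gamma> ?y x (a t)) (b t) (c t)
        + R ?y (a t) (h *\<^sub>R - \<Gamma> ?y x (b t)) (c t)) + R ?y (a t) (b t) (h *\<^sub>R - \<Gamma> ?y x (c t)))) (at t within {0..1})"
    by (rule has_derivative_linear_family[where L = "\<lambda>s w. R (s *\<^sub>R x) (a s) (b s) w"
          and L' = "\<lambda>h w. h *\<^sub>R ?D (a t) (b t) w + R ?y (h *\<^sub>R - \<Gamma> ?y x (a t)) (b t) w
            + R ?y (a t) (h *\<^sub>R - \<Gamma> ?y x (b t)) w",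
          OF R_linear(3)[OF star[OF x]] t _ 2 d(3)], assumption)
      (intro linearI; simp add: R_simps[OF y] \<Gamma>_simps[OF y] algebra_simps)
  show "((\<lambda>t. R (t *\<^sub>R x) (a t) (b t) (c t)) has_vector_derivative
      - \<Gamma> ?y x (R ?y (a t) (b t) (c t))) (at t within {0..1})"
    unfolding has_vector_derivative_def
    by (rule has_derivative_eq_rhs[OF 3]) (simp add: R_simps[OF y] fun_eq_iff algebra_simps)
qed

definition F :: "'a \<Rightarrow> 'a set" where "F x = {f. \<forall>b c. R x f b c = 0}"

text \<open>Any \<open>b\<close> and \<open>c\<close> at time \<open>t\<close> extend to parallel
  fields. R of the three fields is then parallel, and it vanishes at time \<open>s\<close>, hence
  always.\<close>

lemma F_transport:
  assumes x: "x \<in> S" and f: "transport x f" and s: "s \<in> {0..1}" and t: "t \<in> {0..1}"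
    and fs: "f s \<in> F (s *\<^sub>R x)"
  shows "f t \<in> F (t *\<^sub>R x)"
  unfolding F_def
proof (intro CollectI allI)
  fix b c
  obtain b' where b': "transport x b'" "b' t = b" using transport_exists[OF x t] by blast
  obtain c' where c': "transport x c'" "c' t = c" using transport_exists[OF x t] by blast
  have "R (t *\<^sub>R x) (f t) (b' t) (c' t) = 0"
    by (rule transport_zero[OF x transport_R[OF x f b'(1) c'(1)] _ s t]) (use fs in \<open>simp add: F_def\<close>)
  then show "R (t *\<^sub>R x) (f t) b c = 0" by (simp add: b' c')
qed

text \<open>The transported vector stays in the kernel, where \<open>transport_constant\<close>
  applies: it does not move at all, so its constant value lies in every kernel along the
  ray.\<close>

lemma F_transport_constant:
  assumes x: "x \<in> S" and s: "s \<in> {0..1}" and f: "f \<in> F (s *\<^sub>R x)" and t: "t \<in> {0..1}"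
  shows "f \<in> F (t *\<^sub>R x)" "\<Gamma> (t *\<^sub>R x) x f = 0"
proof -
  obtain f' where f': "transport x f'" "f' s = f" using transport_exists[OF x s] by blast
  have ker: "f' t \<in> F (t *\<^sub>R x)" if "t \<in> {0..1}" for t
    by (rule F_transport[OF x f'(1) s that]) (simp add: f' f)
  then have "f' t = f' s" "\<Gamma> (t *\<^sub>R x) x (f' t) = 0"
    using transport_constant[OF x f'(1)] s t unfolding F_def by blast+
  then show "f \<in> F (t *\<^sub>R x)" "\<Gamma> (t *\<^sub>R x) x f = 0" using ker[OF t] f' by auto
qed

lemma F_constant: "x \<in> S \<Longrightarrow> F x = F 0"
  using F_transport_constant(1)[of x 1 _ 0] F_transport_constant(1)[of x 0 _ 1] by auto

text \<open>Transport along rays yields only the radial case w = x. For general \<open>w\<close>,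
  the field t \<open>\<Gamma> (t x) w f\<close> turns out to be parallel along the ray, and it
  starts at 0.\<close>

lemma \<Gamma>_F:
  assumes x: "x \<in> S" and f: "f \<in> F 0"
  shows "\<Gamma> x w f = 0"
proof -
  have rad: "\<Gamma> y y f = 0" if "y \<in> S" for y
    using F_transport_constant(2)[OF that, of 0 f 1] f by simp
  \<comment> \<open>Differentiating the radial identity brings in the arbitrary direction
    \<open>w\<close>.\<close>
  have rad': "d\<Gamma> y y f w + \<Gamma> y w f = 0" if y: "y \<in> S" for y
  proof -
    have "((\<lambda>y. \<Gamma> y y f) has_derivative (\<lambda>w. d\<Gamma> y y f w + \<Gamma> y w f + \<Gamma> y y 0)) (at y)"
      by (rule has_derivative_\<Gamma>[OF y]) (auto intro: derivative_intros)
    moreover have "((\<lambda>y. \<Gamma> y y f) has_derivative (\<lambda>w. 0)) (at y)"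
      by (rule has_derivative_transform_within_open[OF has_derivative_const open_S y]) (use rad in auto)
    ultimately have "(\<lambda>w. d\<Gamma> y y f w + \<Gamma> y w f + \<Gamma> y y 0) = (\<lambda>w. 0)" by (rule has_derivative_unique)
    then have "d\<Gamma> y y f w + \<Gamma> y w f + \<Gamma> y y 0 = 0" by metis
    then show ?thesis by (simp add: \<Gamma>_simps[OF y])
  qed
  define m where "m t = t *\<^sub>R \<Gamma> (t *\<^sub>R x) w f" for t
  have "transport x m"
    unfolding transport_def
  proof
    fix t :: real assume t: "t \<in> {0..1}"
    let ?y = "t *\<^sub>R x"
    have y: "?y \<in> S" by (rule star[OF x t])
    have "f \<in> F ?y" using F_constant[OF y] f by simp
    \<comment> \<open>The kernel condition concerns the first slot, and by antisymmetry the second;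
      Bianchi's identity moves it to the third.\<close>
    then have "R ?y w f x = 0" "R ?y f x w = 0"
      using R_antisym[of ?y w f x] by (auto simp: F_def)
    then have "R ?y x w f = 0" using R_bianchi[OF y, of x w f] by simp
    then have R0: "t *\<^sub>R d\<Gamma> ?y w f x - t *\<^sub>R d\<Gamma> ?y x f w + t *\<^sub>R \<Gamma> ?y x (\<Gamma> ?y w f) = 0"
      using F_transport_constant(2)[OF x, of 0 f t] f t
      by (simp add: R_def \<Gamma>_simps[OF y] flip: scaleR_add_right scaleR_diff_right)
    have "t *\<^sub>R d\<Gamma> ?y x f w = - \<Gamma> ?y w f"
      using rad'[OF y] by (simp add: d\<Gamma>_simps[OF y] eq_neg_iff_add_eq_0)
    with R0 have eq: "t *\<^sub>R d\<Gamma> ?y w f x + \<Gamma> ?y w f = - \<Gamma> ?y x (m t)"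
      by (simp add: m_def \<Gamma>_simps[OF y] eq_neg_iff_add_eq_0)
    have "((\<lambda>t. \<Gamma> (t *\<^sub>R x) w f) has_vector_derivative d\<Gamma> ?y w f x + \<Gamma> ?y 0 f + \<Gamma> ?y w 0) (at t within {0..1})"
      by (rule has_vector_derivative_\<Gamma>[OF star[OF x] t ray_derivative]) auto
    then have 1: "((\<lambda>t. \<Gamma> (t *\<^sub>R x) w f) has_vector_derivative d\<Gamma> ?y w f x) (at t within {0..1})"
      by (simp add: \<Gamma>_simps[OF y])
    have 2: "((\<lambda>t. t) has_real_derivative 1) (at t within {0..1})" by (auto intro!: derivative_eq_intros)
    have "(m has_vector_derivative t *\<^sub>R d\<Gamma> ?y w f x + 1 *\<^sub>R \<Gamma> ?y w f) (at t within {0..1})"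
      unfolding m_def by (rule has_vector_derivative_scaleR[OF 2 1])
    then show "(m has_vector_derivative - \<Gamma> ?y x (m t)) (at t within {0..1})" using eq by simp
  qed
  then have "m 1 = 0" by (rule transport_zero[OF x, of m 0]) (auto simp: m_def)
  then show ?thesis by (simp add: m_def)
qed

end

section \<open>Dual connections in coordinates\<close>

text \<open>\<open>G_deriv\<close> is the duality of the two connections, read on constant
  fields.\<close>

locale dual_chart = affine_chart S \<Gamma> d\<Gamma> + dual: affine_chart S \<Gamma>s d\<Gamma>s
  for S :: "'a::euclidean_space set" and \<Gamma> d\<Gamma> \<Gamma>s d\<Gamma>s +
  fixes G :: "'a \<Rightarrow> 'a \<Rightarrow> 'a \<Rightarrow> real"
  assumes G_bilin: "x \<in> S \<Longrightarrow> bilinear (G x)"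
    and G_sym: "x \<in> S \<Longrightarrow> G x a b = G x b a"
    and G_pos: "x \<in> S \<Longrightarrow> a \<noteq> 0 \<Longrightarrow> 0 < G x a a"
    and G_deriv: "x \<in> S \<Longrightarrow>
      ((\<lambda>y. G y a b) has_derivative (\<lambda>w. G x (\<Gamma> x w a) b + G x a (\<Gamma>s x w b))) (at x)"
begin

lemmas G_simps = bilinear_simps[OF G_bilin]

lemma G_nonneg: "x \<in> S \<Longrightarrow> 0 \<le> G x a a"
  using G_pos[of x a] G_simps(9)[of x a] by (cases "a = 0") auto

lemma G_nondegenerate: "x \<in> S \<Longrightarrow> (\<And>a. G x a b = 0) \<Longrightarrow> b = 0"
  using G_pos by fastforce

lemma G_cont: "continuous_on S (\<lambda>y. G y a b)"
  by (intro continuous_at_imp_continuous_on ballI has_derivative_continuous[OF G_deriv])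

lemma has_vector_derivative_G:
  assumes "\<And>s. s \<in> T \<Longrightarrow> z s \<in> S" "t \<in> T" "(z has_vector_derivative z') (at t within T)"
    "(f has_vector_derivative f') (at t within T)" "(g has_vector_derivative g') (at t within T)"
  shows "((\<lambda>s. G (z s) (f s) (g s)) has_vector_derivative
    G (z t) (\<Gamma> (z t) z' (f t)) (g t) + G (z t) (f t) (\<Gamma>s (z t) z' (g t))
      + G (z t) f' (g t) + G (z t) (f t) g') (at t within T)"
  by (rule has_vector_derivative_bilinear_family[where B = G
        and dB = "\<lambda>x a b w. G x (\<Gamma> x w a) b + G x a (\<Gamma>s x w b)", OF open_S G_bilin G_deriv assms])

lemma has_derivative_G:
  assumes x: "x \<in> S" and f: "(f has_derivative f') (at x)" and g: "(g has_derivative g') (at x)"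
  shows "((\<lambda>y. G y (f y) (g y)) has_derivative
    (\<lambda>w. G x (\<Gamma> x w (f x)) (g x) + G x (f x) (\<Gamma>s x w (g x)) + G x (f' w) (g x) + G x (f x) (g' w))) (at x)"
proof -
  have "((\<lambda>y. G y (f y) (g y)) has_derivative
    (\<lambda>w. (G x (\<Gamma> x w (f x)) (g x) + G x (f x) (\<Gamma>s x w (g x))) + G x (f' w) (g x) + G x (f x) (g' w))) (at x within S)"
  proof (rule has_derivative_bilinear_family[where B = G and S = S and T = S and t = x
        and dB = "\<lambda>x a b w. G x (\<Gamma> x w a) b + G x a (\<Gamma>s x w b)" and z = "\<lambda>y. y" and z' = "\<lambda>w. w"])
    show "(f has_derivative f') (at x within S)" "(g has_derivative g') (at x within S)"
      by (rule has_derivative_at_withinI, rule f g)+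
  qed (fact open_S G_bilin G_deriv | simp add: x)+
  then show ?thesis by (simp only: at_within_open[OF x open_S])
qed

lemma continuous_on_G:
  assumes "\<And>s. s \<in> T \<Longrightarrow> z s \<in> S" "continuous_on T z" "continuous_on T f" "continuous_on T g"
  shows "continuous_on T (\<lambda>s. G (z s) (f s) (g s))"
  by (rule continuous_on_bilinear_family[OF G_bilin G_cont assms])

lemma G_cauchy_schwarz:
  assumes x: "x \<in> S"
  shows "(G x a b)\<^sup>2 \<le> G x a a * G x b b"
proof (cases "b = 0")
  case True
  then show ?thesis by (simp add: G_simps[OF x])
next
  case False
  let ?c = "G x a b / G x b b"
  have p: "0 < G x b b" by (rule G_pos[OF x False])
  have "0 \<le> G x (a - ?c *\<^sub>R b) (a - ?c *\<^sub>R b)" by (rule G_nonneg[OF x])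
  also have "\<dots> = G x a a - 2 * ?c * G x a b + ?c\<^sup>2 * G x b b"
    using G_sym[OF x, of b a] by (simp add: G_simps[OF x] power2_eq_square algebra_simps)
  also have "\<dots> = G x a a - (G x a b)\<^sup>2 / G x b b"
    using p by (simp add: power2_eq_square field_simps)
  finally show ?thesis using p by (simp add: field_simps)
qed

text \<open>Both sides come from the antisymmetrised second derivative of \<open>y \<mapsto> G y c d\<close>.\<close>

lemma dual_curvature:
  assumes x: "x \<in> S"
  shows "G x (R x a b c) d + G x c (dual.R x a b d) = 0"
proof -
  define D where "D y u w = 
      (G y (\<Gamma> y w (\<Gamma> y u c)) d + G y (\<Gamma> y u c) (\<Gamma>s y w d) + G y (d\<Gamma> y u c w) d) +
      (G y (\<Gamma> y w c) (\<Gamma>s y u d) + G y c (\<Gamma>s y w (\<Gamma>s y u d)) + G y c (d\<Gamma>s y u d w))" for y u w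
  have der: "((\<lambda>z. G z (\<Gamma> z u c) d + G z c (\<Gamma>s z u d)) has_derivative D y u) (at y)" if y: "y \<in> S" for y u
  proof -
    have "((\<lambda>z. G z (\<Gamma> z u c) d + G z c (\<Gamma>s z u d)) has_derivative
      (\<lambda>w. (G y (\<Gamma> y w (\<Gamma> y u c)) d + G y (\<Gamma> y u c) (\<Gamma>s y w d) + G y (d\<Gamma> y u c w) d + G y (\<Gamma> y u c) 0) +
      (G y (\<Gamma> y w c) (\<Gamma>s y u d) + G y c (\<Gamma>s y w (\<Gamma>s y u d)) + G y 0 (\<Gamma>s y u d) + G y c (d\<Gamma>s y u d w)))) (at y)"
      by (intro has_derivative_add has_derivative_G[OF y] deriv[OF y] dual.deriv[OF y] has_derivative_const)
    then show ?thesis by (simp add: D_def[abs_def] G_simps[OF y])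
  qed
  have c: "continuous_on S (\<lambda>y. D y u w)" for u w
    unfolding D_def
    by (intro continuous_on_add continuous_on_G continuous_on_\<Gamma> dual.continuous_on_\<Gamma> continuous_on_id
        continuous_on_const deriv_cont dual.deriv_cont)
  have "D x a b = D x b a"
    by (rule second_derivative_symmetric[OF open_S x G_deriv der der c c])
  then show ?thesis
    by (simp add: D_def R_def dual.R_def G_simps[OF x])
qed

definition K :: "'a \<Rightarrow> 'a \<Rightarrow> 'a \<Rightarrow> 'a" where "K x a b = \<Gamma>s x a b - \<Gamma> x a b"

lemma K_bilin: "x \<in> S \<Longrightarrow> bilinear (K x)"
  unfolding K_def bilinear_def
  by (intro conjI allI linear_compose_sub bilinear_linear1[OF bilin] bilinear_linear2[OF bilin]
      bilinear_linear1[OF dual.bilin] bilinear_linear2[OF dual.bilin])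

lemma K_sym: "x \<in> S \<Longrightarrow> K x a b = K x b a"
  by (simp add: K_def sym[of x a b] dual.sym[of x a b])

text \<open>The derivative of \<open>G y c d\<close> is symmetric in \<open>c\<close> and
  \<open>d\<close>, but duality assigns the two connections to different slots; comparing both
  orders leaves K. With \<open>K_sym\<close> this makes \<open>G x c (K x v d)\<close> a totally
  symmetric form, the cubic tensor \<nabla>g.\<close>

lemma G_K_sym: assumes x: "x \<in> S" shows "G x c (K x v d) = G x d (K x v c)"
proof -
  have "((\<lambda>y. G y d c) has_derivative (\<lambda>w. G x (\<Gamma> x w c) d + G x c (\<Gamma>s x w d))) (at x)"
    by (rule has_derivative_transform_within_open[OF G_deriv[OF x] open_S x]) (rule G_sym)
  then have "(\<lambda>w. G x (\<Gamma> x w c) d + G x c (\<Gamma>s x w d)) = (\<lambda>w. G x (\<Gamma> x w d) c + G x d (\<Gamma>s x w c))"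
    by (rule has_derivative_unique[OF _ G_deriv[OF x]])
  then have "G x (\<Gamma> x v c) d + G x c (\<Gamma>s x v d) = G x (\<Gamma> x v d) c + G x d (\<Gamma>s x v c)" by metis
  then show ?thesis
    by (simp add: K_def G_simps[OF x] G_sym[OF x, of "\<Gamma> x v c" d] G_sym[OF x, of "\<Gamma> x v d" c])
qed

end

section \<open>The Gauss lemma\<close>

locale normal_dual_chart = normal_chart S \<Gamma> d\<Gamma> + dual_chart S \<Gamma> d\<Gamma> \<Gamma>s d\<Gamma>s G
  for S :: "'a::euclidean_space set" and \<Gamma> d\<Gamma> \<Gamma>s d\<Gamma>s G
begin

text \<open>Self-duality is metric compatibility, so a geodesic has constant speed.\<close>

lemma G_radial_constant:
  assumes self: "\<And>y. y \<in> S \<Longrightarrow> \<Gamma>s y = \<Gamma> y" and x: "x \<in> S" and t: "t \<in> {0..1}"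
  shows "G (t *\<^sub>R x) x x = G 0 x x"
proof -
  have d: "((\<lambda>t. G (t *\<^sub>R x) x x) has_vector_derivative 0) (at t within {0..1})" if t: "t \<in> {0..1}" for t
  proof -
    have y: "t *\<^sub>R x \<in> S" by (rule star[OF x t])
    show ?thesis
      using has_vector_derivative_G[OF star[OF x] t ray_derivative has_vector_derivative_const has_vector_derivative_const, of x x]
      by (simp add: self[OF y] \<Gamma>_ray[OF x t] G_simps[OF y])
  qed
  have "G (t *\<^sub>R x) x x = G (0 *\<^sub>R x) x x"
  proof (rule constant_on_unit_interval[where u = "\<lambda>t. G (t *\<^sub>R x) x x"])
    show "continuous_on {0..1} (\<lambda>t. G (t *\<^sub>R x) x x)"
      by (rule continuous_on_if_vector_derivative[OF d])
    show "((\<lambda>t. G (t *\<^sub>R x) x x) has_vector_derivative 0) (at t)" if "t \<in> {0<..<1}" for t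
      by (rule vector_derivative_at_interior[OF d that]) (use that in auto)
  qed (use t in auto)
  then show ?thesis by simp
qed

text \<open>Differentiating \<open>G y y y = G 0 y y\<close> in \<open>y\<close> gives
  \<open>eq\<close>. At the point t x it states that the derivative of t \<open>G (t x) x w\<close>
  is the constant \<open>G 0 x w\<close>; integration from 0 to 1 finishes.\<close>

lemma gauss_lemma:
  assumes self: "\<And>y. y \<in> S \<Longrightarrow> \<Gamma>s y = \<Gamma> y" and x: "x \<in> S"
  shows "G x x w = G 0 x w"
proof -
  have eq: "G y (\<Gamma> y y w) y + G y y w = G 0 y w" if y: "y \<in> S" for y
  proof -
    have "((\<lambda>y. G y y y) has_derivative (\<lambda>w. G y (\<Gamma> y w y) y + G y y (\<Gamma>s y w y) + G y w y + G y y w)) (at y)"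
      by (rule has_derivative_G[OF y has_derivative_ident has_derivative_ident])
    moreover have "((\<lambda>y. G y y y) has_derivative (\<lambda>w. G 0 w y + G 0 y w)) (at y)"
    proof (rule has_derivative_transform_within_open[OF _ open_S y])
      have "bounded_bilinear (G 0)" using G_bilin[OF zero_in] by (rule bilinear_conv_bounded_bilinear[THEN iffD1])
      then have "((\<lambda>y. G 0 y y) has_derivative (\<lambda>w. G 0 y w + G 0 w y)) (at y)"
        by (rule bounded_bilinear.FDERIV[OF _ has_derivative_ident has_derivative_ident])
      then show "((\<lambda>y. G 0 y y) has_derivative (\<lambda>w. G 0 w y + G 0 y w)) (at y)" by (simp add: add.commute)
      show "G 0 z z = G z z z" if "z \<in> S" for z using G_radial_constant[OF self that, of 1] by simp
    qed
    ultimately have "(\<lambda>w. G y (\<Gamma> y w y) y + G y y (\<Gamma>s y w y) + G y w y + G y y w) = (\<lambda>w. G 0 w y + G 0 y w)"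
      by (rule has_derivative_unique)
    then have "G y (\<Gamma> y w y) y + G y y (\<Gamma>s y w y) + G y w y + G y y w = G 0 w y + G 0 y w" by metis
    then show ?thesis
      using sym[OF y, of w y] G_sym[OF y, of "\<Gamma> y y w" y] G_sym[OF y, of w y] G_sym[OF zero_in, of w y]
      by (simp add: self[OF y])
  qed
  have d: "((\<lambda>t. t * G (t *\<^sub>R x) x w) has_vector_derivative
      G (t *\<^sub>R x) x w + t * G (t *\<^sub>R x) x (\<Gamma> (t *\<^sub>R x) x w)) (at t within {0..1})" if t: "t \<in> {0..1}" for t
  proof -
    have y: "t *\<^sub>R x \<in> S" by (rule star[OF x t])
    have 1: "((\<lambda>t. G (t *\<^sub>R x) x w) has_vector_derivative G (t *\<^sub>R x) x (\<Gamma> (t *\<^sub>R x) x w)) (at t within {0..1})"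
      using has_vector_derivative_G[OF star[OF x] t ray_derivative has_vector_derivative_const has_vector_derivative_const, of x w]
      by (simp add: self[OF y] \<Gamma>_ray[OF x t] G_simps[OF y])
    have 2: "((\<lambda>t. t) has_vector_derivative 1) (at t within {0..1})" by (auto intro!: derivative_eq_intros)
    show ?thesis using has_vector_derivative_mult[OF 2 1] by (simp add: add.commute)
  qed
  have "1 * G (1 *\<^sub>R x) x w - 1 * G 0 x w = 0 * G (0 *\<^sub>R x) x w - 0 * G 0 x w"
  proof (rule constant_on_unit_interval[where u = "\<lambda>t. t * G (t *\<^sub>R x) x w - t * G 0 x w"])
    show "continuous_on {0..1} (\<lambda>t. t * G (t *\<^sub>R x) x w - t * G 0 x w)"
      by (intro continuous_on_diff continuous_on_if_vector_derivative[OF d] continuous_intros)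
    fix t :: real assume t: "t \<in> {0<..<1}"
    then have t': "t \<in> {0..1}" by auto
    have y: "t *\<^sub>R x \<in> S" by (rule star[OF x t'])
    have "t * (G (t *\<^sub>R x) x w + t * G (t *\<^sub>R x) x (\<Gamma> (t *\<^sub>R x) x w)) = t * G 0 x w"
      using eq[OF y] G_sym[OF y, of "\<Gamma> (t *\<^sub>R x) x w" x]
      by (simp add: G_simps[OF y] G_simps[OF zero_in] \<Gamma>_simps[OF y] algebra_simps)
    then have e: "G (t *\<^sub>R x) x w + t * G (t *\<^sub>R x) x (\<Gamma> (t *\<^sub>R x) x w) = G 0 x w" using t by simp
    have 2: "((\<lambda>t. t * G 0 x w) has_vector_derivative G 0 x w) (at t)"
      by (auto intro!: derivative_eq_intros)
    show "((\<lambda>t. t * G (t *\<^sub>R x) x w - t * G 0 x w) has_vector_derivative 0) (at t)"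
      using has_vector_derivative_diff[OF vector_derivative_at_interior[OF d[OF t'] t] 2] e by simp
  qed auto
  then show ?thesis by simp
qed

text \<open>Regularising the radius \<open>r\<close> to \<open>sqrt (r\<^sup>2 + \<epsilon>\<^sup>2)\<close> avoids the points where \<open>r = 0\<close>.\<close>

lemma curve_length_ge_radius:
  assumes self: "\<And>y. y \<in> S \<Longrightarrow> \<Gamma>s y = \<Gamma> y"
    and z: "\<And>t. t \<in> {0..1} \<Longrightarrow> z t \<in> S" "z 0 = 0"
    and der: "\<And>t. t \<in> {0..1} \<Longrightarrow> (z has_vector_derivative Z t) (at t within {0..1})"
    and Z: "continuous_on {0..1} Z"
  shows "sqrt (G 0 (z 1) (z 1)) \<le> integral {0..1} (\<lambda>t. sqrt (G (z t) (Z t) (Z t)))" (is "_ \<le> ?L")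
proof (rule field_le_epsilon)
  fix e :: real assume e: "0 < e"
  have zc: "continuous_on {0..1} z" by (rule continuous_on_if_vector_derivative[OF der])
  define q where "q t = G 0 (z t) (z t)" for t
  have q0: "0 \<le> q t" for t unfolding q_def by (rule G_nonneg[OF zero_in])
  define h where "h t = sqrt (q t + e\<^sup>2)" for t
  define h' where "h' t = G (z t) (z t) (Z t) / h t" for t
  have h0: "0 < h t" for t using q0[of t] e by (simp add: h_def add_nonneg_pos)
  have bb: "bounded_bilinear (G 0)" using G_bilin[OF zero_in] by (rule bilinear_conv_bounded_bilinear[THEN iffD1])
  have hd: "(h has_vector_derivative h' t) (at t within {0..1})" if t: "t \<in> {0..1}" for t
  proof -
    have "(q has_vector_derivative G 0 (z t) (Z t) + G 0 (Z t) (z t)) (at t within {0..1})"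
      unfolding q_def by (rule bounded_bilinear.has_vector_derivative[OF bb der[OF t] der[OF t]])
    then have "(q has_real_derivative 2 * G (z t) (z t) (Z t)) (at t within {0..1})"
      using G_sym[OF zero_in, of "Z t" "z t"] gauss_lemma[OF self z(1)[OF t], of "Z t"]
      by (simp add: has_real_derivative_iff_has_vector_derivative)
    then have "((\<lambda>t. q t + e\<^sup>2) has_real_derivative 2 * G (z t) (z t) (Z t)) (at t within {0..1})"
      by (auto intro!: derivative_eq_intros)
    moreover have "0 < q t + e\<^sup>2" using q0[of t] e by (simp add: add_nonneg_pos)
    ultimately have "(h has_real_derivative inverse (sqrt (q t + e\<^sup>2)) / 2 * (2 * G (z t) (z t) (Z t))) (at t within {0..1})"
      unfolding h_def[abs_def] by (intro DERIV_chain2[OF DERIV_real_sqrt])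
    then show ?thesis
      by (simp add: has_real_derivative_iff_has_vector_derivative[symmetric] h'_def h_def[of t] field_simps)
  qed
  have le: "h' t \<le> sqrt (G (z t) (Z t) (Z t))" if t: "t \<in> {0..1}" for t
  proof -
    have zt: "z t \<in> S" by (rule z(1)[OF t])
    have "G (z t) (z t) (z t) = q t" using gauss_lemma[OF self zt, of "z t"] by (simp add: q_def)
    then have "(G (z t) (z t) (Z t))\<^sup>2 \<le> q t * G (z t) (Z t) (Z t)"
      using G_cauchy_schwarz[OF zt, of "z t" "Z t"] by simp
    also have "\<dots> \<le> (q t + e\<^sup>2) * G (z t) (Z t) (Z t)"
      using G_nonneg[OF zt, of "Z t"] by (intro mult_right_mono) auto
    finally have "\<bar>G (z t) (z t) (Z t)\<bar> \<le> sqrt ((q t + e\<^sup>2) * G (z t) (Z t) (Z t))"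
      by (metis real_sqrt_abs real_sqrt_le_mono)
    then have "G (z t) (z t) (Z t) \<le> h t * sqrt (G (z t) (Z t) (Z t))"
      by (simp add: h_def real_sqrt_mult)
    then show ?thesis using h0[of t] by (simp add: h'_def divide_le_eq mult.commute)
  qed
  have "(h' has_integral (h 1 - h 0)) {0..1}"
    by (rule fundamental_theorem_of_calculus) (use hd in auto)
  moreover have "((\<lambda>t. sqrt (G (z t) (Z t) (Z t))) has_integral ?L) {0..1}"
    by (intro integrable_integral integrable_continuous_interval continuous_on_real_sqrt continuous_on_G z zc Z)
  ultimately have "h 1 - h 0 \<le> ?L" using le by (rule has_integral_le)
  \<comment> \<open>The regularisation costs exactly \<open>e\<close>, which the arbitrary choice of
    \<open>e\<close> absorbs.\<close>
  moreover have "h 0 = e" using e by (simp add: h_def q_def z G_simps[OF zero_in])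
  moreover have "sqrt (q 1) \<le> h 1" by (simp add: h_def)
  ultimately show "sqrt (G 0 (z 1) (z 1)) \<le> ?L + e" by (simp add: q_def)
qed

end

section \<open>Linear projections\<close>

text \<open>The Euclidean inner product is auxiliary here: it selects a complement of
  \<open>V\<close> and has nothing to do with the metric \<open>G\<close>.\<close>

lemma projection_with_kernel:
  fixes V :: "'a::euclidean_space set"
  assumes "subspace V"
  shows "\<exists>P. linear P \<and> (\<forall>v\<in>V. P v = 0) \<and> (\<forall>a. a - P a \<in> V)"
proof -
  obtain B where B: "B \<subseteq> V" "pairwise orthogonal B" "\<And>x. x \<in> B \<Longrightarrow> norm x = 1" "independent B" "span B = V"
    using orthonormal_basis_subspace[OF assms] by metis
  have fin: "finite B" using B(4) by (rule independent_imp_finite)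
  define P where "P a = a - (\<Sum>b\<in>B. (a \<bullet> b) *\<^sub>R b)" for a
  have lin: "linear P"
    unfolding P_def by (intro linearI)
      (simp_all add: inner_add_left scaleR_add_left sum.distrib scaleR_sum_right algebra_simps)
  have "P v = 0" if "v \<in> V" for v
  proof (rule linear_eq_0_on_span[OF lin])
    show "v \<in> span B" using that B by simp
    fix x assume x: "x \<in> B"
    have "(\<Sum>b\<in>B. (x \<bullet> b) *\<^sub>R b) = (\<Sum>b\<in>B. if b = x then x else 0)"
    proof (rule sum.cong[OF refl])
      fix b assume b: "b \<in> B"
      show "(x \<bullet> b) *\<^sub>R b = (if b = x then x else 0)"
        using B(2,3) x b by (auto simp: pairwise_def orthogonal_def norm_eq_1)
    qed
    also have "\<dots> = x" using fin x by simp
    finally show "P x = 0" by (simp add: P_def)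
  qed
  moreover have "a - P a \<in> V" for a
  proof -
    have "(\<Sum>b\<in>B. (a \<bullet> b) *\<^sub>R b) \<in> span B" by (intro span_sum span_scale span_base)
    then show ?thesis unfolding B(5) by (simp add: P_def)
  qed
  ultimately show ?thesis using lin by blast
qed

section \<open>Parallel curvature with vanishing \<open>R(X,Y,Y,Y)\<close>\<close>

locale dual_symmetric_chart = symmetric_chart S \<Gamma> d\<Gamma> + normal_dual_chart S \<Gamma> d\<Gamma> \<Gamma>s d\<Gamma>s G
  for S :: "'a::euclidean_space set" and \<Gamma> d\<Gamma> \<Gamma>s d\<Gamma>s G +
  assumes R_cubic: "x \<in> S \<Longrightarrow> G x (R x a b b) b = 0"
begin

text \<open>Polarising \<open>R(X,Y,Y,Y) = 0\<close> and combining it with the Bianchi identities of \<open>R\<close> and of the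
  dual curvature gives \<open>4 R(X,Y,Z,Z) = 0\<close>.\<close>

lemma R_skew_diagonal:
  assumes x: "x \<in> S"
  shows "G x (R x a b c) c = 0"
proof -
  define r where "r a b c d = G x (R x a b c) d" for a b c d
  have anti: "r a b c d = - r b a c d" for a b c d
    unfolding r_def using R_antisym[of x a b c] by (simp add: G_simps[OF x])
  have bianchi: "r a b c d + r b c a d + r c a b d = 0" for a b c d
    using R_bianchi[OF x, of a b c] unfolding r_def
    by (simp add: G_simps(1)[OF x, symmetric] G_simps(9)[OF x])
  have bianchi_dual: "r a b d c + r b c d a + r c a d b = 0" for a b c d
  proof -
    have "G x d (dual.R x a b c) + G x d (dual.R x b c a) + G x d (dual.R x c a b) = 0"
      using dual.R_bianchi[OF x, of a b c]
      by (simp add: G_simps(2)[OF x, symmetric] G_simps(10)[OF x])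
    then show ?thesis
      using dual_curvature[OF x, of a b d c] dual_curvature[OF x, of b c d a] dual_curvature[OF x, of c a d b]
      unfolding r_def by linarith
  qed
  have polar: "r a b c c + r a c b c + r a c c b = 0" for a b c
  proof -
    \<comment> \<open>Subtracting the values at c + b and c - b leaves the parts odd in
      \<open>b\<close>. The part cubic in \<open>b\<close> vanishes by hypothesis, so the part
      linear in \<open>b\<close> vanishes too.\<close>
    have "r a (c + b) (c + b) (c + b) = 0" "r a (c + - b) (c + - b) (c + - b) = 0"
      "r a c c c = 0" "r a b b b = 0"
      unfolding r_def by (rule R_cubic[OF x])+
    then show ?thesis unfolding r_def by (simp add: G_simps[OF x] R_simps[OF x] del: add_uminus_conv_diff)
  qed
  have "r a b c c = 0"
    using polar[of a b c] polar[of b a c] anti[of b a c c] anti[of b c a c] anti[of c a b c]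
      bianchi[of a b c c] bianchi_dual[of a b c c] anti[of c a c b] anti[of b c c a] by linarith
  then show ?thesis by (simp add: r_def)
qed

lemma R_skew: assumes x: "x \<in> S" shows "G x (R x a b c) d = - G x c (R x a b d)"
proof -
  have "G x (R x a b (c + d)) (c + d) = 0" by (rule R_skew_diagonal[OF x])
  then have "G x (R x a b c) d + G x (R x a b d) c = 0"
    using R_skew_diagonal[OF x, of a b c] R_skew_diagonal[OF x, of a b d]
    by (simp add: G_simps[OF x] R_simps[OF x])
  then show ?thesis using G_sym[OF x, of "R x a b d" c] by linarith
qed

text \<open>The classical argument for a metric connection uses only skewness in both pairs and
  Bianchi's identity in its four cyclic versions; all of these are available once
  \<open>R_skew\<close> is.\<close>

lemma R_pair_sym: assumes x: "x \<in> S" shows "G x (R x a b c) d = G x (R x c d a) b"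
proof -
  define r where "r a b c d = G x (R x a b c) d" for a b c d
  have anti: "r a b c d = - r b a c d" for a b c d
    unfolding r_def using R_antisym[of x a b c] by (simp add: G_simps[OF x])
  have skew: "r a b c d = - r a b d c" for a b c d
    unfolding r_def using R_skew[OF x, of a b c d] G_sym[OF x, of c] by simp
  have bianchi: "r a b c d + r b c a d + r c a b d = 0" for a b c d
    using R_bianchi[OF x, of a b c] unfolding r_def
    by (simp add: G_simps(1)[OF x, symmetric] G_simps(9)[OF x])
  have "r a b c d = r c d a b"
    using bianchi[of a b c d] bianchi[of b c d a] bianchi[of c d a b] bianchi[of d a b c]
      skew[of a b c d] skew[of b c a d] skew[of c a b d] skew[of c d b a] skew[of d b c a]
      skew[of d a c b] skew[of a c d b] skew[of a b d c] skew[of b d a c] skew[of c d a b] skew[of d a b c]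
      anti[of c a b d] anti[of d b c a] anti[of a c d b] anti[of b d a c]
      anti[of c a d b] anti[of d b a c]
    by linarith
  then show ?thesis by (simp add: r_def)
qed

text \<open>Differentiate \<open>R_skew\<close>. The curvature is parallel for \<nabla>, whereas the
  metric is differentiated by \<Gamma> in one slot and by the dual symbols in the other. All
  \<Gamma>-terms cancel by skewness and only the difference K survives.\<close>

lemma K_R_commute: assumes x: "x \<in> S" shows "K x v (R x a b d) = R x a b (K x v d)"
proof -
  have "G x c (K x v (R x a b d) - R x a b (K x v d)) = 0" for c
  proof -
    have "((\<lambda>y. G y (R y a b c) d + G y c (R y a b d)) has_derivative
      (\<lambda>w. (G x (\<Gamma> x w (R x a b c)) d + G x (R x a b c) (\<Gamma>s x w d) +
          G x (- \<Gamma> x w (R x a b c) + R x (\<Gamma> x w a) b c + R x a (\<Gamma> x w b) c + R x a b (\<Gamma> x w c)) d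
          + G x (R x a b c) 0) +
        (G x (\<Gamma> x w c) (R x a b d) + G x c (\<Gamma>s x w (R x a b d)) + G x 0 (R x a b d) +
          G x c (- \<Gamma> x w (R x a b d) + R x (\<Gamma> x w a) b d + R x a (\<Gamma> x w b) d + R x a b (\<Gamma> x w d))))) (at x)"
      by (intro has_derivative_add has_derivative_G[OF x] R_parallel[OF x] has_derivative_const)
    moreover have "((\<lambda>y. G y (R y a b c) d + G y c (R y a b d)) has_derivative (\<lambda>w. 0)) (at x)"
      by (rule has_derivative_transform_within_open[OF has_derivative_const open_S x]) (simp add: R_skew)
    ultimately have "(G x (\<Gamma> x v (R x a b c)) d + G x (R x a b c) (\<Gamma>s x v d) +
          G x (- \<Gamma> x v (R x a b c) + R x (\<Gamma> x v a) b c + R x a (\<Gamma> x v b) c + R x a b (\<Gamma> x v c)) d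
          + G x (R x a b c) 0) +
        (G x (\<Gamma> x v c) (R x a b d) + G x c (\<Gamma>s x v (R x a b d)) + G x 0 (R x a b d) +
          G x c (- \<Gamma> x v (R x a b d) + R x (\<Gamma> x v a) b d + R x a (\<Gamma> x v b) d + R x a b (\<Gamma> x v d))) = 0"
      by (rule has_derivative_unique[THEN fun_cong])
    then show ?thesis
      by (simp add: K_def G_simps[OF x] R_simps[OF x] linear_diff[OF R_linear(3)[OF x]] R_skew[OF x])
  qed
  then have "K x v (R x a b d) - R x a b (K x v d) = 0" by (rule G_nondegenerate[OF x])
  then show ?thesis by simp
qed

text \<open>By \<open>K_R_commute\<close> and skewness, \<open>C(c,v,d) = G c (K v d)\<close> changes sign when \<open>R(a,b)\<close> is moved from
  one slot to another; three moves and the total symmetry of \<open>C\<close> give \<open>C(c,v,R d) = 0\<close>.\<close>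

lemma R_K: assumes x: "x \<in> S" shows "R x a b (K x v d) = 0"
proof (rule G_nondegenerate[OF x])
  fix c
  define C where "C c v d = G x c (K x v d)" for c v d
  have s1: "C c v d = C d v c" for c v d unfolding C_def by (rule G_K_sym[OF x])
  have s2: "C c v d = C c d v" for c v d unfolding C_def using K_sym[OF x, of v d] by simp
  have mv: "C c v (R x a b d) = - C (R x a b c) v d" for c v d
    unfolding C_def K_R_commute[OF x] using R_skew[OF x, of a b c "K x v d"] by simp
  have "C c v (R x a b d) = 0"
    using mv[of c v d] mv[of v c d] mv[of c d v] s1 s2 by (smt (verit, best))
  then show "G x c (R x a b (K x v d)) = 0" by (simp add: C_def K_R_commute[OF x])
qed

text \<open>Pair symmetry moves K from the last argument of R, where \<open>R_K\<close> annihilates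
  it, to the first, which is the slot defining the kernel.\<close>

lemma K_in_F: assumes x: "x \<in> S" shows "K x v d \<in> F 0"
proof -
  have "R x (K x v d) b c = 0" for b c
  proof (rule G_nondegenerate[OF x])
    fix e
    have "G x (R x (K x v d) b c) e = 0"
      using R_pair_sym[OF x, of "K x v d" b c e] R_K[OF x, of c e v d] by (simp add: G_simps[OF x])
    then show "G x e (R x (K x v d) b c) = 0" using G_sym[OF x, of e] by simp
  qed
  then have "K x v d \<in> F x" by (simp add: F_def)
  then show ?thesis using F_constant[OF x] by simp
qed

lemma \<Gamma>_K: "x \<in> S \<Longrightarrow> \<Gamma> x w (K x v d) = 0"
  using \<Gamma>_F[OF _ K_in_F] by blast

text \<open>The derivative of \<open>t\<^sup>2 (G (\<Gamma> x a) b - G a (\<Gamma> x b))\<close> along the ray through \<open>x\<close> vanishes if \<open>a\<close> and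
  \<open>b\<close> evolve by \<open>-K x\<close>.\<close>

lemma \<Gamma>_self_adjoint: assumes x: "x \<in> S" shows "G x (\<Gamma> x x a) b = G x a (\<Gamma> x x b)"
proof -
  have Kc: "continuous_on {0..1} (\<lambda>t. - K (t *\<^sub>R x) x v)" for v
    unfolding K_def by (intro continuous_intros continuous_on_\<Gamma> dual.continuous_on_\<Gamma>)
      (auto intro: star[OF x])
  have Kl: "linear (\<lambda>v. - K (t *\<^sub>R x) x v)" if "t \<in> {0..1}" for t
    by (intro linear_compose_neg bilinear_linear2[OF K_bilin] star[OF x that])
  \<comment> \<open>The values are prescribed at t = 1, where the claim is; at t = 0 the weight t^2
    makes both sides vanish. Moving by -K compensates the discrepancy of the two connections in the
    derivative of \<open>G\<close>, and by \<open>\<Gamma>_K\<close> it adds nothing to the Riccati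
    equation.\<close>
  have ex: "\<exists>f. f 1 = v \<and> (\<forall>t\<in>{0..1}. (f has_vector_derivative - K (t *\<^sub>R x) x (f t)) (at t within {0..1}))" for v
    by (rule linear_ode_exists[where L = "\<lambda>t v. - K (t *\<^sub>R x) x v", OF Kl Kc]) auto
  obtain f where f: "f 1 = a" "\<And>t. t \<in> {0..1} \<Longrightarrow> (f has_vector_derivative - K (t *\<^sub>R x) x (f t)) (at t within {0..1})"
    using ex[of a] by blast
  obtain g where g: "g 1 = b" "\<And>t. t \<in> {0..1} \<Longrightarrow> (g has_vector_derivative - K (t *\<^sub>R x) x (g t)) (at t within {0..1})"
    using ex[of b] by blast
  define M where "M f t = t\<^sup>2 *\<^sub>R \<Gamma> (t *\<^sub>R x) x (f t)" for f and t
  have Md: "(M f has_vector_derivative t\<^sup>2 *\<^sub>R R (t *\<^sub>R x) x (f t) x - \<Gamma> (t *\<^sub>R x) x (M f t)) (at t within {0..1})"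
    if t: "t \<in> {0..1}" and f: "(f has_vector_derivative - K (t *\<^sub>R x) x (f t)) (at t within {0..1})" for f t
  proof -
    let ?y = "t *\<^sub>R x"
    have y: "?y \<in> S" by (rule star[OF x t])
    show ?thesis
      using \<Gamma>_ray_riccati_along[OF x t f]
      by (simp add: M_def[abs_def] \<Gamma>_simps[OF y] \<Gamma>_K[OF y])
  qed
  define \<beta> where "\<beta> t = G (t *\<^sub>R x) (M f t) (g t) - G (t *\<^sub>R x) (f t) (M g t)" for t
  have \<beta>d: "(\<beta> has_vector_derivative 0) (at t within {0..1})" if t: "t \<in> {0..1}" for t
  proof -
    let ?y = "t *\<^sub>R x"
    have y: "?y \<in> S" by (rule star[OF x t])
    note d = f(2)[OF t] g(2)[OF t] Md[OF t f(2)[OF t]] Md[OF t g(2)[OF t]]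
    have "(\<beta> has_vector_derivative
      (G ?y (\<Gamma> ?y x (M f t)) (g t) + G ?y (M f t) (\<Gamma>s ?y x (g t))
        + G ?y (t\<^sup>2 *\<^sub>R R ?y x (f t) x - \<Gamma> ?y x (M f t)) (g t) + G ?y (M f t) (- K ?y x (g t))) -
      (G ?y (\<Gamma> ?y x (f t)) (M g t) + G ?y (f t) (\<Gamma>s ?y x (M g t))
        + G ?y (- K ?y x (f t)) (M g t) + G ?y (f t) (t\<^sup>2 *\<^sub>R R ?y x (g t) x - \<Gamma> ?y x (M g t)))) (at t within {0..1})"
      unfolding \<beta>_def
      by (intro has_vector_derivative_diff has_vector_derivative_G[OF star[OF x] t ray_derivative] d)
    moreover have "\<Gamma>s ?y x c = \<Gamma> ?y x c + K ?y x c" for c by (simp add: K_def)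
    moreover have "G ?y (R ?y x (f t) x) (g t) = G ?y (f t) (R ?y x (g t) x)"
      using R_pair_sym[OF y, of x "f t" x "g t"] G_sym[OF y, of "R ?y x (g t) x" "f t"] by simp
    moreover have "G ?y (K ?y x (f t)) (M g t) = G ?y (f t) (K ?y x (M g t))"
      using G_sym[OF y, of "K ?y x (f t)" "M g t"] G_K_sym[OF y, of "M g t" x "f t"] by simp
    moreover have "G ?y (M f t) (\<Gamma> ?y x (g t)) = G ?y (\<Gamma> ?y x (f t)) (M g t)"
      by (simp add: M_def G_simps[OF y])
    ultimately show ?thesis by (simp add: G_simps[OF y])
  qed
  have "\<beta> 1 = \<beta> 0"
  proof (rule constant_on_unit_interval[where u = \<beta>])
    show "continuous_on {0..1} \<beta>" by (rule continuous_on_if_vector_derivative[OF \<beta>d])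
    show "(\<beta> has_vector_derivative 0) (at t)" if "t \<in> {0<..<1}" for t
      by (rule vector_derivative_at_interior[OF \<beta>d that]) (use that in auto)
  qed auto
  then show ?thesis by (simp add: \<beta>_def M_def f g G_simps[OF zero_in])
qed

lemma subspace_F: "x \<in> S \<Longrightarrow> subspace (F x)"
  unfolding F_def by (auto simp: subspace_def R_simps)

text \<open>The \<open>\<nabla>\<^sup>*\<close>-geodesics through the origin are straight modulo \<open>F 0\<close>: with \<open>P\<close> a projection with
  kernel \<open>F 0\<close>, the defect \<open>\<zeta> = P (z - t z')\<close> satisfies \<open>t \<zeta>' = P (\<Gamma> \<zeta> \<zeta> - 2 \<Gamma> \<zeta> (P z))\<close>, hence
  vanishes, and then \<open>P z'\<close> is constant.\<close>

lemma dual_geodesic_transport: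
  assumes zS: "\<And>t. t \<in> {0..1} \<Longrightarrow> z t \<in> S" and z0: "z 0 = 0"
    and zd: "\<And>t. t \<in> {0..1} \<Longrightarrow> (z has_vector_derivative Z t) (at t within {0..1})"
    and Zd: "\<And>t. t \<in> {0..1} \<Longrightarrow> (Z has_vector_derivative - \<Gamma>s (z t) (Z t) (Z t)) (at t within {0..1})"
    and t: "t \<in> {0..1}"
  shows "\<Gamma> (z t) (Z t) (z 1) = 0"
proof -
  obtain P where P: "linear P" "\<And>f. f \<in> F 0 \<Longrightarrow> P f = 0" "\<And>a. a - P a \<in> F 0"
    using projection_with_kernel[OF subspace_F[OF zero_in]] by blast
  note P_simps = linear_add[OF P(1)] linear_diff[OF P(1)] linear_cmul[OF P(1)] linear_neg[OF P(1)] linear_0[OF P(1)]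
  \<comment> \<open>By \<open>\<Gamma>_F\<close> the symbols see vectors only modulo
    \<open>F 0\<close>. \<open>P\<close> also annihilates K, so modulo \<open>F 0\<close> the dual
    geodesic obeys the \<nabla>-geodesic equation.\<close>
  have \<Gamma>P: "\<Gamma> x a b = \<Gamma> x (P a) (P b)" if x: "x \<in> S" for x a b
  proof -
    have "\<Gamma> x c d = \<Gamma> x c (P d)" for c d
      using \<Gamma>_F[OF x P(3)[of d], of c] by (simp add: \<Gamma>_simps[OF x])
    then show ?thesis using sym[OF x] by metis
  qed
  have PK: "P (K x a b) = 0" if "x \<in> S" for x a b by (rule P(2)[OF K_in_F[OF that]])
  have zc: "continuous_on {0..1} z" by (rule continuous_on_if_vector_derivative[OF zd])
  have Zc: "continuous_on {0..1} Z" by (rule continuous_on_if_vector_derivative[OF Zd])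
  have "bounded (Z ` {0..1})" by (intro compact_imp_bounded compact_continuous_image Zc) auto
  then obtain M where M: "0 < M" "\<And>t. t \<in> {0..1} \<Longrightarrow> norm (Z t) \<le> M"
    by (auto simp: bounded_pos)
  \<comment> \<open>This linear growth supplies the factor t that compensates the division by t in
    the equation for \<zeta>.\<close>
  have zM: "norm (z t) \<le> M * t" if t: "t \<in> {0..1}" for t
  proof -
    have "norm (z t - z 0) \<le> M * norm (t - 0)"
    proof (rule differentiable_bound[of "{0..1}" z "\<lambda>t h. h *\<^sub>R Z t"])
      show "(z has_derivative (\<lambda>h. h *\<^sub>R Z s)) (at s within {0..1})" if "s \<in> {0..1}" for s
        using zd[OF that] by (simp add: has_vector_derivative_def)
      show "onorm (\<lambda>h. h *\<^sub>R Z s) \<le> M" if "s \<in> {0..1}" for s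
        by (rule onorm_le) (simp add: mult.commute[of M] mult_left_mono M(2)[OF that])
    qed (use t in auto)
    then show ?thesis using t by (simp add: z0)
  qed
  obtain p where p: "0 < p" "\<And>a. norm (P a) \<le> p * norm a"
    using bounded_linear.pos_bounded[OF linear_conv_bounded_linear[THEN iffD1, OF P(1)]]
    by (auto simp: mult.commute)
  have "\<exists>C>0. \<forall>t\<in>{0..1}. \<forall>a b. norm (\<Gamma> (z t) a b) \<le> C * norm a * norm b"
  proof (rule bilinear_family_bounded)
    show "continuous_on {0..1} (\<lambda>t. \<Gamma> (z t) a b)" for a b
      by (intro continuous_on_\<Gamma> zS zc continuous_on_const)
    show "bilinear (\<Gamma> (z t))" if "t \<in> {0..1}" for t by (rule bilin[OF zS[OF that]])
  qed auto
  then obtain C where C: "0 < C" "\<And>t a b. t \<in> {0..1} \<Longrightarrow> norm (\<Gamma> (z t) a b) \<le> C * norm a * norm b" by blast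
  define \<zeta> where "\<zeta> t = P (z t - t *\<^sub>R Z t)" for t
  define D where "D t = t *\<^sub>R P (\<Gamma> (z t) (Z t) (Z t))" for t
  have Ps: "P (\<Gamma>s (z t) (Z t) (Z t)) = P (\<Gamma> (z t) (Z t) (Z t))" if "t \<in> {0..1}" for t
    using PK[OF zS[OF that], of "Z t" "Z t"] by (simp add: K_def P_simps)
  have \<zeta>d: "(\<zeta> has_vector_derivative D t) (at t within {0..1})" if t: "t \<in> {0..1}" for t
  proof -
    have 1: "((\<lambda>t. t) has_real_derivative 1) (at t within {0..1})" by (auto intro!: derivative_eq_intros)
    have "(\<zeta> has_vector_derivative P (Z t - (t *\<^sub>R - \<Gamma>s (z t) (Z t) (Z t) + 1 *\<^sub>R Z t))) (at t within {0..1})"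
      unfolding \<zeta>_def
      by (intro bounded_linear.has_vector_derivative[OF linear_conv_bounded_linear[THEN iffD1, OF P(1)]]
          has_vector_derivative_diff has_vector_derivative_scaleR 1 zd Zd t)
    then show ?thesis by (simp add: D_def P_simps Ps[OF t])
  qed
  have zero: "\<Gamma> (z t) (P (z t)) (P (z t)) = 0" if "t \<in> {0..1}" for t
    using radial[OF zS[OF that]] \<Gamma>P[OF zS[OF that], of "z t" "z t"] by simp
  have bound: "norm (D t) \<le> (p * C * p * (2 * M)) * norm (\<zeta> t)" if t: "t \<in> {0<..<1}" for t
  proof -
    have t': "t \<in> {0..1}" and t0: "0 < t" using t by auto
    have x: "z t \<in> S" by (rule zS[OF t'])
    have e: "t *\<^sub>R P (Z t) = P (z t) - \<zeta> t" by (simp add: \<zeta>_def P_simps)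
    have "t *\<^sub>R D t = P (\<Gamma> (z t) (t *\<^sub>R P (Z t)) (t *\<^sub>R P (Z t)))"
      by (simp add: D_def \<Gamma>P[OF x, of "Z t" "Z t"] \<Gamma>_simps[OF x] P_simps)
    \<comment> \<open>Expanding the square of P z - \<zeta>, its term free of \<zeta> vanishes by
      radiality; every remaining term contains \<zeta>, as a Gronwall bound requires.\<close>
    also have "\<dots> = P (\<Gamma> (z t) (\<zeta> t) (\<zeta> t - 2 *\<^sub>R P (z t)))"
      unfolding e using zero[OF t'] sym[OF x, of "P (z t)" "\<zeta> t"]
      by (simp add: \<Gamma>_simps[OF x] scaleR_2 P_simps)
    also have "norm \<dots> \<le> p * (C * norm (\<zeta> t) * norm (\<zeta> t - 2 *\<^sub>R P (z t)))"
      by (intro order_trans[OF p(2)] mult_left_mono C t') (use p in auto)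
    also have "\<dots> \<le> p * (C * norm (\<zeta> t) * (p * (2 * M * t)))"
    proof -
      have "\<zeta> t - 2 *\<^sub>R P (z t) = P (- (z t + t *\<^sub>R Z t))" by (simp add: \<zeta>_def P_simps scaleR_2)
      also have "norm \<dots> \<le> p * norm (- (z t + t *\<^sub>R Z t))" by (rule p(2))
      also have "\<dots> \<le> p * (2 * M * t)"
      proof -
        have "norm (z t + t *\<^sub>R Z t) \<le> norm (z t) + norm (t *\<^sub>R Z t)" by (rule norm_triangle_ineq)
        also have "\<dots> \<le> M * t + t * M" using zM[OF t'] M(2)[OF t'] t0 by (intro add_mono) auto
        finally show ?thesis unfolding norm_minus_cancel using p(1) by (intro mult_left_mono) auto
      qed
      finally show ?thesis using p(1) C(1) by (intro mult_left_mono) auto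
    qed
    finally have "t * norm (D t) \<le> t * ((p * C * p * (2 * M)) * norm (\<zeta> t))"
      using t0 by (simp add: algebra_simps)
    then show ?thesis using t0 by simp
  qed
  have \<zeta>0: "\<zeta> t = 0" if t: "t \<in> {0..1}" for t
  proof (rule vanishing_derivative_bound[where u = \<zeta> and F = D and ?t0.0 = 0, OF _ _ bound])
    show "continuous_on {0..1} \<zeta>" by (rule continuous_on_if_vector_derivative[OF \<zeta>d])
    show "(\<zeta> has_vector_derivative D t) (at t)" if "t \<in> {0<..<1}" for t
      by (rule vector_derivative_at_interior[OF \<zeta>d that]) (use that in auto)
  qed (use t in \<open>auto simp: \<zeta>_def z0 P_simps\<close>)
  have Y: "t *\<^sub>R P (Z t) = P (z t)" if "t \<in> {0..1}" for t
    using \<zeta>0[OF that] by (simp add: \<zeta>_def P_simps)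
  have YY: "\<Gamma> (z t) (P (Z t)) (P (Z t)) = 0" if t: "t \<in> {0<..1}" for t
  proof -
    have t': "t \<in> {0..1}" using t by auto
    have "t *\<^sub>R (t *\<^sub>R \<Gamma> (z t) (P (Z t)) (P (Z t))) = \<Gamma> (z t) (t *\<^sub>R P (Z t)) (t *\<^sub>R P (Z t))"
      by (simp add: \<Gamma>_simps[OF zS[OF t']])
    also have "\<dots> = 0" unfolding Y[OF t'] by (rule zero[OF t'])
    finally show ?thesis using t by simp
  qed
  have Yd: "((\<lambda>t. P (Z t)) has_vector_derivative P (- \<Gamma>s (z t) (Z t) (Z t))) (at t within {0..1})" if "t \<in> {0..1}" for t
    by (intro bounded_linear.has_vector_derivative[OF linear_conv_bounded_linear[THEN iffD1, OF P(1)]] Zd that)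
  have Yc: "P (Z s) = P (z 1)" if s: "s \<in> {0..1}" for s
  proof -
    have "P (Z s) = P (Z 1)"
    proof (rule constant_on_unit_interval[where u = "\<lambda>t. P (Z t)"])
      show "continuous_on {0..1} (\<lambda>t. P (Z t))" by (rule continuous_on_if_vector_derivative[OF Yd])
      fix t :: real assume t: "t \<in> {0<..<1}"
      then have t': "t \<in> {0..1}" by auto
      have "P (- \<Gamma>s (z t) (Z t) (Z t)) = 0"
        using YY[of t] t by (simp add: P_simps Ps[OF t'] \<Gamma>P[OF zS[OF t'], of "Z t" "Z t"])
      then show "((\<lambda>t. P (Z t)) has_vector_derivative 0) (at t)"
        using vector_derivative_at_interior[OF Yd[OF t'] t] by simp
    qed (use s in auto)
    then show ?thesis using Y[of 1] by simp
  qed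
  show ?thesis
  proof (rule zero_at_left_end[where u = "\<lambda>t. \<Gamma> (z t) (Z t) (z 1)"])
    show "continuous_on {0..1} (\<lambda>t. \<Gamma> (z t) (Z t) (z 1))"
      by (intro continuous_on_\<Gamma> zS zc Zc continuous_on_const)
    fix t :: real assume t: "t \<in> {0<..1}"
    then have t': "t \<in> {0..1}" by auto
    \<comment> \<open>Modulo \<open>F 0\<close> the end point \<open>z 1\<close> equals the velocity
      \<open>Z t\<close>, so the claim is the vanishing just found for two equal arguments.\<close>
    show "\<Gamma> (z t) (Z t) (z 1) = 0"
      using YY[OF t] unfolding \<Gamma>P[OF zS[OF t'], of "Z t" "z 1"] Yc[OF t'] .
  qed (rule t)
qed

text \<open>By self-adjointness of \<open>\<Gamma> x x\<close> the one-form \<open>w \<mapsto> G x x w\<close> is closed.\<close>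

lemma radial_form_path_independent:
  assumes zS: "\<And>t. t \<in> {0..1} \<Longrightarrow> z t \<in> S" and z0: "z 0 = 0"
    and zd: "\<And>t. t \<in> {0..1} \<Longrightarrow> (z has_vector_derivative Z t) (at t within {0..1})"
    and Zc: "continuous_on {0..1} Z"
  shows "integral {0..1} (\<lambda>t. G (z t) (Z t) (z t)) = integral {0..1} (\<lambda>s. s * G (s *\<^sub>R z 1) (z 1) (z 1))"
proof -
  have zc: "continuous_on {0..1} z" by (rule continuous_on_if_vector_derivative[OF zd])
  have sz: "s *\<^sub>R z t \<in> S" if "s \<in> {0..1}" "t \<in> {0..1}" for s t by (rule star[OF zS[OF that(2)] that(1)])
  \<comment> \<open>Poincare's primitive: integrating over \<open>s\<close> integrates the form
    along the ray to \<open>z t\<close>. The t-derivative of this primitive has to be the form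
    evaluated on \<open>Z t\<close>.\<close>
  define \<phi> where "\<phi> t s = s * G (s *\<^sub>R z t) (z t) (z t)" for t s
  define D where "D t s = s * (G (s *\<^sub>R z t) (\<Gamma> (s *\<^sub>R z t) (s *\<^sub>R Z t) (z t)) (z t)
      + G (s *\<^sub>R z t) (z t) (\<Gamma>s (s *\<^sub>R z t) (s *\<^sub>R Z t) (z t))
      + G (s *\<^sub>R z t) (Z t) (z t) + G (s *\<^sub>R z t) (z t) (Z t))" for t s
  have \<phi>d: "((\<lambda>t. \<phi> t s) has_vector_derivative D t s) (at t within {0..1})"
    if t: "t \<in> {0..1}" and s: "s \<in> cbox 0 1" for t s
  proof -
    have s': "s \<in> {0..1}" using s by simp
    have 1: "((\<lambda>t. s *\<^sub>R z t) has_vector_derivative s *\<^sub>R Z t) (at t within {0..1})"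
      by (intro bounded_linear.has_vector_derivative[OF bounded_linear_scaleR_right] zd t)
    show ?thesis unfolding \<phi>_def D_def
      by (intro has_vector_derivative_mult_right
          has_vector_derivative_G[where z = "\<lambda>t. s *\<^sub>R z t", OF sz[OF s'] t 1 zd[OF t] zd[OF t]])
  qed
  have \<phi>c: "continuous_on {0..1} (\<phi> t)" if t: "t \<in> {0..1}" for t
    unfolding \<phi>_def[abs_def]
    by (intro continuous_on_mult continuous_on_G continuous_intros) (auto intro: sz t)
  have Dc: "continuous_on ({0..1} \<times> cbox 0 1) (\<lambda>(t, s). D t s)"
  proof -
    have z1: "continuous_on ({0..1} \<times> {0..1::real}) (\<lambda>q. z (fst q))"
      by (rule continuous_on_compose2[OF zc]) (auto intro: continuous_intros)
    have Z1: "continuous_on ({0..1} \<times> {0..1::real}) (\<lambda>q. Z (fst q))"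
      by (rule continuous_on_compose2[OF Zc]) (auto intro: continuous_intros)
    have s1: "continuous_on ({0..1::real} \<times> {0..1::real}) (\<lambda>q. snd q)" by (intro continuous_intros)
    have sz1: "continuous_on ({0..1} \<times> {0..1}) (\<lambda>q. snd q *\<^sub>R z (fst q))"
      "continuous_on ({0..1} \<times> {0..1}) (\<lambda>q. snd q *\<^sub>R Z (fst q))"
      by (intro continuous_on_scaleR s1 z1 Z1)+
    have in1: "snd q *\<^sub>R z (fst q) \<in> S" if "q \<in> {0..1} \<times> {0..1}" for q using sz that by auto
    show ?thesis
      unfolding D_def split_beta cbox_interval
      by (intro continuous_on_mult continuous_on_add s1 continuous_on_G[OF in1]
          continuous_on_\<Gamma>[OF in1] dual.continuous_on_\<Gamma>[OF in1] z1 Z1 sz1)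
  qed
  have int: "integral {0..1} (D t) = G (z t) (Z t) (z t)" if t: "t \<in> {0..1}" for t
  proof -
    \<comment> \<open>An explicit antiderivative in \<open>s\<close>. Its derivative differs from
      \<open>D\<close> in one \<Gamma>-term, where \<open>Z t\<close> and a radial argument are
      interchanged; self-adjointness removes the difference.\<close>
    have "((\<lambda>s. s\<^sup>2 * G (s *\<^sub>R z t) (z t) (Z t)) has_vector_derivative D t s) (at s within {0..1})"
      if s: "s \<in> {0..1}" for s
    proof -
      let ?y = "s *\<^sub>R z t"
      have y: "?y \<in> S" by (rule sz[OF s t])
      have 1: "((\<lambda>s. G (s *\<^sub>R z t) (z t) (Z t)) has_vector_derivative
          G ?y (\<Gamma> ?y (z t) (z t)) (Z t) + G ?y (z t) (\<Gamma>s ?y (z t) (Z t)) + G ?y 0 (Z t) + G ?y (z t) 0) (at s within {0..1})"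
        by (rule has_vector_derivative_G[OF star[OF zS[OF t]] s ray_derivative has_vector_derivative_const has_vector_derivative_const])
      have 2: "((\<lambda>s. s\<^sup>2) has_vector_derivative 2 * s) (at s within {0..1})"
        unfolding has_real_derivative_iff_has_vector_derivative[symmetric] by (auto intro!: derivative_eq_intros)
      have "((\<lambda>s. s\<^sup>2 * G (s *\<^sub>R z t) (z t) (Z t)) has_vector_derivative
          s\<^sup>2 * (G ?y (\<Gamma> ?y (z t) (z t)) (Z t) + G ?y (z t) (\<Gamma>s ?y (z t) (Z t)) + G ?y 0 (Z t) + G ?y (z t) 0)
          + (2 * s) * G ?y (z t) (Z t)) (at s within {0..1})"
        by (rule has_vector_derivative_mult[OF 2 1])
      moreover have "s * (s * G ?y (\<Gamma> ?y (Z t) (z t)) (z t)) = s * (s * G ?y (\<Gamma> ?y (z t) (z t)) (Z t))"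
      proof -
        have "s * G ?y (\<Gamma> ?y (Z t) (z t)) (z t) = G ?y (\<Gamma> ?y ?y (Z t)) (z t)"
          by (simp add: sym[OF y, of "Z t"] \<Gamma>_simps[OF y] G_simps[OF y])
        also have "\<dots> = G ?y (Z t) (\<Gamma> ?y ?y (z t))" by (rule \<Gamma>_self_adjoint[OF y])
        also have "\<dots> = s * G ?y (\<Gamma> ?y (z t) (z t)) (Z t)"
          using G_sym[OF y, of "Z t"] by (simp add: \<Gamma>_simps[OF y] G_simps[OF y])
        finally show ?thesis by simp
      qed
      ultimately show ?thesis
        unfolding D_def using G_sym[OF y, of "Z t" "z t"] dual.sym[OF y, of "Z t" "z t"]
        by (cases "s = 0")
          (simp_all add: G_simps[OF y] \<Gamma>_simps[OF y] dual.\<Gamma>_simps[OF y] power2_eq_square algebra_simps)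
    qed
    then have "(D t has_integral 1\<^sup>2 * G (1 *\<^sub>R z t) (z t) (Z t) - 0\<^sup>2 * G (0 *\<^sub>R z t) (z t) (Z t)) {0..1}"
      by (intro fundamental_theorem_of_calculus) auto
    then show ?thesis using G_sym[OF zS[OF t], of "Z t" "z t"] by (simp add: integral_unique)
  qed
  have "((\<lambda>t. integral (cbox 0 1) (\<phi> t)) has_vector_derivative integral (cbox 0 1) (D t)) (at t within {0..1})"
    if t: "t \<in> {0..1}" for t
  proof (rule leibniz_rule_vector_derivative[OF \<phi>d _ Dc t convex_real_interval(5)])
    show "\<phi> t integrable_on cbox 0 1" if "t \<in> {0..1}" for t
      unfolding cbox_interval by (rule integrable_continuous_interval[OF \<phi>c[OF that]])
  qed
  then have "((\<lambda>t. G (z t) (Z t) (z t)) has_integral integral {0..1} (\<phi> 1) - integral {0..1} (\<phi> 0)) {0..1}"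
    by (intro fundamental_theorem_of_calculus) (auto simp: int)
  moreover have "\<phi> 0 = (\<lambda>s. 0)" by (simp add: \<phi>_def[abs_def] z0 G_simps[OF zero_in])
  moreover have "\<phi> 1 = (\<lambda>s. s * G (s *\<^sub>R z 1) (z 1) (z 1))" by (simp add: \<phi>_def[abs_def])
  ultimately show ?thesis by (simp add: integral_unique)
qed

end

section \<open>Passage from the manifold to its charts\<close>

section \<open>Charts and tangent vectors\<close>

locale manifold =
  fixes A :: "('m::{t2_space, second_countable_topology}, 'n::finite) chart set"
  assumes manifold: "smooth_manifold A"
begin

lemma is_chart: "c \<in> A \<Longrightarrow> is_chart c"
  using manifold by (simp add: smooth_manifold_def)

lemma open_cdom: "c \<in> A \<Longrightarrow> open (cdom c)"
  and open_image: "c \<in> A \<Longrightarrow> open (cmap c ` cdom c)"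
  and chart_homeomorphism: "c \<in> A \<Longrightarrow> homeomorphism (cdom c) (cmap c ` cdom c) (cmap c) (cinv c)"
  using is_chart[of c] by (simp_all add: is_chart_def)

lemma cinv_cmap: "c \<in> A \<Longrightarrow> p \<in> cdom c \<Longrightarrow> cinv c (cmap c p) = p"
  using homeomorphism_apply1[OF chart_homeomorphism] .

lemma cmap_cinv: "c \<in> A \<Longrightarrow> x \<in> cmap c ` cdom c \<Longrightarrow> cmap c (cinv c x) = x"
  using homeomorphism_apply2[OF chart_homeomorphism] .

lemma cinv_in: "c \<in> A \<Longrightarrow> x \<in> cmap c ` cdom c \<Longrightarrow> cinv c x \<in> cdom c"
  by (auto simp: cinv_cmap)

lemma open_chart_image: assumes c: "c \<in> A" and W: "open W" shows "open (cmap c ` (W \<inter> cdom c))"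
proof -
  have "openin (top_of_set (cmap c ` cdom c)) (cmap c ` (W \<inter> cdom c))"
    by (rule homeomorphism_imp_open_map[OF chart_homeomorphism[OF c]])
      (use W in \<open>auto simp: openin_open\<close>)
  then show ?thesis by (rule openin_open_trans[OF _ open_image[OF c]])
qed

lemma open_chart_image': "c \<in> A \<Longrightarrow> open W \<Longrightarrow> W \<subseteq> cdom c \<Longrightarrow> open (cmap c ` W)"
  using open_chart_image[of c W] by (simp add: Int_absorb2)

lemma chart_at: obtains c where "c \<in> A" "p \<in> cdom c"
proof -
  have "p \<in> (\<Union>c\<in>A. cdom c)" using manifold by (simp add: smooth_manifold_def)
  then show ?thesis using that by blast
qed

lemma continuous_on_cmap: "c \<in> A \<Longrightarrow> continuous_on (cdom c) (cmap c)"
  using chart_homeomorphism by (auto simp: homeomorphism_def)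

lemma continuous_on_cinv: "c \<in> A \<Longrightarrow> continuous_on (cmap c ` cdom c) (cinv c)"
  using chart_homeomorphism by (auto simp: homeomorphism_def)

lemma transition_smooth:
  assumes "c \<in> A" "d \<in> A"
  shows "smooth_on (cmap c ` (cdom c \<inter> cdom d)) (cmap d \<circ> cinv c)"
proof -
  have "compatible c d" using manifold assms by (simp add: smooth_manifold_def)
  then show ?thesis by (simp add: compatible_def)
qed

lemma open_overlap: "c \<in> A \<Longrightarrow> d \<in> A \<Longrightarrow> open (cmap c ` (cdom c \<inter> cdom d))"
  by (intro open_chart_image' open_Int open_cdom) auto

definition Dtrans :: "('m, 'n) chart \<Rightarrow> ('m, 'n) chart \<Rightarrow> 'm \<Rightarrow> real ^ 'n \<Rightarrow> real ^ 'n" where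
  "Dtrans c d p = frechet_derivative (cmap d \<circ> cinv c) (at (cmap c p))"

lemma transition_derivative:
  assumes "c \<in> A" "d \<in> A" "p \<in> cdom c" "p \<in> cdom d"
  shows "((cmap d \<circ> cinv c) has_derivative Dtrans c d p) (at (cmap c p))"
  unfolding Dtrans_def
  by (rule smooth_on_has_derivative[OF transition_smooth[OF assms(1,2)]]) (use assms in auto)

lemma Dtrans_linear:
  "c \<in> A \<Longrightarrow> d \<in> A \<Longrightarrow> p \<in> cdom c \<Longrightarrow> p \<in> cdom d \<Longrightarrow> linear (Dtrans c d p)"
  using has_derivative_linear[OF transition_derivative] .

lemma derivative_change_chart:
  assumes c: "c \<in> A" "p \<in> cdom c" and d: "d \<in> A" "p \<in> cdom d"
    and f: "((\<lambda>x. f (cinv d x)) has_derivative f') (at (cmap d p))"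
  shows "((\<lambda>x. f (cinv c x)) has_derivative (\<lambda>u. f' (Dtrans c d p u))) (at (cmap c p))"
proof -
  have "(cmap d \<circ> cinv c) (cmap c p) = cmap d p" using cinv_cmap[OF c] by simp
  then have "((\<lambda>x. f (cinv d ((cmap d \<circ> cinv c) x))) has_derivative (\<lambda>u. f' (Dtrans c d p u))) (at (cmap c p))"
    using has_derivative_compose[OF transition_derivative[OF c(1) d(1) c(2) d(2)], of "\<lambda>x. f (cinv d x)" f'] f
    by simp
  then show ?thesis
    by (rule has_derivative_transform_within_open[OF _ open_overlap[OF c(1) d(1)]])
      (use c d in \<open>auto simp: cinv_cmap\<close>)
qed

lemma Dtrans_trans:
  assumes "c \<in> A" "d \<in> A" "e \<in> A" "p \<in> cdom c" "p \<in> cdom d" "p \<in> cdom e"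
  shows "Dtrans d e p (Dtrans c d p u) = Dtrans c e p u"
proof -
  have "((\<lambda>x. cmap e (cinv c x)) has_derivative (\<lambda>u. Dtrans d e p (Dtrans c d p u))) (at (cmap c p))"
    by (rule derivative_change_chart[where d = d and f = "cmap e"])
      (simp_all add: assms transition_derivative[of d e p, unfolded comp_def])
  moreover have "((\<lambda>x. cmap e (cinv c x)) has_derivative Dtrans c e p) (at (cmap c p))"
    using transition_derivative[of c e p] assms by (simp add: comp_def)
  ultimately have "(\<lambda>u. Dtrans d e p (Dtrans c d p u)) = Dtrans c e p" by (rule has_derivative_unique)
  then show ?thesis by metis
qed

lemma Dtrans_id: assumes "c \<in> A" "p \<in> cdom c" shows "Dtrans c c p u = u"
proof -
  have "((\<lambda>x. x) has_derivative Dtrans c c p) (at (cmap c p))"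
    by (rule has_derivative_transform_within_open[OF transition_derivative[OF assms(1,1,2,2)]
          open_overlap[OF assms(1,1)]])
      (use assms in \<open>auto simp: cinv_cmap\<close>)
  then have "Dtrans c c p = (\<lambda>x. x)" by (rule has_derivative_unique[OF _ has_derivative_ident])
  then show ?thesis by simp
qed

lemma coord_vec_eq:
  "coord_vec A c p u = (\<lambda>d. if d \<in> A \<and> p \<in> cdom d then Dtrans c d p u else 0)"
  unfolding coord_vec_def Dtrans_def by (rule refl)

lemma coord_vec_component:
  "c \<in> A \<Longrightarrow> p \<in> cdom c \<Longrightarrow> coord_vec A c p u c = u"
  by (simp add: coord_vec_eq Dtrans_id)

lemma tangent_space_iff:
  "v \<in> tangent_space A p \<longleftrightarrow> (\<forall>c. \<not> (c \<in> A \<and> p \<in> cdom c) \<longrightarrow> v c = 0) \<and>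
     (\<forall>c\<in>A. \<forall>d\<in>A. p \<in> cdom c \<and> p \<in> cdom d \<longrightarrow> v d = Dtrans c d p (v c))"
  by (simp add: tangent_space_def Dtrans_def)

lemma tangent_component:
  "v \<in> tangent_space A p \<Longrightarrow> c \<in> A \<Longrightarrow> d \<in> A \<Longrightarrow> p \<in> cdom c \<Longrightarrow> p \<in> cdom d \<Longrightarrow> v d = Dtrans c d p (v c)"
  unfolding tangent_space_iff by blast

lemma coord_vec_tangent: "c \<in> A \<Longrightarrow> p \<in> cdom c \<Longrightarrow> coord_vec A c p u \<in> tangent_space A p"
  unfolding tangent_space_iff by (simp add: coord_vec_eq Dtrans_trans)

lemma tangent_eq_coord_vec:
  assumes "v \<in> tangent_space A p" "c \<in> A" "p \<in> cdom c"
  shows "v = coord_vec A c p (v c)"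
proof
  fix d
  show "v d = coord_vec A c p (v c) d"
  proof (cases "d \<in> A \<and> p \<in> cdom d")
    case True
    then show ?thesis using tangent_component[OF assms(1,2) _ assms(3), of d] by (simp add: coord_vec_eq)
  next
    case False
    then have "v d = 0" using assms(1) unfolding tangent_space_iff by blast
    then show ?thesis using False by (auto simp: coord_vec_eq)
  qed
qed

lemma tangent_eqI:
  "u \<in> tangent_space A p \<Longrightarrow> v \<in> tangent_space A p \<Longrightarrow> c \<in> A \<Longrightarrow> p \<in> cdom c \<Longrightarrow> u c = v c \<Longrightarrow> u = v"
  by (metis tangent_eq_coord_vec)

lemma tangent_lincomb:
  assumes "u \<in> tangent_space A p" "v \<in> tangent_space A p"
  shows "(\<lambda>c. a *\<^sub>R u c + b *\<^sub>R v c) \<in> tangent_space A p"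
  unfolding tangent_space_iff
proof (intro conjI allI impI ballI)
  fix c assume "\<not> (c \<in> A \<and> p \<in> cdom c)"
  then have "u c = 0" "v c = 0" using assms unfolding tangent_space_iff by blast+
  then show "a *\<^sub>R u c + b *\<^sub>R v c = 0" by simp
next
  fix c d assume cd: "c \<in> A" "d \<in> A" "p \<in> cdom c \<and> p \<in> cdom d"
  then show "a *\<^sub>R u d + b *\<^sub>R v d = Dtrans c d p (a *\<^sub>R u c + b *\<^sub>R v c)"
    using tangent_component[OF assms(1), of c d] tangent_component[OF assms(2), of c d] Dtrans_linear[of c d p]
    by (simp add: linear_add linear_cmul)
qed

lemma tangent_add: "u \<in> tangent_space A p \<Longrightarrow> v \<in> tangent_space A p \<Longrightarrow> tadd u v \<in> tangent_space A p"
  using tangent_lincomb[of u p v 1 1] by simp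

lemma tangent_scale: "u \<in> tangent_space A p \<Longrightarrow> tscale a u \<in> tangent_space A p"
  using tangent_lincomb[of u p u a 0] by simp

lemma coord_vec_lincomb:
  assumes "c \<in> A" "p \<in> cdom c"
  shows "coord_vec A c p (a *\<^sub>R u + b *\<^sub>R v) = tadd (tscale a (coord_vec A c p u)) (tscale b (coord_vec A c p v))"
  by (rule tangent_eqI[OF coord_vec_tangent[OF assms] _ assms])
    (simp_all add: coord_vec_component[OF assms] tangent_lincomb coord_vec_tangent[OF assms])

lemma coord_vec_add: "c \<in> A \<Longrightarrow> p \<in> cdom c \<Longrightarrow>
    coord_vec A c p (u + v) = tadd (coord_vec A c p u) (coord_vec A c p v)"
  using coord_vec_lincomb[of c p 1 u 1 v] by simp

lemma coord_vec_scale: "c \<in> A \<Longrightarrow> p \<in> cdom c \<Longrightarrow>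
    coord_vec A c p (a *\<^sub>R u) = tscale a (coord_vec A c p u)"
  using coord_vec_lincomb[of c p a u 0 u] by simp

text \<open>The chain rule makes the chart picked by \<open>SOME\<close> irrelevant, so the
  derivative may be computed in whichever chart is at hand.\<close>

lemma dir_deriv_eq:
  assumes c: "c \<in> A" "p \<in> cdom c" and v: "v \<in> tangent_space A p"
    and f: "((\<lambda>x. f (cinv c x)) has_derivative f') (at (cmap c p))"
  shows "dir_deriv A p v f = f' (v c)"
proof -
  define d where "d = (SOME c. c \<in> A \<and> p \<in> cdom c)"
  have d: "d \<in> A" "p \<in> cdom d"
    unfolding d_def using someI_ex[of "\<lambda>c. c \<in> A \<and> p \<in> cdom c"] c by blast+
  have "((\<lambda>x. f (cinv d x)) has_derivative (\<lambda>u. f' (Dtrans d c p u))) (at (cmap d p))"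
    by (rule derivative_change_chart[OF d c f])
  then have "frechet_derivative (f \<circ> cinv d) (at (cmap d p)) = (\<lambda>u. f' (Dtrans d c p u))"
    by (simp add: frechet_derivative_at[symmetric] comp_def)
  then show ?thesis
    using tangent_component[OF v d(1) c(1) d(2) c(2)] by (simp add: dir_deriv_def d_def[symmetric])
qed

section \<open>Smooth functions and vector fields in a chart\<close>

lemma change_chart_smooth:
  fixes f :: "'m \<Rightarrow> 'b::real_normed_vector"
  assumes c: "c \<in> A" and d: "d \<in> A" and W: "open W" "W \<subseteq> cdom c"
    and f: "smooth_on (cmap c ` W) (\<lambda>x. f (cinv c x))"
  shows "smooth_on (cmap d ` (W \<inter> cdom d)) (\<lambda>y. f (cinv d y))"
proof (rule smooth_on_cong)
  show o: "open (cmap d ` (W \<inter> cdom d))" by (rule open_chart_image[OF d W(1)])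
  show "smooth_on (cmap d ` (W \<inter> cdom d)) (\<lambda>y. (\<lambda>x. f (cinv c x)) ((cmap c \<circ> cinv d) y))"
  proof (rule smooth_on_comp[OF o open_chart_image'[OF c W] _ f])
    show "(cmap c \<circ> cinv d) ` cmap d ` (W \<inter> cdom d) \<subseteq> cmap c ` W" using cinv_cmap[OF d] by auto
    show "smooth_on (cmap d ` (W \<inter> cdom d)) (cmap c \<circ> cinv d)"
      by (rule smooth_on_subset[OF _ transition_smooth[OF d c]]) (use W in auto)
  qed
  show "f (cinv c ((cmap c \<circ> cinv d) y)) = f (cinv d y)" if "y \<in> cmap d ` (W \<inter> cdom d)" for y
    using that W cinv_cmap[OF c] cinv_cmap[OF d] by auto
qed

lemma smooth_funI:
  assumes "c \<in> A" "open W" "W \<subseteq> cdom c" "smooth_on (cmap c ` W) (\<lambda>x. f (cinv c x))"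
  shows "smooth_fun A W f"
  unfolding smooth_fun_def using change_chart_smooth[OF assms(1) _ assms(2-4)] by (simp add: comp_def)

lemma smooth_funD:
  "smooth_fun A W f \<Longrightarrow> c \<in> A \<Longrightarrow> W \<subseteq> cdom c \<Longrightarrow> smooth_on (cmap c ` W) (\<lambda>x. f (cinv c x))"
  unfolding smooth_fun_def comp_def by (metis Int_absorb2)

text \<open>One chart is enough: components in any other chart arise by applying the smooth
  derivative of the coordinate change to the given ones.\<close>

lemma smooth_vfieldI:
  assumes c: "c \<in> A" and W: "open W" "W \<subseteq> cdom c" and T: "\<And>p. p \<in> W \<Longrightarrow> X p \<in> tangent_space A p"
    and X: "smooth_on (cmap c ` W) (\<lambda>x. X (cinv c x) c)"
  shows "smooth_vfield A W X"
  unfolding smooth_vfield_def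
proof (intro conjI ballI)
  show "X p \<in> tangent_space A p" if "p \<in> W" for p by (rule T[OF that])
  fix d assume d: "d \<in> A"
  define W' where "W' = W \<inter> cdom d"
  have W': "open W'" "W' \<subseteq> cdom c" "W' \<subseteq> cdom d" using W open_cdom[OF d] by (auto simp: W'_def)
  have o: "open (cmap c ` W')" by (rule open_chart_image'[OF c W'(1,2)])
  have "smooth_on (cmap c ` W') (\<lambda>x. frechet_derivative (cmap d \<circ> cinv c) (at x) (X (cinv c x) c))"
    by (rule smooth_on_frechet_derivative_family[OF o smooth_on_subset[OF _ transition_smooth[OF c d]]
          smooth_on_subset[OF _ X]]) (use W' in \<open>auto simp: W'_def\<close>)
  then have "smooth_on (cmap c ` W') (\<lambda>x. X (cinv c x) d)"
  proof (rule smooth_on_cong[OF o, rotated])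
    fix x assume "x \<in> cmap c ` W'"
    then obtain p where p: "p \<in> W'" "x = cmap c p" by blast
    then have pc: "p \<in> cdom c" "p \<in> cdom d" using W' by auto
    have "X p d = Dtrans c d p (X p c)"
      by (rule tangent_component[OF T c d pc]) (use p in \<open>auto simp: W'_def\<close>)
    then show "frechet_derivative (cmap d \<circ> cinv c) (at x) (X (cinv c x) c) = X (cinv c x) d"
      by (simp add: p cinv_cmap[OF c pc(1)] Dtrans_def)
  qed
  from change_chart_smooth[OF c d W'(1,2) this]
  show "smooth_on (cmap d ` (W \<inter> cdom d)) (\<lambda>x. X (cinv d x) d)" by (simp add: W'_def)
qed

lemma smooth_vfieldD:
  assumes "smooth_vfield A W X"
  shows "p \<in> W \<Longrightarrow> X p \<in> tangent_space A p"
    "c \<in> A \<Longrightarrow> W \<subseteq> cdom c \<Longrightarrow> smooth_on (cmap c ` W) (\<lambda>x. X (cinv c x) c)"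
  using assms unfolding smooth_vfield_def by (auto simp: Int_absorb2)

lemma smooth_vfield_coord:
  assumes c: "c \<in> A" and W: "open W" "W \<subseteq> cdom c"
  shows "smooth_vfield A W (\<lambda>q. coord_vec A c q u)"
proof (rule smooth_vfieldI[OF c W])
  show "coord_vec A c p u \<in> tangent_space A p" if "p \<in> W" for p
    using coord_vec_tangent[OF c] that W by auto
  show "smooth_on (cmap c ` W) (\<lambda>x. coord_vec A c (cinv c x) u c)"
  proof (rule smooth_on_cong[OF open_chart_image'[OF c W] _ smooth_on_const[OF open_chart_image'[OF c W]]])
    show "u = coord_vec A c (cinv c x) u c" if "x \<in> cmap c ` W" for x
      using that W coord_vec_component[OF c] cinv_cmap[OF c] by auto
  qed
qed

lemma smooth_vfield_cong:
  assumes W: "open W" and X: "smooth_vfield A W X" and eq: "\<And>p. p \<in> W \<Longrightarrow> Y p = X p"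
  shows "smooth_vfield A W Y"
  unfolding smooth_vfield_def
proof (intro conjI ballI)
  show "Y p \<in> tangent_space A p" if "p \<in> W" for p using smooth_vfieldD(1)[OF X that] eq[OF that] by simp
  fix c assume c: "c \<in> A"
  show "smooth_on (cmap c ` (W \<inter> cdom c)) (\<lambda>x. Y (cinv c x) c)"
    by (rule smooth_on_cong[OF open_chart_image[OF c W], of "\<lambda>x. X (cinv c x) c"])
      (use X c eq cinv_cmap[OF c] in \<open>auto simp: smooth_vfield_def\<close>)
qed

lemma smooth_vfield_add:
  assumes W: "open W" and X: "smooth_vfield A W X" and Y: "smooth_vfield A W Y"
  shows "smooth_vfield A W (\<lambda>q. tadd (X q) (Y q))"
  unfolding smooth_vfield_def
proof (intro conjI ballI)
  show "tadd (X p) (Y p) \<in> tangent_space A p" if "p \<in> W" for p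
    by (intro tangent_add smooth_vfieldD(1)[OF X that] smooth_vfieldD(1)[OF Y that])
  fix c assume c: "c \<in> A"
  show "smooth_on (cmap c ` (W \<inter> cdom c)) (\<lambda>x. X (cinv c x) c + Y (cinv c x) c)"
    by (rule smooth_on_add[OF open_chart_image[OF c W]]) (use X Y c in \<open>auto simp: smooth_vfield_def\<close>)
qed

lemma smooth_vfield_scale:
  assumes W: "open W" and X: "smooth_vfield A W X" and f: "smooth_fun A W f"
  shows "smooth_vfield A W (\<lambda>q. tscale (f q) (X q))"
  unfolding smooth_vfield_def
proof (intro conjI ballI)
  show "tscale (f p) (X p) \<in> tangent_space A p" if "p \<in> W" for p
    by (intro tangent_scale smooth_vfieldD(1)[OF X that])
  fix c assume c: "c \<in> A"
  show "smooth_on (cmap c ` (W \<inter> cdom c)) (\<lambda>x. f (cinv c x) *\<^sub>R X (cinv c x) c)"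
    by (rule smooth_on_scaleR[OF open_chart_image[OF c W]])
      (use X f c in \<open>auto simp: smooth_vfield_def smooth_fun_def comp_def\<close>)
qed

lemma smooth_fun_const: "open W \<Longrightarrow> smooth_fun A W (\<lambda>q. a)"
  unfolding smooth_fun_def comp_def by (intro ballI smooth_on_const open_chart_image)

lemma smooth_vfield_diff:
  assumes W: "open W" and X: "smooth_vfield A W X" and Y: "smooth_vfield A W Y"
  shows "smooth_vfield A W (\<lambda>q. tdiff (X q) (Y q))"
  using smooth_vfield_add[OF W X smooth_vfield_scale[OF W Y smooth_fun_const[OF W, of "-1"]]] by simp

lemma smooth_vfield_zero:
  assumes "open W" "smooth_vfield A W X"
  shows "smooth_vfield A W (\<lambda>q. tzero)"
  using smooth_vfield_scale[OF assms smooth_fun_const[OF assms(1), of 0]] by simp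

lemma smooth_vfield_sum:
  assumes W: "open W" and X: "smooth_vfield A W X" and "finite I"
    and f: "\<And>i. i \<in> I \<Longrightarrow> smooth_fun A W (f i)" and Z: "\<And>i. i \<in> I \<Longrightarrow> smooth_vfield A W (Z i)"
  shows "smooth_vfield A W (\<lambda>q d. \<Sum>i\<in>I. f i q *\<^sub>R Z i q d)"
  using \<open>finite I\<close> f Z
proof (induction I)
  case empty
  show ?case using smooth_vfield_zero[OF W X] by simp
next
  case (insert i I)
  show ?case
    using smooth_vfield_add[OF W smooth_vfield_scale[OF W insert.prems(2)[of i] insert.prems(1)[of i]] insert.IH]
      insert.hyps insert.prems by simp
qed

lemma smooth_component:
  assumes c: "c \<in> A" and W: "open W" "W \<subseteq> cdom c" and X: "smooth_vfield A W X"
  shows "smooth_fun A W (\<lambda>q. X q c \<bullet> i)"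
  by (rule smooth_funI[OF c W])
    (rule smooth_on_bounded_linear_comp[OF bounded_linear_inner_left open_chart_image'[OF c W] smooth_vfieldD(2)[OF X c W(2)]])

lemma vfield_expand:
  assumes c: "c \<in> A" "q \<in> cdom c" and X: "v \<in> tangent_space A q"
  shows "v = (\<lambda>d. \<Sum>i\<in>Basis. (v c \<bullet> i) *\<^sub>R coord_vec A c q i d)"
proof
  fix d
  have lin: "linear (\<lambda>u. coord_vec A c q u d)"
    by (intro linearI) (simp_all add: coord_vec_add[OF c] coord_vec_scale[OF c])
  have "v d = coord_vec A c q (v c) d" using tangent_eq_coord_vec[OF X c] by metis
  also have "\<dots> = (\<Sum>i\<in>Basis. (v c \<bullet> i) *\<^sub>R coord_vec A c q i d)" by (rule linear_family_expand[OF lin])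
  finally show "v d = (\<Sum>i\<in>Basis. (v c \<bullet> i) *\<^sub>R coord_vec A c q i d)" .
qed

end

section \<open>Connections in a chart\<close>

locale connection = manifold A for A :: "('m::{t2_space, second_countable_topology}, 'n::finite) chart set" +
  fixes N :: "('m, 'n) connection"
  assumes conn: "affine_connection A N" and torsion_free: "torsion_free A N"
begin

context
  fixes W X Y assumes W: "open W" and X: "smooth_vfield A W X" and Y: "smooth_vfield A W Y"
begin

lemma N_smooth: "smooth_vfield A W (N X Y)"
  and N_cong: "smooth_vfield A W X' \<Longrightarrow> smooth_vfield A W Y' \<Longrightarrow> (\<And>p. p \<in> W \<Longrightarrow> X' p = X p) \<Longrightarrow>
    (\<And>p. p \<in> W \<Longrightarrow> Y' p = Y p) \<Longrightarrow> p \<in> W \<Longrightarrow> N X' Y' p = N X Y p"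
  and N_add1: "smooth_vfield A W X' \<Longrightarrow> p \<in> W \<Longrightarrow> N (\<lambda>q. tadd (X q) (X' q)) Y p = tadd (N X Y p) (N X' Y p)"
  and N_add2: "smooth_vfield A W Y' \<Longrightarrow> p \<in> W \<Longrightarrow> N X (\<lambda>q. tadd (Y q) (Y' q)) p = tadd (N X Y p) (N X Y' p)"
  and N_scale1: "smooth_fun A W f \<Longrightarrow> p \<in> W \<Longrightarrow> N (\<lambda>q. tscale (f q) (X q)) Y p = tscale (f p) (N X Y p)"
  and N_scale2: "smooth_fun A W f \<Longrightarrow> p \<in> W \<Longrightarrow> N X (\<lambda>q. tscale (f q) (Y q)) p =
    tadd (tscale (dir_deriv A p (X p) f) (Y p)) (tscale (f p) (N X Y p))"
proof -
  note * = conn[unfolded affine_connection_def, rule_format, OF conjI[OF W conjI[OF X Y]]]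
  show "smooth_vfield A W (N X Y)" using * by blast
  show "N X' Y' p = N X Y p" if "smooth_vfield A W X'" "smooth_vfield A W Y'"
    "\<And>p. p \<in> W \<Longrightarrow> X' p = X p" "\<And>p. p \<in> W \<Longrightarrow> Y' p = Y p" "p \<in> W" using * that by blast
  show "N (\<lambda>q. tadd (X q) (X' q)) Y p = tadd (N X Y p) (N X' Y p)" if "smooth_vfield A W X'" "p \<in> W"
    using * that by blast
  show "N X (\<lambda>q. tadd (Y q) (Y' q)) p = tadd (N X Y p) (N X Y' p)" if "smooth_vfield A W Y'" "p \<in> W"
    using * that by blast
  show "N (\<lambda>q. tscale (f q) (X q)) Y p = tscale (f p) (N X Y p)" if "smooth_fun A W f" "p \<in> W"
    using * that by blast
  show "N X (\<lambda>q. tscale (f q) (Y q)) p =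
    tadd (tscale (dir_deriv A p (X p) f) (Y p)) (tscale (f p) (N X Y p))" if "smooth_fun A W f" "p \<in> W"
    using * that by blast
qed

end

lemma N_zero1:
  assumes W: "open W" and Y: "smooth_vfield A W Y" and p: "p \<in> W"
  shows "N (\<lambda>q. tzero) Y p = tzero"
  using N_scale1[OF W Y Y smooth_fun_const[OF W, of 0] p] by simp

lemma N_zero2:
  assumes W: "open W" and X: "smooth_vfield A W X" and c: "c \<in> A" and p: "p \<in> W" "p \<in> cdom c"
  shows "N X (\<lambda>q. tzero) p = tzero"
proof -
  have "dir_deriv A p (X p) (\<lambda>q. 0) = 0"
    by (rule dir_deriv_eq[OF c p(2) smooth_vfieldD(1)[OF X p(1)], where f' = "\<lambda>_. 0"]) simp
  then show ?thesis using N_scale2[OF W X X smooth_fun_const[OF W, of 0] p(1)] by simp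
qed

lemma N_sum1:
  assumes W: "open W" and Y: "smooth_vfield A W Y" and "finite I" and p: "p \<in> W"
    and f: "\<And>i. i \<in> I \<Longrightarrow> smooth_fun A W (f i)" and Z: "\<And>i. i \<in> I \<Longrightarrow> smooth_vfield A W (Z i)"
  shows "N (\<lambda>q d. \<Sum>i\<in>I. f i q *\<^sub>R Z i q d) Y p = (\<lambda>d. \<Sum>i\<in>I. f i p *\<^sub>R N (Z i) Y p d)"
  using \<open>finite I\<close> f Z
proof (induction I)
  case empty
  show ?case using N_zero1[OF W Y p] by simp
next
  case (insert i I)
  have 1: "smooth_vfield A W (\<lambda>q. tscale (f i q) (Z i q))" by (intro smooth_vfield_scale W insert.prems) auto
  have 2: "smooth_vfield A W (\<lambda>q d. \<Sum>i\<in>I. f i q *\<^sub>R Z i q d)"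
    by (rule smooth_vfield_sum[OF W Y insert.hyps(1)]) (auto intro: insert.prems)
  have "N (\<lambda>q. tadd (tscale (f i q) (Z i q)) (\<lambda>d. \<Sum>i\<in>I. f i q *\<^sub>R Z i q d)) Y p
      = tadd (N (\<lambda>q. tscale (f i q) (Z i q)) Y p) (N (\<lambda>q d. \<Sum>i\<in>I. f i q *\<^sub>R Z i q d) Y p)"
    by (rule N_add1[OF W 1 Y 2 p])
  also have "N (\<lambda>q. tscale (f i q) (Z i q)) Y p = tscale (f i p) (N (Z i) Y p)"
    by (rule N_scale1[OF W _ Y _ p]) (auto intro: insert.prems)
  also have "N (\<lambda>q d. \<Sum>i\<in>I. f i q *\<^sub>R Z i q d) Y p = (\<lambda>d. \<Sum>i\<in>I. f i p *\<^sub>R N (Z i) Y p d)"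
    by (rule insert.IH) (auto intro: insert.prems)
  finally show ?case using insert.hyps by simp
qed

lemma N_sum2:
  assumes W: "open W" and X: "smooth_vfield A W X" and "finite I" and c: "c \<in> A" and p: "p \<in> W" "p \<in> cdom c"
    and f: "\<And>i. i \<in> I \<Longrightarrow> smooth_fun A W (f i)" and Z: "\<And>i. i \<in> I \<Longrightarrow> smooth_vfield A W (Z i)"
  shows "N X (\<lambda>q d. \<Sum>i\<in>I. f i q *\<^sub>R Z i q d) p =
    (\<lambda>d. \<Sum>i\<in>I. dir_deriv A p (X p) (f i) *\<^sub>R Z i p d + f i p *\<^sub>R N X (Z i) p d)"
  using \<open>finite I\<close> f Z
proof (induction I)
  case empty
  show ?case using N_zero2[OF W X c p] by simp
next
  case (insert i I)
  have 1: "smooth_vfield A W (\<lambda>q. tscale (f i q) (Z i q))" by (intro smooth_vfield_scale W insert.prems) auto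
  have 2: "smooth_vfield A W (\<lambda>q d. \<Sum>i\<in>I. f i q *\<^sub>R Z i q d)"
    by (rule smooth_vfield_sum[OF W X insert.hyps(1)]) (auto intro: insert.prems)
  have "N X (\<lambda>q. tadd (tscale (f i q) (Z i q)) (\<lambda>d. \<Sum>i\<in>I. f i q *\<^sub>R Z i q d)) p
      = tadd (N X (\<lambda>q. tscale (f i q) (Z i q)) p) (N X (\<lambda>q d. \<Sum>i\<in>I. f i q *\<^sub>R Z i q d) p)"
    by (rule N_add2[OF W X 1 2 p(1)])
  also have "N X (\<lambda>q. tscale (f i q) (Z i q)) p
      = tadd (tscale (dir_deriv A p (X p) (f i)) (Z i p)) (tscale (f i p) (N X (Z i) p))"
    by (rule N_scale2[OF W X _ _ p(1)]) (auto intro: insert.prems)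
  also have "N X (\<lambda>q d. \<Sum>i\<in>I. f i q *\<^sub>R Z i q d) p
      = (\<lambda>d. \<Sum>i\<in>I. dir_deriv A p (X p) (f i) *\<^sub>R Z i p d + f i p *\<^sub>R N X (Z i) p d)"
    by (rule insert.IH) (auto intro: insert.prems)
  finally show ?case using insert.hyps by (simp add: add.assoc)
qed

lemma christoffel_bilinear:
  assumes c: "c \<in> A" and p: "p \<in> cdom c"
  shows "bilinear (christoffel A N c p)"
proof -
  let ?W = "cdom c"
  note W = open_cdom[OF c]
  note S = smooth_vfield_coord[OF c W order_refl]
  have add: "smooth_vfield A ?W (\<lambda>q. tadd (coord_vec A c q u) (coord_vec A c q v))" for u v
    by (intro smooth_vfield_add W S)
  have scale: "smooth_vfield A ?W (\<lambda>q. tscale a (coord_vec A c q v))" for a v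
    by (rule smooth_vfield_scale[OF W S smooth_fun_const[OF W]])
  have dd: "dir_deriv A p (coord_vec A c p u) (\<lambda>q. a) = 0" for u a
    by (rule dir_deriv_eq[OF c p coord_vec_tangent[OF c p], where f' = "\<lambda>_. 0"]) simp
  have 1: "christoffel A N c p (u + v) w = christoffel A N c p u w + christoffel A N c p v w" for u v w
  proof -
    have "N (\<lambda>q. coord_vec A c q (u + v)) (\<lambda>q. coord_vec A c q w) p
        = N (\<lambda>q. tadd (coord_vec A c q u) (coord_vec A c q v)) (\<lambda>q. coord_vec A c q w) p"
      by (rule N_cong[OF W add S S S _ refl p]) (rule coord_vec_add[OF c])
    then show ?thesis unfolding christoffel_def by (simp add: N_add1[OF W S S S p])
  qed
  have 2: "christoffel A N c p (a *\<^sub>R u) w = a *\<^sub>R christoffel A N c p u w" for a u w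
  proof -
    have "N (\<lambda>q. coord_vec A c q (a *\<^sub>R u)) (\<lambda>q. coord_vec A c q w) p
        = N (\<lambda>q. tscale a (coord_vec A c q u)) (\<lambda>q. coord_vec A c q w) p"
      by (rule N_cong[OF W scale S S S _ refl p]) (rule coord_vec_scale[OF c])
    then show ?thesis unfolding christoffel_def by (simp add: N_scale1[OF W S S smooth_fun_const[OF W] p])
  qed
  have 3: "christoffel A N c p w (u + v) = christoffel A N c p w u + christoffel A N c p w v" for u v w
  proof -
    have "N (\<lambda>q. coord_vec A c q w) (\<lambda>q. coord_vec A c q (u + v)) p
        = N (\<lambda>q. coord_vec A c q w) (\<lambda>q. tadd (coord_vec A c q u) (coord_vec A c q v)) p"
      by (rule N_cong[OF W S add S S refl _ p]) (rule coord_vec_add[OF c])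
    then show ?thesis unfolding christoffel_def by (simp add: N_add2[OF W S S S p])
  qed
  have 4: "christoffel A N c p w (a *\<^sub>R u) = a *\<^sub>R christoffel A N c p w u" for a u w
  proof -
    have "N (\<lambda>q. coord_vec A c q w) (\<lambda>q. coord_vec A c q (a *\<^sub>R u)) p
        = N (\<lambda>q. coord_vec A c q w) (\<lambda>q. tscale a (coord_vec A c q u)) p"
      by (rule N_cong[OF W S scale S S refl _ p]) (rule coord_vec_scale[OF c])
    then show ?thesis unfolding christoffel_def by (simp add: N_scale2[OF W S S smooth_fun_const[OF W] p] dd)
  qed
  show ?thesis unfolding bilinear_def by (intro conjI allI linearI 1 2 3 4)
qed

text \<open>Both fields are expanded in the coordinate frame of \<open>c\<close>; linearity over
  functions in \<open>X\<close> and the Leibniz rule in \<open>Y\<close> do the rest. The expansion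
  is made on all of \<open>W\<close> because the axioms speak of smooth fields on open sets, not of
  vectors at a point.\<close>

lemma N_component:
  assumes c: "c \<in> A" and W: "open W" "W \<subseteq> cdom c" and X: "smooth_vfield A W X" and Y: "smooth_vfield A W Y"
    and p: "p \<in> W"
  shows "N X Y p c = frechet_derivative (\<lambda>x. Y (cinv c x) c) (at (cmap c p)) (X p c)
    + christoffel A N c p (X p c) (Y p c)"
proof -
  note pc = subsetD[OF W(2) p]
  note S = smooth_vfield_coord[OF c W]
  note B = christoffel_bilinear[OF c pc]
  have ex: "Z q = (\<lambda>d. \<Sum>i\<in>Basis. (Z q c \<bullet> i) *\<^sub>R coord_vec A c q i d)"
    if "smooth_vfield A W Z" "q \<in> W" for Z q
    by (rule vfield_expand[OF c subsetD[OF W(2) that(2)] smooth_vfieldD(1)[OF that]])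
  have sm: "smooth_vfield A W (\<lambda>q d. \<Sum>i\<in>Basis. (Z q c \<bullet> i) *\<^sub>R coord_vec A c q i d)"
    if "smooth_vfield A W Z" for Z
    by (intro smooth_vfield_sum[OF W(1) that] finite_Basis smooth_component[OF c W that] S)
  have first: "N X (\<lambda>q. coord_vec A c q j) p c = christoffel A N c p (X p c) j" for j
  proof -
    have "N X (\<lambda>q. coord_vec A c q j) p
        = N (\<lambda>q d. \<Sum>i\<in>Basis. (X q c \<bullet> i) *\<^sub>R coord_vec A c q i d) (\<lambda>q. coord_vec A c q j) p"
      by (rule N_cong[OF W(1) sm[OF X] S X S ex[OF X] refl p])
    also have "\<dots> = (\<lambda>d. \<Sum>i\<in>Basis. (X p c \<bullet> i) *\<^sub>R N (\<lambda>q. coord_vec A c q i) (\<lambda>q. coord_vec A c q j) p d)"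
      by (rule N_sum1[OF W(1) S finite_Basis p smooth_component[OF c W X] S])
    finally show ?thesis
      unfolding linear_family_expand[OF bilinear_linear1[OF B], of "X p c" j] by (simp add: christoffel_def)
  qed
  have Yd: "((\<lambda>x. Y (cinv c x) c) has_derivative frechet_derivative (\<lambda>x. Y (cinv c x) c) (at (cmap c p))) (at (cmap c p))"
    by (rule smooth_on_has_derivative[OF smooth_vfieldD(2)[OF Y c W(2)]]) (use p in auto)
  have dd: "dir_deriv A p (X p) (\<lambda>q. Y q c \<bullet> i)
      = frechet_derivative (\<lambda>x. Y (cinv c x) c) (at (cmap c p)) (X p c) \<bullet> i" for i
    by (rule dir_deriv_eq[OF c pc smooth_vfieldD(1)[OF X p]]) (rule has_derivative_inner_left[OF Yd])
  have "N X Y p = N X (\<lambda>q d. \<Sum>i\<in>Basis. (Y q c \<bullet> i) *\<^sub>R coord_vec A c q i d) p"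
    by (rule N_cong[OF W(1) X sm[OF Y] X Y refl ex[OF Y] p])
  also have "\<dots> = (\<lambda>d. \<Sum>i\<in>Basis. dir_deriv A p (X p) (\<lambda>q. Y q c \<bullet> i) *\<^sub>R coord_vec A c p i d
      + (Y p c \<bullet> i) *\<^sub>R N X (\<lambda>q. coord_vec A c q i) p d)"
    by (rule N_sum2[OF W(1) X finite_Basis c p pc smooth_component[OF c W Y] S])
  finally have "N X Y p c = (\<Sum>i\<in>Basis. (frechet_derivative (\<lambda>x. Y (cinv c x) c) (at (cmap c p)) (X p c) \<bullet> i) *\<^sub>R i)
      + (\<Sum>i\<in>Basis. (Y p c \<bullet> i) *\<^sub>R christoffel A N c p (X p c) i)"
    by (simp add: dd first coord_vec_component[OF c pc] sum.distrib)
  then show ?thesis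
    unfolding linear_family_expand[OF bilinear_linear2[OF B], of "X p c" "Y p c"]
    by (simp add: euclidean_representation)
qed

definition \<Gamma> :: "('m, 'n) chart \<Rightarrow> real ^ 'n \<Rightarrow> real ^ 'n \<Rightarrow> real ^ 'n \<Rightarrow> real ^ 'n" where
  "\<Gamma> c x = christoffel A N c (cinv c x)"

definition d\<Gamma> :: "('m, 'n) chart \<Rightarrow> real ^ 'n \<Rightarrow> real ^ 'n \<Rightarrow> real ^ 'n \<Rightarrow> real ^ 'n \<Rightarrow> real ^ 'n" where
  "d\<Gamma> c x a b = frechet_derivative (\<lambda>y. \<Gamma> c y a b) (at x)"

lemma \<Gamma>_cmap: "c \<in> A \<Longrightarrow> p \<in> cdom c \<Longrightarrow> \<Gamma> c (cmap c p) = christoffel A N c p"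
  by (simp add: \<Gamma>_def cinv_cmap)

lemma smooth_\<Gamma>: assumes c: "c \<in> A" shows "smooth_on (cmap c ` cdom c) (\<lambda>x. \<Gamma> c x a b)"
  unfolding \<Gamma>_def christoffel_def
  by (rule smooth_vfieldD(2)[OF N_smooth c order_refl])
    (intro open_cdom smooth_vfield_coord c order_refl)+

lemma lie_bracket_component:
  assumes "c \<in> A" "p \<in> cdom c"
  shows "lie_bracket A X Y p c = frechet_derivative (\<lambda>x. Y (cinv c x) c) (at (cmap c p)) (X p c)
    - frechet_derivative (\<lambda>x. X (cinv c x) c) (at (cmap c p)) (Y p c)"
  using assms by (simp add: lie_bracket_def)

lemma lie_bracket_eq:
  assumes "open W" "smooth_vfield A W X" "smooth_vfield A W Y" "p \<in> W"
  shows "lie_bracket A X Y p = tdiff (N X Y p) (N Y X p)"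
  using torsion_free assms unfolding torsion_free_def by metis

lemma smooth_lie_bracket:
  assumes "open W" "smooth_vfield A W X" "smooth_vfield A W Y"
  shows "smooth_vfield A W (lie_bracket A X Y)"
  by (rule smooth_vfield_cong[OF assms(1) smooth_vfield_diff[OF assms(1) N_smooth[OF assms(1,2,3)] N_smooth[OF assms(1,3,2)]]])
    (rule lie_bracket_eq[OF assms])

lemma affine_chart: assumes c: "c \<in> A" shows "affine_chart (cmap c ` cdom c) (\<Gamma> c) (d\<Gamma> c)"
proof
  show "open (cmap c ` cdom c)" by (rule open_image[OF c])
  fix x assume x: "x \<in> cmap c ` cdom c"
  let ?p = "cinv c x"
  have p: "?p \<in> cdom c" by (rule cinv_in[OF c x])
  show "bilinear (\<Gamma> c x)" unfolding \<Gamma>_def by (rule christoffel_bilinear[OF c p])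
  fix a b
  show "((\<lambda>y. \<Gamma> c y a b) has_derivative d\<Gamma> c x a b) (at x)"
    unfolding d\<Gamma>_def by (rule smooth_on_has_derivative[OF smooth_\<Gamma>[OF c] x])
  \<comment> \<open>Coordinate fields have constant components, so their bracket vanishes and
    freedom from torsion becomes the symmetry of \<Gamma>.\<close>
  have const: "frechet_derivative (\<lambda>x. coord_vec A c (cinv c x) u c) (at x) v = 0" for u v
  proof -
    have "((\<lambda>x. coord_vec A c (cinv c x) u c) has_derivative (\<lambda>_. 0)) (at x)"
      by (rule has_derivative_transform_within_open[OF has_derivative_const open_image[OF c] x])
        (simp add: coord_vec_component[OF c cinv_in[OF c]])
    then show ?thesis by (simp add: frechet_derivative_at[symmetric])
  qed
  have "lie_bracket A (\<lambda>q. coord_vec A c q a) (\<lambda>q. coord_vec A c q b) ?p c = 0"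
    using const by (simp add: lie_bracket_component[OF c p] cmap_cinv[OF c x])
  moreover have "lie_bracket A (\<lambda>q. coord_vec A c q a) (\<lambda>q. coord_vec A c q b) ?p
      = tdiff (N (\<lambda>q. coord_vec A c q a) (\<lambda>q. coord_vec A c q b) ?p) (N (\<lambda>q. coord_vec A c q b) (\<lambda>q. coord_vec A c q a) ?p)"
    by (rule lie_bracket_eq[OF open_cdom[OF c] smooth_vfield_coord smooth_vfield_coord p])
      (auto intro: c open_cdom)
  ultimately show "\<Gamma> c x a b = \<Gamma> c x b a" by (simp add: \<Gamma>_def christoffel_def)
next
  fix a b w
  show "continuous_on (cmap c ` cdom c) (\<lambda>y. d\<Gamma> c y a b w)"
    unfolding d\<Gamma>_def by (intro smooth_on_imp_continuous_on smooth_on_frechet_derivative smooth_\<Gamma> c)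
qed

end

context connection begin

lemma N_tangent:
  assumes "open W" "smooth_vfield A W X" "smooth_vfield A W Y" "p \<in> W" "c \<in> A" "p \<in> cdom c"
  shows "N X Y p = coord_vec A c p (N X Y p c)"
  by (rule tangent_eq_coord_vec[OF smooth_vfieldD(1)[OF N_smooth[OF assms(1-3)] assms(4)] assms(5,6)])

text \<open>One covariant derivative computed twice: for the coordinate fields of \<open>c\<close>,
  the components in \<open>d\<close> follow from those in \<open>c\<close> because the result is a
  tangent vector, and directly from \<open>N_component\<close> in \<open>d\<close>, where these
  fields need not be constant; this is the source of the second derivative.\<close>

lemma christoffel_transform:
  assumes c: "c \<in> A" "p \<in> cdom c" and d: "d \<in> A" "p \<in> cdom d"
  shows "christoffel A N d p (Dtrans c d p a) (Dtrans c d p b) =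
    Dtrans c d p (christoffel A N c p a b)
      - frechet_derivative (\<lambda>y. frechet_derivative (cmap d \<circ> cinv c) (at y) b) (at (cmap c p)) a"
proof -
  let ?W = "cdom c \<inter> cdom d" and ?X = "\<lambda>q. coord_vec A c q a" and ?Y = "\<lambda>q. coord_vec A c q b"
  let ?\<tau> = "cmap d \<circ> cinv c"
  let ?B = "frechet_derivative (\<lambda>y. frechet_derivative ?\<tau> (at y) b) (at (cmap c p))"
  have W: "open ?W" "?W \<subseteq> cdom c" "?W \<subseteq> cdom d" and p: "p \<in> ?W" using c d by (auto intro: open_cdom)
  note X = smooth_vfield_coord[OF c(1) W(1,2), of a] and Y = smooth_vfield_coord[OF c(1) W(1,2), of b]
  have comp: "coord_vec A c p u d = Dtrans c d p u" for u using c d by (simp add: coord_vec_eq)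
  have x: "cmap c p \<in> cmap c ` ?W" using p by blast
  have "((\<lambda>y. frechet_derivative ?\<tau> (at y) b) has_derivative ?B) (at (cmap c p))"
    by (rule smooth_on_has_derivative[OF smooth_on_frechet_derivative[OF transition_smooth[OF c(1) d(1)]] x])
  then have "((\<lambda>y. frechet_derivative ?\<tau> (at (cmap c (cinv c y))) b) has_derivative ?B) (at (cmap c p))"
    by (rule has_derivative_transform_within_open[OF _ open_chart_image'[OF c(1) W(1,2)] x])
      (auto simp: cinv_cmap[OF c(1)])
  from derivative_change_chart[where f = "\<lambda>q. frechet_derivative ?\<tau> (at (cmap c q)) b", OF d c this]
  have "((\<lambda>x. frechet_derivative ?\<tau> (at (cmap c (cinv d x))) b) has_derivative
      (\<lambda>u. ?B (Dtrans d c p u))) (at (cmap d p))" .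
  then have "((\<lambda>x. coord_vec A c (cinv d x) b d) has_derivative (\<lambda>u. ?B (Dtrans d c p u))) (at (cmap d p))"
    by (rule has_derivative_transform_within_open[OF _ open_chart_image'[OF d(1) W(1,3)]])
      (use p in \<open>auto simp: cinv_cmap[OF d(1)] coord_vec_eq Dtrans_def d(1)\<close>)
  then have "frechet_derivative (\<lambda>x. coord_vec A c (cinv d x) b d) (at (cmap d p)) = (\<lambda>u. ?B (Dtrans d c p u))"
    by (simp add: frechet_derivative_at[symmetric])
  moreover have "Dtrans d c p (Dtrans c d p a) = a"
    by (simp add: Dtrans_trans c d Dtrans_id)
  moreover have "N ?X ?Y p d = Dtrans c d p (christoffel A N c p a b)"
    unfolding christoffel_def
    by (rule tangent_component[OF smooth_vfieldD(1)[OF N_smooth[OF W(1) X Y] p] c(1) d(1) c(2) d(2)])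
  ultimately show ?thesis
    using N_component[OF d(1) W(1,3) X Y p] by (simp add: comp eq_diff_eq add.commute)
qed

section \<open>Curvature in a chart\<close>

text \<open>Second derivatives of \<open>Z\<close> cancel by their symmetry.\<close>

lemma curvature_component:
  assumes c: "c \<in> A" and W: "open W" "W \<subseteq> cdom c" and X: "smooth_vfield A W X"
    and Y: "smooth_vfield A W Y" and Z: "smooth_vfield A W Z" and p: "p \<in> W"
  shows "curvature A N X Y Z p c = affine_chart.R (\<Gamma> c) (d\<Gamma> c) (cmap c p) (X p c) (Y p c) (Z p c)"
proof -
  interpret C: affine_chart "cmap c ` cdom c" "\<Gamma> c" "d\<Gamma> c" by (rule affine_chart[OF c])
  let ?S = "cmap c ` W" and ?x = "cmap c p"
  have pc: "p \<in> cdom c" using p W by auto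
  have S: "open ?S" "?x \<in> ?S" "?x \<in> cmap c ` cdom c" using open_chart_image'[OF c W] p pc by auto
  have NN: "N X (N Y Z) p c = 
      frechet_derivative (\<lambda>y. frechet_derivative (\<lambda>x. Z (cinv c x) c) (at y) (Y p c)) (at ?x) (X p c)
      + frechet_derivative (\<lambda>x. Z (cinv c x) c) (at ?x) (frechet_derivative (\<lambda>x. Y (cinv c x) c) (at ?x) (X p c))
      + d\<Gamma> c ?x (Y p c) (Z p c) (X p c)
      + \<Gamma> c ?x (frechet_derivative (\<lambda>x. Y (cinv c x) c) (at ?x) (X p c)) (Z p c)
      + \<Gamma> c ?x (Y p c) (frechet_derivative (\<lambda>x. Z (cinv c x) c) (at ?x) (X p c))
      + \<Gamma> c ?x (X p c) (frechet_derivative (\<lambda>x. Z (cinv c x) c) (at ?x) (Y p c))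
      + \<Gamma> c ?x (X p c) (\<Gamma> c ?x (Y p c) (Z p c))"
    if X: "smooth_vfield A W X" and Y: "smooth_vfield A W Y" for X Y
  proof -
    let ?Y = "\<lambda>x. Y (cinv c x) c" and ?Z = "\<lambda>x. Z (cinv c x) c"
    note sY = smooth_vfieldD(2)[OF Y c W(2)] and sZ = smooth_vfieldD(2)[OF Z c W(2)]
    have Yd: "(?Y has_derivative frechet_derivative ?Y (at ?x)) (at ?x)"
      and Zd: "(?Z has_derivative frechet_derivative ?Z (at ?x)) (at ?x)"
      by (rule smooth_on_has_derivative[OF sY S(2)] smooth_on_has_derivative[OF sZ S(2)])+
    have Zd2: "((\<lambda>y. frechet_derivative ?Z (at y) v) has_derivative
        frechet_derivative (\<lambda>y. frechet_derivative ?Z (at y) v) (at ?x)) (at ?x)" for v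
      by (rule smooth_on_has_derivative[OF smooth_on_frechet_derivative[OF sZ] S(2)])
    have linZ: "linear (frechet_derivative ?Z (at y))" if "y \<in> ?S" for y
      by (rule has_derivative_linear[OF smooth_on_has_derivative[OF sZ that]])
    have eq: "?Y ?x = Y p c" "?Z ?x = Z p c" by (simp_all add: cinv_cmap[OF c pc])
    have "((\<lambda>y. frechet_derivative ?Z (at y) (?Y y)) has_derivative
      (\<lambda>w. frechet_derivative (\<lambda>y. frechet_derivative ?Z (at y) (?Y ?x)) (at ?x) w
        + frechet_derivative ?Z (at ?x) (frechet_derivative ?Y (at ?x) w))) (at ?x within ?S)"
    proof (rule has_derivative_linear_family[where L = "\<lambda>y. frechet_derivative ?Z (at y)"
          and L' = "\<lambda>w v. frechet_derivative (\<lambda>y. frechet_derivative ?Z (at y) v) (at ?x) w"])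
      show "linear (\<lambda>v. frechet_derivative (\<lambda>y. frechet_derivative ?Z (at y) v) (at ?x) w)" for w
        by (rule derivative_linear_in_parameter[where L = "\<lambda>y. frechet_derivative ?Z (at y)"
              and L' = "\<lambda>v. frechet_derivative (\<lambda>y. frechet_derivative ?Z (at y) v) (at ?x)", OF linZ S(1,2) Zd2])
    qed (use linZ S(2) has_derivative_at_withinI[OF Zd2] has_derivative_at_withinI[OF Yd] in \<open>blast+\<close>)
    then have 1: "((\<lambda>y. frechet_derivative ?Z (at y) (?Y y)) has_derivative
      (\<lambda>w. frechet_derivative (\<lambda>y. frechet_derivative ?Z (at y) (?Y ?x)) (at ?x) w
        + frechet_derivative ?Z (at ?x) (frechet_derivative ?Y (at ?x) w))) (at ?x)"
      by (simp only: at_within_open[OF S(2,1)])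
    have "((\<lambda>y. frechet_derivative ?Z (at y) (?Y y) + \<Gamma> c y (?Y y) (?Z y)) has_derivative
      (\<lambda>w. (frechet_derivative (\<lambda>y. frechet_derivative ?Z (at y) (?Y ?x)) (at ?x) w
        + frechet_derivative ?Z (at ?x) (frechet_derivative ?Y (at ?x) w)) +
       (d\<Gamma> c ?x (?Y ?x) (?Z ?x) w + \<Gamma> c ?x (frechet_derivative ?Y (at ?x) w) (?Z ?x)
        + \<Gamma> c ?x (?Y ?x) (frechet_derivative ?Z (at ?x) w)))) (at ?x)" (is "(_ has_derivative ?D) _")
      by (rule has_derivative_add[OF 1 C.has_derivative_\<Gamma>[OF S(3) Yd Zd]])
    then have "((\<lambda>x. N Y Z (cinv c x) c) has_derivative ?D) (at ?x)"
    proof (rule has_derivative_transform_within_open[OF _ S(1,2)])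
      fix y assume "y \<in> ?S"
      then obtain q where q: "q \<in> W" "y = cmap c q" by blast
      then have qc: "q \<in> cdom c" using W by auto
      show "frechet_derivative ?Z (at y) (?Y y) + \<Gamma> c y (?Y y) (?Z y) = N Y Z (cinv c y) c"
        using N_component[OF c W Y Z q(1)] by (simp add: q cinv_cmap[OF c qc] \<Gamma>_cmap[OF c qc])
    qed
    then have "frechet_derivative (\<lambda>x. N Y Z (cinv c x) c) (at ?x) = ?D"
      by (simp add: frechet_derivative_at[symmetric])
    then have "N X (N Y Z) p c = ?D (X p c) + \<Gamma> c ?x (X p c) (N Y Z p c)"
      using N_component[OF c W X N_smooth[OF W(1) Y Z] p] by (simp add: \<Gamma>_cmap[OF c pc])
    moreover have "N Y Z p c = frechet_derivative ?Z (at ?x) (Y p c) + \<Gamma> c ?x (Y p c) (Z p c)"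
      using N_component[OF c W Y Z p] by (simp add: \<Gamma>_cmap[OF c pc])
    ultimately show ?thesis by (simp add: eq C.\<Gamma>_simps[OF S(3)] algebra_simps)
  qed
  have lie: "N (lie_bracket A X Y) Z p c =
      frechet_derivative (\<lambda>x. Z (cinv c x) c) (at ?x) (lie_bracket A X Y p c) + \<Gamma> c ?x (lie_bracket A X Y p c) (Z p c)"
    using N_component[OF c W smooth_lie_bracket[OF W(1) X Y] Z p] by (simp add: \<Gamma>_cmap[OF c pc])
  have linZ: "linear (frechet_derivative (\<lambda>x. Z (cinv c x) c) (at ?x))"
    by (rule has_derivative_linear[OF smooth_on_has_derivative[OF smooth_vfieldD(2)[OF Z c W(2)] S(2)]])
  have sym2: "frechet_derivative (\<lambda>y. frechet_derivative (\<lambda>x. Z (cinv c x) c) (at y) (Y p c)) (at ?x) (X p c)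
      = frechet_derivative (\<lambda>y. frechet_derivative (\<lambda>x. Z (cinv c x) c) (at y) (X p c)) (at ?x) (Y p c)"
    by (rule smooth_on_second_derivative_symmetric[OF S(1) smooth_vfieldD(2)[OF Z c W(2)] S(2)])
  show ?thesis
    unfolding curvature_def NN[OF X Y] NN[OF Y X] lie lie_bracket_component[OF c pc] C.R_def
    by (simp add: linear_diff[OF linZ] C.\<Gamma>_simps[OF S(3)] sym2)
qed

lemma smooth_curvature:
  assumes W: "open W" and X: "smooth_vfield A W X" and Y: "smooth_vfield A W Y" and Z: "smooth_vfield A W Z"
  shows "smooth_vfield A W (curvature A N X Y Z)"
proof -
  have "curvature A N X Y Z = (\<lambda>p. tdiff (tdiff (N X (N Y Z) p) (N Y (N X Z) p)) (N (lie_bracket A X Y) Z p))"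
    by (rule ext) (simp add: curvature_def)
  then show ?thesis
    by (simp only:) (intro smooth_vfield_diff N_smooth smooth_lie_bracket assms)
qed

text \<open>The condition is evaluated on coordinate fields. The inner fields \<open>N V X\<close>
  need not be coordinate fields, but by \<open>curvature_component\<close> only their values at the
  point count, and those are Christoffel symbols.\<close>

lemma parallel_curvature_component:
  assumes par: "parallel_curvature A N" and c: "c \<in> A" and x: "x \<in> cmap c ` cdom c"
  defines "R \<equiv> affine_chart.R (\<Gamma> c) (d\<Gamma> c)"
  shows "((\<lambda>y. R y a b e) has_derivative (\<lambda>w. - \<Gamma> c x w (R x a b e) + R x (\<Gamma> c x w a) b e
    + R x a (\<Gamma> c x w b) e + R x a b (\<Gamma> c x w e))) (at x)"
proof -
  let ?W = "cdom c"
  note W = open_cdom[OF c]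
  let ?F = "\<lambda>u q. coord_vec A c q u"
  note F = smooth_vfield_coord[OF c W order_refl]
  define p where "p = cinv c x"
  have p: "p \<in> ?W" unfolding p_def by (rule cinv_in[OF c x])
  have px: "cmap c p = x" unfolding p_def by (rule cmap_cinv[OF c x])
  have comp: "coord_vec A c q u c = u" if "q \<in> ?W" for q u by (rule coord_vec_component[OF c that])
  have K: "curvature A N X Y Z q c = R (cmap c q) (X q c) (Y q c) (Z q c)"
    if "smooth_vfield A ?W X" "smooth_vfield A ?W Y" "smooth_vfield A ?W Z" "q \<in> ?W" for X Y Z q
    unfolding R_def by (rule curvature_component[OF c W order_refl that])
  let ?K = "curvature A N (?F a) (?F b) (?F e)"
  have Ks: "smooth_vfield A ?W ?K" by (rule smooth_curvature[OF W F F F])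
  have d0: "((\<lambda>y. ?K (cinv c y) c) has_derivative frechet_derivative (\<lambda>y. ?K (cinv c y) c) (at x)) (at x)"
    by (rule smooth_on_has_derivative[OF smooth_vfieldD(2)[OF Ks c order_refl] x])
  have "frechet_derivative (\<lambda>y. ?K (cinv c y) c) (at x) w = - \<Gamma> c x w (R x a b e) + R x (\<Gamma> c x w a) b e
    + R x a (\<Gamma> c x w b) e + R x a b (\<Gamma> c x w e)" for w
  proof -
    have Nc: "N (?F w) (?F u) p c = \<Gamma> c x w u" for u
      by (simp add: \<Gamma>_def christoffel_def p_def)
    have "N (?F w) ?K p c = frechet_derivative (\<lambda>y. ?K (cinv c y) c) (at x) w + \<Gamma> c x w (R x a b e)"
      using N_component[OF c W order_refl F Ks p, of w]
      by (simp add: px comp[OF p] K[OF F F F p] \<Gamma>_cmap[OF c p, unfolded px])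
    moreover have "cov_deriv_curvature A N (?F w) (?F a) (?F b) (?F e) p = tzero"
      using par W F p unfolding parallel_curvature_def by blast
    then have "cov_deriv_curvature A N (?F w) (?F a) (?F b) (?F e) p c = 0" by simp
    ultimately show ?thesis
      unfolding cov_deriv_curvature_def
      by (simp add: K[OF N_smooth[OF W F F] F F p] K[OF F N_smooth[OF W F F] F p]
          K[OF F F N_smooth[OF W F F] p] comp[OF p] px Nc algebra_simps)
  qed
  then have "frechet_derivative (\<lambda>y. ?K (cinv c y) c) (at x) = (\<lambda>w. - \<Gamma> c x w (R x a b e) + R x (\<Gamma> c x w a) b e
    + R x a (\<Gamma> c x w b) e + R x a b (\<Gamma> c x w e))" by (rule ext)
  then show ?thesis
    using has_derivative_transform_within_open[OF d0 open_image[OF c] x, of "\<lambda>y. R y a b e"]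
    by (simp add: K[OF F F F cinv_in[OF c]] comp[OF cinv_in[OF c]] cmap_cinv[OF c])
qed

end

section \<open>Curves, geodesics and parallel transport in a chart\<close>

text \<open>A curve may leave a chart; by continuity, a derivative at \<open>t\<close> is determined
  by nearby parameters whose points still lie in it.\<close>

lemma at_within_preimage:
  fixes \<gamma> :: "real \<Rightarrow> 'a::topological_space"
  assumes "continuous_on {0..1} \<gamma>" "open V" "\<gamma> t \<in> V" "t \<in> {0..1}"
  shows "at t within {s \<in> {0..1}. \<gamma> s \<in> V} = at t within {0..1}"
proof -
  have "openin (top_of_set {0..1}) ({0..1} \<inter> \<gamma> -` V)"
    using assms(1,2) by (simp add: continuous_openin_preimage_gen)
  then obtain O' where O': "open O'" "{0..1} \<inter> \<gamma> -` V = {0..1} \<inter> O'" by (auto simp: openin_open)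
  have eq: "{s \<in> {0..1}. \<gamma> s \<in> V} = {0..1} \<inter> O'" using O'(2) by blast
  have "t \<in> {0..1} \<inter> O'" using assms(3,4) unfolding eq[symmetric] by blast
  then have "t \<in> O'" by blast
  then show ?thesis unfolding eq by (rule at_within_nhd[OF _ O'(1)]) blast
qed

lemma vector_derivative_unit_interval:
  fixes f :: "real \<Rightarrow> 'a::euclidean_space"
  shows "(f has_vector_derivative D) (at t within {0..1}) \<Longrightarrow> t \<in> {0..1} \<Longrightarrow>
    vector_derivative f (at t within {0..1}) = D"
  by (rule vector_derivative_within_closed_interval) auto

context manifold begin

context
  fixes c \<gamma> X
  assumes c: "c \<in> A" and \<gamma>: "\<And>t. t \<in> {0..1} \<Longrightarrow> \<gamma> t \<in> cdom c"
    and der: "\<And>t. t \<in> {0..1} \<Longrightarrow> ((cmap c \<circ> \<gamma>) has_vector_derivative X t) (at t within {0..1})"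
begin

lemma curve_continuous: "continuous_on {0..1} \<gamma>"
proof -
  have "continuous_on {0..1} (cmap c \<circ> \<gamma>)" by (rule continuous_on_if_vector_derivative[OF der])
  then have "continuous_on {0..1} (\<lambda>t. cinv c ((cmap c \<circ> \<gamma>) t))"
    by (rule continuous_on_compose2[OF continuous_on_cinv[OF c]]) (use \<gamma> in auto)
  then show ?thesis by (rule continuous_on_cong[THEN iffD1, rotated -1]) (auto simp: cinv_cmap[OF c \<gamma>])
qed

lemma curve_derivative:
  assumes t: "t \<in> {0..1}" and d: "d \<in> A" "\<gamma> t \<in> cdom d"
  shows "((cmap d \<circ> \<gamma>) has_vector_derivative Dtrans c d (\<gamma> t) (X t)) (at t within {0..1})"
proof -
  have "((cmap d \<circ> cinv c) has_derivative Dtrans c d (\<gamma> t)) (at ((cmap c \<circ> \<gamma>) t))"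
    using transition_derivative[OF c d(1) \<gamma>[OF t] d(2)] by simp
  from has_derivative_compose[OF der[OF t, unfolded has_vector_derivative_def] this]
  have "((\<lambda>s. (cmap d \<circ> cinv c) ((cmap c \<circ> \<gamma>) s)) has_vector_derivative Dtrans c d (\<gamma> t) (X t)) (at t within {0..1})"
    by (simp add: has_vector_derivative_def linear_cmul[OF Dtrans_linear[OF c d(1) \<gamma>[OF t] d(2)]])
  then show ?thesis
    by (rule has_vector_derivative_transform[OF t, rotated]) (auto simp: cinv_cmap[OF c \<gamma>])
qed

lemma curve_velocity: assumes t: "t \<in> {0..1}" shows "velocity A \<gamma> t = coord_vec A c (\<gamma> t) (X t)"
proof
  fix d
  show "velocity A \<gamma> t d = coord_vec A c (\<gamma> t) (X t) d"
  proof (cases "d \<in> A \<and> \<gamma> t \<in> cdom d")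
    case True
    then have "vector_derivative (cmap d \<circ> \<gamma>) (at t within {0..1}) = Dtrans c d (\<gamma> t) (X t)"
      by (intro vector_derivative_unit_interval curve_derivative t) auto
    then show ?thesis using True by (simp add: velocity_def coord_vec_eq)
  next
    case False
    then show ?thesis by (auto simp: velocity_def coord_vec_eq)
  qed
qed

end

end

context connection begin

text \<open>\<open>parallel_along\<close> asks for the equation in every chart, while constructions
  provide it in one. In another chart, differentiating the Jacobian along the curve gives a second
  derivative, and the inhomogeneous term of \<open>christoffel_transform\<close> accounts for
  it.\<close>

lemma parallel_alongI:
  assumes c: "c \<in> A" and \<gamma>: "\<And>t. t \<in> {0..1} \<Longrightarrow> \<gamma> t \<in> cdom c"
    and der: "\<And>t. t \<in> {0..1} \<Longrightarrow> ((cmap c \<circ> \<gamma>) has_vector_derivative X t) (at t within {0..1})"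
    and V: "\<And>t. t \<in> {0..1} \<Longrightarrow> V t = coord_vec A c (\<gamma> t) (v t)"
    and vd: "\<And>t. t \<in> {0..1} \<Longrightarrow>
      (v has_vector_derivative - christoffel A N c (\<gamma> t) (X t) (v t)) (at t within {0..1})"
  shows "parallel_along A N \<gamma> V"
  unfolding parallel_along_def
proof (intro ballI conjI impI)
  fix t :: real assume t: "t \<in> {0..1}"
  show "V t \<in> tangent_space A (\<gamma> t)" unfolding V[OF t] by (rule coord_vec_tangent[OF c \<gamma>[OF t]])
  fix d assume d: "d \<in> A" "\<gamma> t \<in> cdom d"
  let ?\<tau> = "cmap d \<circ> cinv c" and ?T = "{s \<in> {0..1}. \<gamma> s \<in> cdom d}"
  let ?S = "cmap c ` (cdom c \<inter> cdom d)" and ?x = "cmap c \<circ> \<gamma>"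
  have T: "at t within ?T = at t within {0..1}"
    by (rule at_within_preimage[OF curve_continuous[OF c \<gamma> der] open_cdom[OF d(1)] d(2) t])
  have tT: "t \<in> ?T" using t d by auto
  have xS: "?x s \<in> ?S" if "s \<in> ?T" for s using that \<gamma> by auto
  note sm = transition_smooth[OF c d(1)]
  have lin: "linear (frechet_derivative ?\<tau> (at y))" if "y \<in> ?S" for y
    by (rule has_derivative_linear[OF smooth_on_has_derivative[OF sm that]])
  let ?B = "\<lambda>u. frechet_derivative (\<lambda>y. frechet_derivative ?\<tau> (at y) u) (at (?x t))"
  have B: "((\<lambda>y. frechet_derivative ?\<tau> (at y) u) has_derivative ?B u) (at (?x t))" for u
    by (rule smooth_on_has_derivative[OF smooth_on_frechet_derivative[OF sm] xS[OF tT]])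
  have B_lin: "linear (\<lambda>u. ?B u w)" for w
    by (rule derivative_linear_in_parameter[where L = "\<lambda>y. frechet_derivative ?\<tau> (at y)" and L' = ?B,
          OF lin open_overlap[OF c d(1)] xS[OF tT] B])
  have "((\<lambda>s. frechet_derivative ?\<tau> (at (?x s)) (v s)) has_derivative
    (\<lambda>h. ?B (v t) (h *\<^sub>R X t) + frechet_derivative ?\<tau> (at (?x t)) (h *\<^sub>R - christoffel A N c (\<gamma> t) (X t) (v t)))) (at t within ?T)"
  proof (rule has_derivative_linear_family[where L = "\<lambda>s. frechet_derivative ?\<tau> (at (?x s))"
        and L' = "\<lambda>h u. ?B u (h *\<^sub>R X t)"])
    show "linear (frechet_derivative ?\<tau> (at (?x s)))" if "s \<in> ?T" for s by (rule lin[OF xS[OF that]])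
    show "t \<in> ?T" by (rule tT)
    show "linear (\<lambda>u. ?B u (h *\<^sub>R X t))" for h by (rule B_lin)
    show "((\<lambda>s. frechet_derivative ?\<tau> (at (?x s)) u) has_derivative (\<lambda>h. ?B u (h *\<^sub>R X t))) (at t within ?T)" for u
      unfolding T by (rule has_derivative_compose[OF der[OF t, unfolded has_vector_derivative_def] B])
    show "(v has_derivative (\<lambda>h. h *\<^sub>R - christoffel A N c (\<gamma> t) (X t) (v t))) (at t within ?T)"
      unfolding T by (rule vd[OF t, unfolded has_vector_derivative_def])
  qed
  moreover have "?B (v t) (h *\<^sub>R X t) + frechet_derivative ?\<tau> (at (?x t)) (h *\<^sub>R - christoffel A N c (\<gamma> t) (X t) (v t))
      = h *\<^sub>R - christoffel A N d (\<gamma> t) (velocity A \<gamma> t d) (V t d)" for h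
  proof -
    have "velocity A \<gamma> t d = Dtrans c d (\<gamma> t) (X t)" "V t d = Dtrans c d (\<gamma> t) (v t)"
    proof -
      have "velocity A \<gamma> t = coord_vec A c (\<gamma> t) (X t)" by (rule curve_velocity[OF c \<gamma> der t])
      then show "velocity A \<gamma> t d = Dtrans c d (\<gamma> t) (X t)" using d by (simp add: coord_vec_eq)
      show "V t d = Dtrans c d (\<gamma> t) (v t)" unfolding V[OF t] using d by (simp add: coord_vec_eq)
    qed
    then have "- christoffel A N d (\<gamma> t) (velocity A \<gamma> t d) (V t d)
        = ?B (v t) (X t) - Dtrans c d (\<gamma> t) (christoffel A N c (\<gamma> t) (X t) (v t))"
      using christoffel_transform[OF c \<gamma>[OF t] d, of "X t" "v t"] by simp
    moreover have "frechet_derivative ?\<tau> (at (?x t)) = Dtrans c d (\<gamma> t)" by (simp add: Dtrans_def)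
    ultimately show ?thesis
      using linear_cmul[OF has_derivative_linear[OF B[of "v t"]], of h "X t"]
      by (simp add: linear_cmul[OF Dtrans_linear[OF c d(1) \<gamma>[OF t] d(2)]]
          linear_neg[OF Dtrans_linear[OF c d(1) \<gamma>[OF t] d(2)]] scaleR_diff_right)
  qed
  ultimately have "((\<lambda>s. frechet_derivative ?\<tau> (at (?x s)) (v s)) has_vector_derivative
      - christoffel A N d (\<gamma> t) (velocity A \<gamma> t d) (V t d)) (at t within ?T)"
    by (simp only: has_vector_derivative_def)
  then have "((\<lambda>s. V s d) has_vector_derivative
      - christoffel A N d (\<gamma> t) (velocity A \<gamma> t d) (V t d)) (at t within ?T)"
    by (rule has_vector_derivative_transform[OF tT, rotated]) (use d in \<open>auto simp: V coord_vec_eq Dtrans_def\<close>)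
  then show "((\<lambda>s. V s d) has_vector_derivative
      - christoffel A N d (\<gamma> t) (velocity A \<gamma> t d) (V t d)) (at t within {0..1})" by (simp only: T)
qed

lemma parallel_component:
  assumes "parallel_along A N \<gamma> V" "t \<in> {0..1}" "c \<in> A" "\<gamma> t \<in> cdom c"
  shows "((\<lambda>s. V s c) has_vector_derivative
    - christoffel A N c (\<gamma> t) (velocity A \<gamma> t c) (V t c)) (at t within {0..1})" "V t \<in> tangent_space A (\<gamma> t)"
  using bspec[OF assms(1)[unfolded parallel_along_def] assms(2)] assms(3,4) by auto

lemma geodesic_component:
  assumes geo: "is_geodesic A N \<gamma>" and t: "t \<in> {0..1}" and c: "c \<in> A" "\<gamma> t \<in> cdom c"
  shows "((cmap c \<circ> \<gamma>) has_vector_derivative velocity A \<gamma> t c) (at t within {0..1})"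
    "((\<lambda>s. velocity A \<gamma> s c) has_vector_derivative
      - christoffel A N c (\<gamma> t) (velocity A \<gamma> t c) (velocity A \<gamma> t c)) (at t within {0..1})"
    "velocity A \<gamma> t = coord_vec A c (\<gamma> t) (velocity A \<gamma> t c)"
proof -
  have "(cmap c \<circ> \<gamma>) differentiable (at t within {0..1})"
    using geo t c unfolding is_geodesic_def differentiable_curve_def by blast
  then show "((cmap c \<circ> \<gamma>) has_vector_derivative velocity A \<gamma> t c) (at t within {0..1})"
    using c by (simp add: velocity_def vector_derivative_works)
  have p: "parallel_along A N \<gamma> (velocity A \<gamma>)" using geo by (simp add: is_geodesic_def)
  show "((\<lambda>s. velocity A \<gamma> s c) has_vector_derivative
      - christoffel A N c (\<gamma> t) (velocity A \<gamma> t c) (velocity A \<gamma> t c)) (at t within {0..1})"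
    by (rule parallel_component(1)[OF p t c])
  show "velocity A \<gamma> t = coord_vec A c (\<gamma> t) (velocity A \<gamma> t c)"
    by (rule tangent_eq_coord_vec[OF parallel_component(2)[OF p t c] c])
qed

text \<open>The \<open>THE\<close> in \<open>parallel_transport\<close> is justified by uniqueness
  for linear equations, applied in a chart that contains the whole curve.\<close>

lemma parallel_transport_eq:
  assumes c: "c \<in> A" and \<gamma>: "\<And>t. t \<in> {0..1} \<Longrightarrow> \<gamma> t \<in> cdom c"
    and der: "\<And>t. t \<in> {0..1} \<Longrightarrow> ((cmap c \<circ> \<gamma>) has_vector_derivative X t) (at t within {0..1})"
    and Xc: "continuous_on {0..1} X" and V: "parallel_along A N \<gamma> V"
  shows "parallel_transport A N \<gamma> (V 0) = V 1"
  unfolding parallel_transport_def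
proof (rule the_equality)
  show "\<exists>V'. parallel_along A N \<gamma> V' \<and> V' 0 = V 0 \<and> V' 1 = V 1" using V by blast
  interpret C: affine_chart "cmap c ` cdom c" "\<Gamma> c" "d\<Gamma> c" by (rule affine_chart[OF c])
  fix w assume "\<exists>V'. parallel_along A N \<gamma> V' \<and> V' 0 = V 0 \<and> V' 1 = w"
  then obtain V' where V': "parallel_along A N \<gamma> V'" "V' 0 = V 0" "V' 1 = w" by blast
  let ?x = "cmap c \<circ> \<gamma>"
  have x: "?x t \<in> cmap c ` cdom c" if "t \<in> {0..1}" for t using \<gamma>[OF that] by simp
  have xc: "continuous_on {0..1} ?x" by (rule continuous_on_if_vector_derivative[OF der])
  have vel: "velocity A \<gamma> t c = X t" if "t \<in> {0..1}" for t
    using curve_velocity[OF c \<gamma> der that] coord_vec_component[OF c \<gamma>[OF that]] by simp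
  have d: "((\<lambda>s. V s c) has_vector_derivative - \<Gamma> c (?x t) (X t) (V t c)) (at t within {0..1})"
    if "parallel_along A N \<gamma> V" "t \<in> {0..1}" for V t
    using parallel_component(1)[OF that c \<gamma>[OF that(2)]] by (simp add: vel[OF that(2)] \<Gamma>_cmap[OF c \<gamma>[OF that(2)]])
  have d': "((\<lambda>s. V' s c - V s c) has_vector_derivative - \<Gamma> c (?x t) (X t) (V' t c - V t c)) (at t within {0..1})"
    if "t \<in> {0..1}" for t
    using has_vector_derivative_diff[OF d[OF V'(1) that] d[OF V that]] by (simp add: C.\<Gamma>_simps[OF x[OF that, unfolded comp_apply]])
  have "V' 1 c - V 1 c = 0"
  proof (rule linear_ode_unique[where L = "\<lambda>t v. - \<Gamma> c (?x t) (X t) v" and u = "\<lambda>s. V' s c - V s c" and ?t0.0 = 0])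
    show "linear (\<lambda>v. - \<Gamma> c (?x t) (X t) v)" if "t \<in> {0..1}" for t
      by (intro linear_compose_neg bilinear_linear2[OF C.bilin] x[OF that])
    show "continuous_on {0..1} (\<lambda>t. - \<Gamma> c (?x t) (X t) v)" for v
      by (intro continuous_on_minus C.continuous_on_\<Gamma> x xc Xc continuous_on_const)
    show "continuous_on {0..1} (\<lambda>s. V' s c - V s c)" by (rule continuous_on_if_vector_derivative[OF d'])
    show "((\<lambda>s. V' s c - V s c) has_vector_derivative - \<Gamma> c (?x t) (X t) (V' t c - V t c)) (at t)"
      if "t \<in> {0<..<1}" for t by (rule vector_derivative_at_interior[OF d' that]) (use that in auto)
  qed (use V'(2) in auto)
  then have "V' 1 = V 1"
    by (intro tangent_eqI[OF _ _ c \<gamma>[of 1]] parallel_component(2)[OF V'(1) _ c] parallel_component(2)[OF V _ c] \<gamma>) auto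
  then show "w = V 1" using V'(3) by simp
qed

text \<open>The geodesic equation is quadratic in the velocity, so affine changes of time preserve
  it. Initial segments are the case a = 0, b = t; reversal is a = 1, b = -1.\<close>

lemma geodesic_reparametrize:
  assumes geo: "is_geodesic A N \<gamma>" and ab: "\<And>s. s \<in> {0..1} \<Longrightarrow> a + b * s \<in> {0..1}"
    and \<delta>: "\<And>s. s \<in> {0..1} \<Longrightarrow> \<delta> s = \<gamma> (a + b * s)"
  shows "is_geodesic A N \<delta>" and "s \<in> {0..1} \<Longrightarrow> velocity A \<delta> s = tscale b (velocity A \<gamma> (a + b * s))"
proof -
  have chain: "((\<lambda>s. f (a + b * s)) has_vector_derivative b *\<^sub>R D) (at s within {0..1})"
    if "(f has_vector_derivative D) (at (a + b * s) within {0..1})" "s \<in> {0..1}"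
    for f :: "real \<Rightarrow> real ^ 'n" and D s
  proof -
    have "((\<lambda>s. a + b * s) has_vector_derivative b) (at s within {0..1})"
      by (auto intro!: derivative_eq_intros simp: has_real_derivative_iff_has_vector_derivative[symmetric])
    moreover have "(f has_vector_derivative D) (at (a + b * s) within (\<lambda>s. a + b * s) ` {0..1})"
      by (rule has_vector_derivative_within_subset[OF that(1)]) (use ab in blast)
    ultimately have "((f \<circ> (\<lambda>s. a + b * s)) has_vector_derivative b *\<^sub>R D) (at s within {0..1})"
      by (rule vector_diff_chain_within)
    then show ?thesis by (simp add: comp_def)
  qed
  have d1: "((cmap c \<circ> \<delta>) has_vector_derivative b *\<^sub>R velocity A \<gamma> (a + b * s) c) (at s within {0..1})"
    if s: "s \<in> {0..1}" and c: "c \<in> A" "\<delta> s \<in> cdom c" for s c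
  proof -
    have "\<gamma> (a + b * s) \<in> cdom c" using c \<delta>[OF s] by simp
    from chain[OF geodesic_component(1)[OF geo ab[OF s] c(1) this] s]
    show ?thesis by (rule has_vector_derivative_transform[OF s, rotated]) (simp add: \<delta>)
  qed
  show vel: "velocity A \<delta> s = tscale b (velocity A \<gamma> (a + b * s))" if s: "s \<in> {0..1}" for s
  proof
    fix c
    show "velocity A \<delta> s c = b *\<^sub>R velocity A \<gamma> (a + b * s) c"
    proof (cases "c \<in> A \<and> \<delta> s \<in> cdom c")
      case True
      then show ?thesis using vector_derivative_unit_interval[OF d1[OF s, of c] s] by (simp add: velocity_def)
    next
      case False
      then have "velocity A \<delta> s c = 0" "velocity A \<gamma> (a + b * s) c = 0"
        using \<delta>[OF s] unfolding velocity_def by auto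
      then show ?thesis by simp
    qed
  qed
  show "is_geodesic A N \<delta>"
    unfolding is_geodesic_def differentiable_curve_def parallel_along_def
  proof (intro conjI ballI impI)
    have "continuous_on {0..1} \<gamma>" using geo by (simp add: is_geodesic_def differentiable_curve_def)
    then have "continuous_on {0..1} (\<lambda>s. \<gamma> (a + b * s))"
    proof (rule continuous_on_compose2)
      show "(\<lambda>s. a + b * s) ` {0..1} \<subseteq> {0..1}" using ab by blast
    qed (intro continuous_intros)
    then show "continuous_on {0..1} \<delta>" by (rule continuous_on_cong[THEN iffD1, rotated -1]) (simp_all add: \<delta>)
    fix s :: real assume s: "s \<in> {0..1}"
    have "parallel_along A N \<gamma> (velocity A \<gamma>)" using geo by (simp add: is_geodesic_def)
    then have "velocity A \<gamma> (a + b * s) \<in> tangent_space A (\<gamma> (a + b * s))"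
      unfolding parallel_along_def using ab[OF s] by blast
    then show "velocity A \<delta> s \<in> tangent_space A (\<delta> s)"
      unfolding vel[OF s] \<delta>[OF s] by (rule tangent_scale)
    fix c assume c: "c \<in> A" "\<delta> s \<in> cdom c"
    then have c': "\<gamma> (a + b * s) \<in> cdom c" using \<delta>[OF s] by simp
    show "(cmap c \<circ> \<delta>) differentiable at s within {0..1}"
      using d1[OF s c] unfolding has_vector_derivative_def differentiable_def by blast
    have "((\<lambda>s. velocity A \<gamma> (a + b * s) c) has_vector_derivative
        b *\<^sub>R - christoffel A N c (\<gamma> (a + b * s)) (velocity A \<gamma> (a + b * s) c) (velocity A \<gamma> (a + b * s) c)) (at s within {0..1})"
      by (rule chain[OF geodesic_component(2)[OF geo ab[OF s] c(1) c'] s])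
    then have "((\<lambda>s. b *\<^sub>R velocity A \<gamma> (a + b * s) c) has_vector_derivative
        b *\<^sub>R (b *\<^sub>R - christoffel A N c (\<gamma> (a + b * s)) (velocity A \<gamma> (a + b * s) c) (velocity A \<gamma> (a + b * s) c))) (at s within {0..1})"
      by (rule bounded_linear.has_vector_derivative[OF bounded_linear_scaleR_right])
    then have "((\<lambda>s. velocity A \<delta> s c) has_vector_derivative
        b *\<^sub>R (b *\<^sub>R - christoffel A N c (\<gamma> (a + b * s)) (velocity A \<gamma> (a + b * s) c) (velocity A \<gamma> (a + b * s) c))) (at s within {0..1})"
      by (rule has_vector_derivative_transform[OF s, rotated]) (simp add: vel)
    then show "((\<lambda>s. velocity A \<delta> s c) has_vector_derivative
        - christoffel A N c (\<delta> s) (velocity A \<delta> s c) (velocity A \<delta> s c)) (at s within {0..1})"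
      by (simp add: vel[OF s] \<delta>[OF s] bilinear_simps[OF christoffel_bilinear[OF c(1) c']])
  qed
qed

end

section \<open>Statistical manifolds in a chart\<close>

locale statistical = manifold A for A :: "('m::{t2_space, second_countable_topology}, 'n::finite) chart set" +
  fixes g :: "('m, 'n) metric" and N Ns :: "('m, 'n) connection"
  assumes statistical: "statistical_manifold A g N Ns"
begin

sublocale connection A N
  using statistical by unfold_locales (simp_all add: statistical_manifold_def)

sublocale dual: connection A Ns
  using statistical by unfold_locales (simp_all add: statistical_manifold_def)

lemma metric: "riemannian_metric A g" and dual_conn: "dual_connections A g N Ns"
  using statistical by (simp_all add: statistical_manifold_def)

lemmas metric_unfolded = metric[unfolded riemannian_metric_def]

lemma g_linear:
  assumes "u \<in> tangent_space A p" "v \<in> tangent_space A p" "w \<in> tangent_space A p"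
  shows "g p (tadd (tscale a u) (tscale b v)) w = a * g p u w + b * g p v w"
  using metric_unfolded[THEN conjunct1, rule_format, OF assms] .

lemma g_sym: "u \<in> tangent_space A p \<Longrightarrow> v \<in> tangent_space A p \<Longrightarrow> g p u v = g p v u"
  using metric_unfolded[THEN conjunct2, THEN conjunct1, rule_format] .

lemma g_pos: "u \<in> tangent_space A p \<Longrightarrow> u \<noteq> tzero \<Longrightarrow> 0 < g p u u"
  using metric_unfolded[THEN conjunct2, THEN conjunct2, THEN conjunct1, rule_format] .

lemma g_smooth: "open W \<Longrightarrow> smooth_vfield A W X \<Longrightarrow> smooth_vfield A W Y \<Longrightarrow> smooth_fun A W (\<lambda>p. g p (X p) (Y p))"
  by (rule metric_unfolded[THEN conjunct2, THEN conjunct2, THEN conjunct2, rule_format]) blast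

definition G :: "('m, 'n) chart \<Rightarrow> real ^ 'n \<Rightarrow> real ^ 'n \<Rightarrow> real ^ 'n \<Rightarrow> real" where
  "G c x a b = g (cinv c x) (coord_vec A c (cinv c x) a) (coord_vec A c (cinv c x) b)"

lemma G_cmap: "c \<in> A \<Longrightarrow> p \<in> cdom c \<Longrightarrow> G c (cmap c p) a b = g p (coord_vec A c p a) (coord_vec A c p b)"
  by (simp add: G_def cinv_cmap)

lemma dual_chart:
  assumes c: "c \<in> A"
  shows "dual_chart (cmap c ` cdom c) (\<Gamma> c) (d\<Gamma> c) (dual.\<Gamma> c) (dual.d\<Gamma> c) (G c)"
proof -
  interpret C: affine_chart "cmap c ` cdom c" "\<Gamma> c" "d\<Gamma> c" by (rule affine_chart[OF c])
  interpret D: affine_chart "cmap c ` cdom c" "dual.\<Gamma> c" "dual.d\<Gamma> c" by (rule dual.affine_chart[OF c])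
  show ?thesis
  proof
    fix x assume x: "x \<in> cmap c ` cdom c"
    define p where "p = cinv c x"
    have p: "p \<in> cdom c" unfolding p_def by (rule cinv_in[OF c x])
    have px: "cmap c p = x" unfolding p_def by (rule cmap_cinv[OF c x])
    note T = coord_vec_tangent[OF c p]
    have Gx: "G c x a b = g p (coord_vec A c p a) (coord_vec A c p b)" for a b by (simp add: G_def p_def)
    show sym: "G c x a b = G c x b a" for a b unfolding Gx by (rule g_sym[OF T T])
    have 1: "G c x (r *\<^sub>R a + s *\<^sub>R b) e = r * G c x a e + s * G c x b e" for r s a b e
      unfolding Gx coord_vec_lincomb[OF c p] by (rule g_linear[OF T T T])
    have 2: "linear (\<lambda>a. G c x a e)" for e
    proof (rule linearI)
      show "G c x (a + b) e = G c x a e + G c x b e" for a b using 1[of 1 a 1 b e] by simp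
      show "G c x (r *\<^sub>R a) e = r *\<^sub>R G c x a e" for r a using 1[of r a 0 a e] by simp
    qed
    have 3: "linear (G c x e)" for e
    proof -
      have "G c x e = (\<lambda>a. G c x a e)" by (rule ext) (rule sym)
      then show ?thesis by (rule ssubst) (rule 2)
    qed
    show "bilinear (G c x)" unfolding bilinear_def by (intro conjI allI 2 3)
    show "0 < G c x a a" if "a \<noteq> 0" for a
    proof -
      have "coord_vec A c p a \<noteq> tzero"
      proof
        assume "coord_vec A c p a = tzero"
        then have "coord_vec A c p a c = 0" by simp
        then show False using coord_vec_component[OF c p, of a] that by simp
      qed
      then show ?thesis unfolding Gx by (rule g_pos[OF T])
    qed
    fix a b
    note F = smooth_vfield_coord[OF c open_cdom[OF c] order_refl]
    have "smooth_on (cmap c ` cdom c) (\<lambda>y. G c y a b)"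
      unfolding G_def by (rule smooth_funD[OF g_smooth[OF open_cdom[OF c] F F] c order_refl])
    then have d: "((\<lambda>y. G c y a b) has_derivative frechet_derivative (\<lambda>y. G c y a b) (at x)) (at x)"
      by (rule smooth_on_has_derivative) (rule x)
    have "frechet_derivative (\<lambda>y. G c y a b) (at x) w = G c x (\<Gamma> c x w a) b + G c x a (dual.\<Gamma> c x w b)" for w
    proof -
      have "dir_deriv A p (coord_vec A c p w) (\<lambda>q. g q (coord_vec A c q a) (coord_vec A c q b))
          = frechet_derivative (\<lambda>y. G c y a b) (at x) (coord_vec A c p w c)"
        by (rule dir_deriv_eq[OF c p T]) (use d in \<open>simp add: px G_def\<close>)
      moreover have "dir_deriv A p (coord_vec A c p w) (\<lambda>q. g q (coord_vec A c q a) (coord_vec A c q b))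
          = g p (N (\<lambda>q. coord_vec A c q w) (\<lambda>q. coord_vec A c q a) p) (coord_vec A c p b)
          + g p (coord_vec A c p a) (Ns (\<lambda>q. coord_vec A c q w) (\<lambda>q. coord_vec A c q b) p)"
        by (rule dual_conn[unfolded dual_connections_def, rule_format, where W = "cdom c", OF _ p])
          (intro conjI open_cdom c F)
      moreover have "N (\<lambda>q. coord_vec A c q w) (\<lambda>q. coord_vec A c q a) p = coord_vec A c p (\<Gamma> c x w a)"
        using N_tangent[OF open_cdom[OF c] F F p c p] by (simp add: \<Gamma>_def christoffel_def p_def)
      moreover have "Ns (\<lambda>q. coord_vec A c q w) (\<lambda>q. coord_vec A c q b) p = coord_vec A c p (dual.\<Gamma> c x w b)"
        using dual.N_tangent[OF open_cdom[OF c] F F p c p] by (simp add: dual.\<Gamma>_def christoffel_def p_def)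
      ultimately show ?thesis by (simp add: Gx coord_vec_component[OF c p])
    qed
    then have "frechet_derivative (\<lambda>y. G c y a b) (at x) = (\<lambda>w. G c x (\<Gamma> c x w a) b + G c x a (dual.\<Gamma> c x w b))"
      by (rule ext)
    then show "((\<lambda>y. G c y a b) has_derivative (\<lambda>w. G c x (\<Gamma> c x w a) b + G c x a (dual.\<Gamma> c x w b))) (at x)"
      using d by simp
  qed
qed

end

section \<open>Geodesics in a convex set\<close>

locale geodesically_convex = connection A N
  for A :: "('m::{t2_space, second_countable_topology}, 'n::finite) chart set" and N +
  fixes U :: "'m set"
  assumes unique_geodesic: "p \<in> U \<Longrightarrow> q \<in> U \<Longrightarrow> \<exists>!\<sigma>. joins_in A N U p q \<sigma>"
begin

lemma joins_geod: "p \<in> U \<Longrightarrow> q \<in> U \<Longrightarrow> joins_in A N U p q (geod A N U p q)"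
  unfolding geod_def by (rule theI'[OF unique_geodesic])

lemma geod_eqI: "p \<in> U \<Longrightarrow> q \<in> U \<Longrightarrow> joins_in A N U p q \<sigma> \<Longrightarrow> geod A N U p q = \<sigma>"
  unfolding geod_def by (rule the1_equality[OF unique_geodesic])

context
  fixes p q assumes p: "p \<in> U" and q: "q \<in> U"
begin

lemma geod_in: "t \<in> {0..1} \<Longrightarrow> geod A N U p q t \<in> U"
  and geod_geodesic: "is_geodesic A N (geod A N U p q)"
  and geod_0: "geod A N U p q 0 = p"
  and geod_1: "geod A N U p q 1 = q"
  using joins_geod[OF p q] by (auto simp: joins_in_def)

lemma geod_reparametrize:
  assumes ab: "\<And>s. s \<in> {0..1} \<Longrightarrow> a + b * s \<in> {0..1}"
  defines "\<sigma> \<equiv> geod A N U p q"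
  shows "s \<in> {0..1} \<Longrightarrow> velocity A (geod A N U (\<sigma> a) (\<sigma> (a + b))) s = tscale b (velocity A \<sigma> (a + b * s))"
proof -
  \<comment> \<open>\<open>joins_in\<close> requires extensional curves, so the piece must be cut
    off outside [0,1] before uniqueness can identify it.\<close>
  define \<delta> where "\<delta> = restrict (\<lambda>s. \<sigma> (a + b * s)) {0..1}"
  have \<delta>: "\<delta> s = \<sigma> (a + b * s)" if "s \<in> {0..1}" for s using that by (simp add: \<delta>_def)
  have "is_geodesic A N \<sigma>" unfolding \<sigma>_def by (rule geod_geodesic)
  note r = geodesic_reparametrize[where \<gamma> = \<sigma> and a = a and b = b and \<delta> = \<delta>, OF this ab \<delta>]
  have in_U: "\<sigma> (a + b * s) \<in> U" if "s \<in> {0..1}" for s unfolding \<sigma>_def by (rule geod_in[OF ab[OF that]])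
  then have "\<delta> \<in> {0..1} \<rightarrow>\<^sub>E U" unfolding \<delta>_def by (intro restrict_PiE_iff[THEN iffD2] ballI)
  then have "joins_in A N U (\<sigma> a) (\<sigma> (a + b)) \<delta>"
    unfolding joins_in_def using r(1) \<delta>[of 0] \<delta>[of 1] by simp
  moreover have "\<sigma> a \<in> U" "\<sigma> (a + b) \<in> U" using in_U[of 0] in_U[of 1] by simp_all
  ultimately have "geod A N U (\<sigma> a) (\<sigma> (a + b)) = \<delta>" by (intro geod_eqI)
  then show "s \<in> {0..1} \<Longrightarrow> velocity A (geod A N U (\<sigma> a) (\<sigma> (a + b))) s = tscale b (velocity A \<sigma> (a + b * s))"
    using r(2) by simp
qed

lemma exp_inv_geod:
  assumes t: "t \<in> {0..1}"
  shows "exp_inv A N U p (geod A N U p q t) = tscale t (exp_inv A N U p q)"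
proof -
  have "0 + t * s \<in> {0..1}" if "s \<in> {0..1}" for s using t that by (auto simp: mult_le_one)
  from geod_reparametrize[OF this, of 0] show ?thesis by (simp add: exp_inv_def geod_0)
qed

lemma exp_inv_reverse: "exp_inv A N U q p = tscale (-1) (velocity A (geod A N U p q) 1)"
proof -
  have "1 + (-1) * s \<in> {0..1}" if "s \<in> {0..1}" for s :: real using that by auto
  from geod_reparametrize[OF this, of 0] show ?thesis by (simp add: exp_inv_def geod_0 geod_1)
qed

end

end

section \<open>Divergences on a dually convex set\<close>

section \<open>The normal chart\<close>

context manifold begin

lemma smooth_fun_continuous:
  assumes W: "open W" and f: "smooth_fun A W f"
  shows "continuous_on W f"
proof (rule continuous_at_imp_continuous_on, rule ballI)
  fix q assume q: "q \<in> W"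
  obtain d where d: "d \<in> A" "q \<in> cdom d" by (rule chart_at)
  let ?V = "W \<inter> cdom d"
  have "continuous_on (cmap d ` ?V) (f \<circ> cinv d)"
    using f d by (intro smooth_on_imp_continuous_on) (simp add: smooth_fun_def)
  then have "continuous_on ?V (\<lambda>r. (f \<circ> cinv d) (cmap d r))"
    by (rule continuous_on_compose2) (auto intro: continuous_on_subset[OF continuous_on_cmap[OF d(1)]])
  then have "continuous_on ?V f"
    by (rule continuous_on_cong[THEN iffD1, rotated -1]) (auto simp: cinv_cmap[OF d(1)])
  moreover have "open ?V" "q \<in> ?V" using W q d open_cdom[OF d(1)] by auto
  ultimately show "isCont f q" by (simp add: continuous_on_eq_continuous_at)
qed

lemma maximal: "is_chart c \<Longrightarrow> (\<And>d. d \<in> A \<Longrightarrow> compatible c d) \<Longrightarrow> c \<in> A"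
  using manifold unfolding smooth_manifold_def by metis

end

locale dually_convex_set = statistical +
  fixes U :: "'a set"
  assumes convex: "dually_convex A N Ns U" and normal: "normal_convention A N Ns U"
begin

sublocale geodesically_convex A N U
  using convex by unfold_locales (simp add: dually_convex_def)

sublocale dual: geodesically_convex A Ns U
  using convex by unfold_locales (simp add: dually_convex_def)

lemma open_U: "open U"
  using normal by (simp add: normal_convention_def)

lemma exp_inv_tangent:
  assumes "p \<in> U" "q \<in> U"
  shows "exp_inv A N U p q \<in> tangent_space A p"
proof -
  have "velocity A (geod A N U p q) 0 \<in> tangent_space A (geod A N U p q 0)"
    using geod_geodesic[OF assms] by (simp add: is_geodesic_def parallel_along_def)
  then show ?thesis by (simp add: exp_inv_def geod_0[OF assms])
qed

text \<open>The chart \<open>c\<close> serves only to identify the tangent space at \<open>p\<close>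
  with \<open>real ^ 'n\<close>.\<close>

definition normal_coord :: "'a \<Rightarrow> ('a, 'b) chart \<Rightarrow> ('a, 'b) chart" where
  "normal_coord p c = (U, \<lambda>q. exp_inv A N U p q c)"

context
  fixes p c assumes p: "p \<in> U" and c: "c \<in> A" "p \<in> cdom c"
begin

text \<open>By maximality of the atlas only compatibility with the given charts is at stake. The
  inverse coordinate map is the exponential map \<open>e\<close>, so smoothness in both directions
  is its diffeomorphism property.\<close>

lemma normal_chart_in: "(normal_coord p c) \<in> A"
proof -
  define \<psi> where "\<psi> = (\<lambda>q. exp_inv A N U p q c)"
  have nc: "(normal_coord p c) = (U, \<psi>)" by (simp add: normal_coord_def \<psi>_def)
  obtain E where E: "exp_diffeo_on A N p E" "U \<subseteq> exp_map A N p ` E"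
    "\<And>q. q \<in> U \<Longrightarrow> inv_into E (exp_map A N p) q = exp_inv A N U p q"
    using normal p unfolding normal_convention_def by blast
  define S where "S = (\<lambda>v. v c) ` E"
  define e where "e = (\<lambda>u. exp_map A N p (coord_vec A c p u))"
  have S: "open S" "inj_on e S" "open (e ` S)" "smooth_map_into A S e" "smooth_fun A (e ` S) (inv_into S e)"
    using E(1) c unfolding exp_diffeo_on_def Let_def S_def e_def by blast+
  have vE: "exp_inv A N U p q \<in> E" "exp_map A N p (exp_inv A N U p q) = q" if q: "q \<in> U" for q
    using E(2) q inv_into_into[of q "exp_map A N p" E] f_inv_into_f[of q "exp_map A N p" E]
    unfolding E(3)[OF q] by blast+
  have \<psi>S: "\<psi> q \<in> S" if "q \<in> U" for q using vE(1)[OF that] by (auto simp: S_def \<psi>_def)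
  have e\<psi>: "e (\<psi> q) = q" if q: "q \<in> U" for q
    using vE(2)[OF q] tangent_eq_coord_vec[OF exp_inv_tangent[OF p q] c] by (simp add: e_def \<psi>_def)
  have inv: "inv_into S e q = \<psi> q" if q: "q \<in> U" for q
    using inv_into_f_f[OF S(2) \<psi>S[OF q]] e\<psi>[OF q] by simp
  \<comment> \<open>Images under the coordinate map are preimages under \<open>e\<close>; hence they
    are open by continuity of \<open>e\<close>.\<close>
  have img: "\<psi> ` (U \<inter> V) = {u \<in> S. e u \<in> U \<inter> V}" for V
  proof (intro set_eqI iffI)
    fix u assume "u \<in> \<psi> ` (U \<inter> V)"
    then show "u \<in> {u \<in> S. e u \<in> U \<inter> V}" using \<psi>S e\<psi> by auto
  next
    fix u assume u: "u \<in> {u \<in> S. e u \<in> U \<inter> V}"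
    then have "e (\<psi> (e u)) = e u" "\<psi> (e u) \<in> S" using e\<psi> \<psi>S by auto
    then have "\<psi> (e u) = u" using S(2) u by (auto dest: inj_onD)
    then show "u \<in> \<psi> ` (U \<inter> V)" using u by (metis (mono_tags, lifting) imageI mem_Collect_eq)
  qed
  have ec: "continuous_on S e" using S(4) by (simp add: smooth_map_into_def)
  have op: "open (\<psi> ` (U \<inter> V))" if "open V" for V
  proof -
    have "open (S \<inter> e -` (U \<inter> V))"
      by (rule continuous_open_preimage[OF ec S(1)]) (use open_U that in auto)
    then show ?thesis unfolding img by (simp add: vimage_def Int_def)
  qed
  have inj: "inj_on \<psi> U" using e\<psi> by (metis inj_on_inverseI)
  have ci: "cinv (U, \<psi>) u = e u" if "u \<in> \<psi> ` U" for u
    using that e\<psi> inv_into_f_f[OF inj] by (auto simp: cinv_def)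
  have US: "U \<subseteq> e ` S" using e\<psi> \<psi>S by (metis image_eqI subsetI)
  have ic: "continuous_on U \<psi>"
    by (rule continuous_on_cong[THEN iffD1, OF refl _ continuous_on_subset[OF smooth_fun_continuous[OF S(3,5)] US]])
      (rule inv)
  show ?thesis unfolding nc
  proof (rule maximal)
    have "continuous_on (\<psi> ` U) e" using img[of UNIV] by (intro continuous_on_subset[OF ec]) auto
    then have "continuous_on (\<psi> ` U) (cinv (U, \<psi>))"
      by (rule continuous_on_cong[THEN iffD1, rotated -1]) (auto simp: ci)
    moreover have "cinv (U, \<psi>) (\<psi> q) = q" if "q \<in> U" for q using ci[of "\<psi> q"] e\<psi>[OF that] that by simp
    ultimately have "homeomorphism U (\<psi> ` U) \<psi> (cinv (U, \<psi>))"
      using ic by (auto simp: homeomorphism_def image_iff)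
    then show "is_chart (U, \<psi>)" using op[of UNIV] open_U by (simp add: is_chart_def)
    fix d assume d: "d \<in> A"
    show "compatible (U, \<psi>) d"
      unfolding compatible_def fst_conv snd_conv
    proof
      have o: "open (\<psi> ` (U \<inter> cdom d))" by (rule op[OF open_cdom[OF d]])
      have "smooth_on {x \<in> S. e x \<in> cdom d} (cmap d \<circ> e)" using S(4) d by (simp add: smooth_map_into_def)
      then have "smooth_on (\<psi> ` (U \<inter> cdom d)) (cmap d \<circ> e)"
        by (rule smooth_on_subset[rotated]) (auto simp: img)
      then show "smooth_on (\<psi> ` (U \<inter> cdom d)) (cmap d \<circ> cinv (U, \<psi>))"
        by (rule smooth_on_cong[OF o, rotated]) (auto simp: ci)
      have o': "open (cmap d ` (U \<inter> cdom d))" by (rule open_chart_image[OF d open_U])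
      have "smooth_on (cmap d ` (e ` S \<inter> cdom d)) (inv_into S e \<circ> cinv d)" using S(5) d by (simp add: smooth_fun_def)
      then have "smooth_on (cmap d ` (U \<inter> cdom d)) (inv_into S e \<circ> cinv d)"
        by (rule smooth_on_subset[rotated]) (use US in auto)
      then show "smooth_on (cmap d ` (U \<inter> cdom d)) (\<psi> \<circ> cinv d)"
        by (rule smooth_on_cong[OF o', rotated]) (auto simp: cinv_cmap[OF d] inv)
    qed
  qed
qed

lemma normal_geod:
  assumes q: "q \<in> U" and t: "t \<in> {0..1}"
  shows "cmap (normal_coord p c) (geod A N U p q t) = t *\<^sub>R cmap (normal_coord p c) q"
  using exp_inv_geod[OF p q t] by (simp add: normal_coord_def)

lemma normal_origin: "cmap (normal_coord p c) p = 0"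
  using normal_geod[OF p, of 0] geod_0[OF p p] by simp

lemma normal_velocity:
  assumes q: "q \<in> U" and t: "t \<in> {0..1}"
  shows "velocity A (geod A N U p q) t (normal_coord p c) = cmap (normal_coord p c) q"
proof -
  have U: "cdom (normal_coord p c) = U" by (simp add: normal_coord_def)
  have "((\<lambda>t. t *\<^sub>R cmap (normal_coord p c) q) has_vector_derivative cmap (normal_coord p c) q) (at t within {0..1})"
    by (auto intro!: derivative_eq_intros)
  then have "((cmap (normal_coord p c) \<circ> geod A N U p q) has_vector_derivative cmap (normal_coord p c) q) (at t within {0..1})"
    by (rule has_vector_derivative_transform[OF t, rotated]) (simp add: normal_geod[OF q])
  then have "vector_derivative (cmap (normal_coord p c) \<circ> geod A N U p q) (at t within {0..1}) = cmap (normal_coord p c) q"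
    by (rule vector_derivative_unit_interval) (rule t)
  then show ?thesis using normal_chart_in geod_in[OF p q t] by (simp add: velocity_def U)
qed

lemma normal_dual_chart:
  "normal_dual_chart (cmap (normal_coord p c) ` U) (\<Gamma> (normal_coord p c)) (d\<Gamma> (normal_coord p c))
    (dual.\<Gamma> (normal_coord p c)) (dual.d\<Gamma> (normal_coord p c)) (G (normal_coord p c))"
proof -
  have U: "cdom (normal_coord p c) = U" by (simp add: normal_coord_def)
  note nA = normal_chart_in
  interpret C: affine_chart "cmap (normal_coord p c) ` U" "\<Gamma> (normal_coord p c)" "d\<Gamma> (normal_coord p c)"
    using affine_chart[OF nA] by (simp add: U)
  interpret D: dual_chart "cmap (normal_coord p c) ` U" "\<Gamma> (normal_coord p c)" "d\<Gamma> (normal_coord p c)"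
    "dual.\<Gamma> (normal_coord p c)" "dual.d\<Gamma> (normal_coord p c)" "G (normal_coord p c)"
    using dual_chart[OF nA] by (simp add: U)
  show ?thesis
  proof unfold_locales
    show "cmap (normal_coord p c) ` U \<noteq> {}" using p by auto
    fix x assume "x \<in> cmap (normal_coord p c) ` U"
    then obtain q where q: "q \<in> U" "x = cmap (normal_coord p c) q" by blast
    show "t *\<^sub>R x \<in> cmap (normal_coord p c) ` U" if "t \<in> {0..1}" for t
      unfolding q(2) normal_geod[OF q(1) that, symmetric] by (rule imageI[OF geod_in[OF p q(1) that]])
    \<comment> \<open>Radiality at \<open>x\<close> is the geodesic equation at time 1, when the ray
      reaches \<open>q\<close>: its velocity components are constant.\<close>
    let ?\<sigma> = "geod A N U p q"
    have "((\<lambda>s. velocity A ?\<sigma> s (normal_coord p c)) has_vector_derivative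
        - christoffel A N (normal_coord p c) (?\<sigma> 1) (velocity A ?\<sigma> 1 (normal_coord p c)) (velocity A ?\<sigma> 1 (normal_coord p c))) (at 1 within {0..1})"
      by (rule geodesic_component(2)[OF geod_geodesic[OF p q(1)] _ nA]) (use q in \<open>auto simp: U geod_1[OF p]\<close>)
    then have "((\<lambda>s. velocity A ?\<sigma> s (normal_coord p c)) has_vector_derivative - \<Gamma> (normal_coord p c) x x x) (at 1 within {0..1})"
      using \<Gamma>_cmap[OF nA, of q] q by (simp add: geod_1[OF p] normal_velocity U)
    moreover have "((\<lambda>s. velocity A ?\<sigma> s (normal_coord p c)) has_vector_derivative 0) (at 1 within {0..1})"
      by (rule has_vector_derivative_transform[OF _ _ has_vector_derivative_const[of x]])
        (auto simp: normal_velocity q)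
    ultimately have "- \<Gamma> (normal_coord p c) x x x = 0"
      using vector_derivative_unit_interval[of "\<lambda>s. velocity A ?\<sigma> s (normal_coord p c)" _ 1]
      by (metis atLeastAtMost_iff order_refl zero_le_one)
    then show "\<Gamma> (normal_coord p c) x x x = 0" by simp
  qed
qed

end

section \<open>The canonical divergence in an adapted chart\<close>

text \<open>Straightness of the \<nabla>-geodesics from \<open>p\<close>, with affine parameter, is
  common to the normal charts and to the chart \<theta>, so a single computation serves all three
  cases.\<close>

context
  fixes p c
  assumes p: "p \<in> U" and c: "c \<in> A" "cdom c = U"
    and straight: "\<And>q t. q \<in> U \<Longrightarrow> t \<in> {0..1} \<Longrightarrow>
      cmap c (geod A N U p q t) = cmap c p + t *\<^sub>R (cmap c q - cmap c p)"
begin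

lemma straight_velocity:
  assumes q: "q \<in> U" and t: "t \<in> {0..1}"
  shows "velocity A (geod A N U p q) t = coord_vec A c (geod A N U p q t) (cmap c q - cmap c p)"
proof (rule curve_velocity[OF c(1) _ _ t])
  show "geod A N U p q s \<in> cdom c" if "s \<in> {0..1}" for s using geod_in[OF p q that] c by simp
  fix s :: real assume s: "s \<in> {0..1}"
  have "((\<lambda>t. cmap c p + t *\<^sub>R (cmap c q - cmap c p)) has_vector_derivative cmap c q - cmap c p) (at s within {0..1})"
    by (auto intro!: derivative_eq_intros)
  then show "((cmap c \<circ> geod A N U p q) has_vector_derivative cmap c q - cmap c p) (at s within {0..1})"
    by (rule has_vector_derivative_transform[OF s, rotated]) (simp add: straight[OF q])
qed

lemma straight_energy:
  assumes q: "q \<in> U"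
  shows "energy_divergence A g N U p q = integral {0..1} (\<lambda>t. t *
    G c (cmap c p + t *\<^sub>R (cmap c q - cmap c p)) (cmap c q - cmap c p) (cmap c q - cmap c p))"
  unfolding energy_divergence_def Let_def
proof (rule integral_cong)
  fix t :: real assume t: "t \<in> {0..1}"
  interpret D: dual_chart "cmap c ` cdom c" "\<Gamma> c" "d\<Gamma> c" "dual.\<Gamma> c" "dual.d\<Gamma> c" "G c"
    by (rule dual_chart[OF c(1)])
  have s: "geod A N U p q t \<in> cdom c" using geod_in[OF p q t] c by simp
  show "t * (sqrt (g (geod A N U p q t) (velocity A (geod A N U p q) t) (velocity A (geod A N U p q) t)))\<^sup>2
    = t * G c (cmap c p + t *\<^sub>R (cmap c q - cmap c p)) (cmap c q - cmap c p) (cmap c q - cmap c p)"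
    using D.G_nonneg[OF imageI[OF s]]
    by (simp add: straight[OF q t, symmetric] G_cmap[OF c(1) s] straight_velocity[OF q t])
qed

text \<open>The constant vector \<open>c q - c p\<close> is parallel along the \<open>\<nabla>\<^sup>*\<close>-geodesic, so \<open>\<Pi>\<^sub>q(p)\<close> is the end
  velocity of the \<open>\<nabla>\<close>-geodesic.\<close>

lemma straight_divergence:
  assumes parallel: "\<And>q t. q \<in> U \<Longrightarrow> t \<in> {0..1} \<Longrightarrow>
      christoffel A N c (geod A Ns U p q t) (velocity A (geod A Ns U p q) t c) (cmap c q - cmap c p) = 0"
    and q: "q \<in> U"
  shows "canonical_divergence A g N Ns U p q = energy_divergence A g N U p q"
proof -
  have T: "transported_exp_inv A N Ns U q p = coord_vec A c q (cmap c q - cmap c p)" if q: "q \<in> U" for q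
  proof -
    let ?\<sigma> = "geod A Ns U p q" and ?v = "cmap c q - cmap c p"
    have s: "?\<sigma> t \<in> cdom c" if "t \<in> {0..1}" for t using dual.geod_in[OF p q that] c by simp
    note geo = dual.geod_geodesic[OF p q]
    note d = dual.geodesic_component[OF geo _ c(1) s]
    have V: "parallel_along A N ?\<sigma> (\<lambda>t. coord_vec A c (?\<sigma> t) ?v)"
      by (rule parallel_alongI[OF c(1) s d(1) refl]) (simp_all add: parallel[OF q])
    have "parallel_transport A N ?\<sigma> (coord_vec A c (?\<sigma> 0) ?v) = coord_vec A c (?\<sigma> 1) ?v"
      by (rule parallel_transport_eq[OF c(1) s d(1) continuous_on_if_vector_derivative[OF d(2)] V])
    moreover have "exp_inv A N U p q = coord_vec A c p ?v"
      using straight_velocity[OF q, of 0] by (simp add: exp_inv_def geod_0[OF p q])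
    ultimately show ?thesis
      by (simp add: transported_exp_inv_def dual.geod_0[OF p q] dual.geod_1[OF p q])
  qed
  interpret D: dual_chart "cmap c ` cdom c" "\<Gamma> c" "d\<Gamma> c" "dual.\<Gamma> c" "dual.d\<Gamma> c" "G c"
    by (rule dual_chart[OF c(1)])
  show ?thesis
    unfolding straight_energy[OF q] canonical_divergence_def Let_def
  proof (rule integral_cong)
    fix t :: real assume t: "t \<in> {0..1}"
    let ?r = "geod A N U p q t"
    have r: "?r \<in> U" "?r \<in> cdom c" using geod_in[OF p q t] c by auto
    define v where "v = cmap c q - cmap c p"
    have rv: "cmap c p + t *\<^sub>R v = cmap c ?r" unfolding v_def by (rule straight[OF q t, symmetric])
    \<comment> \<open>The transported vector at the intermediate point \<open>?r\<close> is thus t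
      times the velocity: this is the weight t in D(p,q).\<close>
    then have "cmap c ?r - cmap c p = t *\<^sub>R v" by (simp add: algebra_simps)
    then show "g ?r (transported_exp_inv A N Ns U ?r p) (velocity A (geod A N U p q) t)
      = t * G c (cmap c p + t *\<^sub>R (cmap c q - cmap c p)) (cmap c q - cmap c p) (cmap c q - cmap c p)"
      unfolding T[OF r(1)] straight_velocity[OF q t] G_cmap[OF c(1) r(2), symmetric]
        v_def[symmetric] rv
      by (simp add: D.G_simps[OF imageI[OF r(2)]])
  qed
qed

end

section \<open>The self-dual case\<close>

text \<open>Connections are total functions, so \<open>same_connection\<close> does not make them
  equal. Geodesics are compared through the Christoffel symbols, which see a connection only on
  coordinate fields.\<close>

lemma geod_cong:
  assumes "\<And>c p. c \<in> A \<Longrightarrow> p \<in> cdom c \<Longrightarrow> christoffel A N1 c p = christoffel A N2 c p"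
  shows "geod A N1 U p q = geod A N2 U p q"
proof -
  have "is_geodesic A N1 \<gamma> = is_geodesic A N2 \<gamma>" for \<gamma>
    unfolding is_geodesic_def parallel_along_def using assms by (metis (no_types, lifting))
  then show ?thesis unfolding geod_def joins_in_def by simp
qed

lemma christoffel_same:
  assumes "same_connection A N1 N2" "c \<in> A" "p \<in> cdom c"
  shows "christoffel A N1 c p = christoffel A N2 c p"
proof (intro ext)
  fix u w
  have "N1 (\<lambda>q. coord_vec A c q u) (\<lambda>q. coord_vec A c q w) p = N2 (\<lambda>q. coord_vec A c q u) (\<lambda>q. coord_vec A c q w) p"
    by (rule assms(1)[unfolded same_connection_def, rule_format, OF _ assms(3)])
      (intro conjI open_cdom smooth_vfield_coord assms(2) order_refl)
  then show "christoffel A N1 c p u w = christoffel A N2 c p u w" by (simp add: christoffel_def)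
qed

lemma self_dual_divergence:
  assumes same: "\<And>c p. c \<in> A \<Longrightarrow> p \<in> cdom c \<Longrightarrow> christoffel A Ns c p = christoffel A N c p"
    and p: "p \<in> U" and q: "q \<in> U"
  defines "d \<equiv> sqrt (g p (exp_inv A N U p q) (exp_inv A N U p q))"
  shows "canonical_divergence A g N Ns U p q = 1/2 * d\<^sup>2" "d = riemannian_distance A g U p q"
proof -
  obtain c0 where c0: "c0 \<in> A" "p \<in> cdom c0" by (rule chart_at)
  define c where "c = normal_coord p c0"
  have c: "c \<in> A" unfolding c_def by (rule normal_chart_in[OF p c0])
  have U: "cdom c = U" by (simp add: c_def normal_coord_def)
  interpret D: normal_dual_chart "cmap c ` U" "\<Gamma> c" "d\<Gamma> c" "dual.\<Gamma> c" "dual.d\<Gamma> c" "G c"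
    unfolding c_def by (rule normal_dual_chart[OF p c0])
  have origin: "cmap c p = 0" unfolding c_def by (rule normal_origin[OF p c0])
  have geod: "cmap c (geod A N U p q t) = t *\<^sub>R cmap c q" if "q \<in> U" "t \<in> {0..1}" for q t
    unfolding c_def by (rule normal_geod[OF p c0 that])
  have straight: "cmap c (geod A N U p q t) = cmap c p + t *\<^sub>R (cmap c q - cmap c p)"
    if "q \<in> U" "t \<in> {0..1}" for q t using geod[OF that] by (simp add: origin)
  have vel: "velocity A (geod A N U p q) t = coord_vec A c (geod A N U p q t) (cmap c q)"
    if "q \<in> U" "t \<in> {0..1}" for q t
    using straight_velocity[OF p c U straight that] by (simp add: origin)
  have self: "dual.\<Gamma> c x = \<Gamma> c x" if x: "x \<in> cmap c ` U" for x
    unfolding dual.\<Gamma>_def \<Gamma>_def by (rule same[OF c cinv_in[OF c]]) (use x U in simp)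
  have eqg: "geod A Ns U = geod A N U" by (intro ext fun_cong[OF geod_cong] same)
  \<comment> \<open>Both kinds of geodesics are the same rays, and the constant vector is the
    velocity itself.\<close>
  have "christoffel A N c (geod A Ns U p q t) (velocity A (geod A Ns U p q) t c) (cmap c q - cmap c p) = 0"
    if q: "q \<in> U" and t: "t \<in> {0..1}" for q t
  proof -
    have r: "geod A N U p q t \<in> cdom c" using geod_in[OF p q t] U by simp
    show ?thesis
      using D.\<Gamma>_ray[OF imageI[OF q] t]
      by (simp add: eqg vel[OF q t] coord_vec_component[OF c r] origin \<Gamma>_cmap[OF c r, symmetric] geod[OF q t])
  qed
  note div = straight_divergence[OF p c U straight this q]
  let ?x = "cmap c q"
  have x: "?x \<in> cmap c ` U" using q by simp
  have const: "G c (t *\<^sub>R ?x) ?x ?x = G c 0 ?x ?x" if "t \<in> {0..1}" for t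
    by (rule D.G_radial_constant[OF self x that])
  have "exp_inv A N U p q = coord_vec A c p ?x"
    using vel[OF q, of 0] by (simp add: exp_inv_def geod_0[OF p q])
  then have d: "d = sqrt (G c 0 ?x ?x)"
    using G_cmap[OF c, of p ?x ?x] p by (simp add: d_def U origin)
  have nn: "0 \<le> G c 0 ?x ?x" by (rule D.G_nonneg[OF D.zero_in])
  have "((\<lambda>t. t * G c 0 ?x ?x) has_integral 1\<^sup>2 / 2 * G c 0 ?x ?x - 0\<^sup>2 / 2 * G c 0 ?x ?x) {0..1}"
    by (rule fundamental_theorem_of_calculus)
      (auto intro!: derivative_eq_intros simp flip: has_real_derivative_iff_has_vector_derivative)
  then have "integral {0..1} (\<lambda>t. t * G c 0 ?x ?x) = 1/2 * d\<^sup>2"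
    using nn by (simp add: integral_unique d)
  moreover have "energy_divergence A g N U p q = integral {0..1} (\<lambda>t. t * G c 0 ?x ?x)"
    by (rule trans[OF straight_energy[OF p c U straight q] integral_cong]) (simp_all add: origin const)
  ultimately show "canonical_divergence A g N Ns U p q = 1/2 * d\<^sup>2" using div by simp
  \<comment> \<open>The geodesic attains the infimum. Every competitor lies in \<open>U\<close>,
    which is the domain of the normal chart, so the lower bound from the Gauss lemma applies to it
    as a whole.\<close>
  define L where "L = {curve_length A g \<gamma> |\<gamma>. C1_curve A \<gamma> \<and> \<gamma> ` {0..1} \<subseteq> U \<and> \<gamma> 0 = p \<and> \<gamma> 1 = q}"
  have "d \<in> L"
  proof -
    let ?\<sigma> = "geod A N U p q"
    have "C1_curve A ?\<sigma>"
      unfolding C1_curve_def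
    proof (intro conjI ballI)
      show "differentiable_curve A ?\<sigma>" using geod_geodesic[OF p q] by (simp add: is_geodesic_def)
      fix e assume e: "e \<in> A"
      show "continuous_on {t \<in> {0..1}. ?\<sigma> t \<in> cdom e} (\<lambda>t. velocity A ?\<sigma> t e)"
      proof (rule continuous_on_if_vector_derivative)
        fix t assume t: "t \<in> {t \<in> {0..1}. ?\<sigma> t \<in> cdom e}"
        then have t': "t \<in> {0..1}" "?\<sigma> t \<in> cdom e" by auto
        show "((\<lambda>t. velocity A ?\<sigma> t e) has_vector_derivative
          - christoffel A N e (?\<sigma> t) (velocity A ?\<sigma> t e) (velocity A ?\<sigma> t e)) (at t within {t \<in> {0..1}. ?\<sigma> t \<in> cdom e})"
          by (rule has_vector_derivative_within_subset[OF geodesic_component(2)[OF geod_geodesic[OF p q] t'(1) e t'(2)]]) auto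
      qed
    qed
    moreover have "curve_length A g ?\<sigma> = d"
    proof -
      have "curve_length A g ?\<sigma> = integral {0..1} (\<lambda>t::real. d)"
        unfolding curve_length_def
      proof (rule integral_cong)
        fix t :: real assume t: "t \<in> {0..1}"
        have r: "?\<sigma> t \<in> cdom c" using geod_in[OF p q t] U by simp
        show "sqrt (g (?\<sigma> t) (velocity A ?\<sigma> t) (velocity A ?\<sigma> t)) = d"
          unfolding vel[OF q t] G_cmap[OF c r, symmetric] geod[OF q t] const[OF t] d ..
      qed
      then show ?thesis by simp
    qed
    moreover have "?\<sigma> ` {0..1} \<subseteq> U" using geod_in[OF p q] by auto
    ultimately show ?thesis unfolding L_def using geod_0[OF p q] geod_1[OF p q] by blast
  qed
  moreover have "d \<le> l" if l: "l \<in> L" for l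
  proof -
    obtain \<gamma> where \<gamma>: "l = curve_length A g \<gamma>" "C1_curve A \<gamma>" "\<gamma> ` {0..1} \<subseteq> U" "\<gamma> 0 = p" "\<gamma> 1 = q"
      using l unfolding L_def by blast
    have r: "\<gamma> t \<in> cdom c" "\<gamma> t \<in> U" if "t \<in> {0..1}" for t using \<gamma>(3) that U by auto
    define Z where "Z t = velocity A \<gamma> t c" for t
    have zd: "((cmap c \<circ> \<gamma>) has_vector_derivative Z t) (at t within {0..1})" if t: "t \<in> {0..1}" for t
    proof -
      have "(cmap c \<circ> \<gamma>) differentiable (at t within {0..1})"
        using \<gamma>(2) t c r(1)[OF t] unfolding C1_curve_def differentiable_curve_def by blast
      then show ?thesis using c r(1)[OF t] by (simp add: Z_def velocity_def vector_derivative_works)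
    qed
    have "{t \<in> {0..1}. \<gamma> t \<in> cdom c} = {0..1}" using r(1) by blast
    moreover have "continuous_on {t \<in> {0..1}. \<gamma> t \<in> cdom c} Z"
      using \<gamma>(2) c unfolding C1_curve_def Z_def by blast
    ultimately have Zc: "continuous_on {0..1} Z" by simp
    have "sqrt (G c 0 ((cmap c \<circ> \<gamma>) 1) ((cmap c \<circ> \<gamma>) 1))
        \<le> integral {0..1} (\<lambda>t. sqrt (G c ((cmap c \<circ> \<gamma>) t) (Z t) (Z t)))"
      by (rule D.curve_length_ge_radius[OF self _ _ zd Zc]) (simp_all add: r(2) \<gamma>(4) origin)
    also have "\<dots> = l"
      unfolding \<gamma>(1) curve_length_def
    proof (rule integral_cong)
      fix t :: real assume t: "t \<in> {0..1}"
      have "velocity A \<gamma> t = coord_vec A c (\<gamma> t) (Z t)" by (rule curve_velocity[OF c r(1) zd t])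
      then show "sqrt (G c ((cmap c \<circ> \<gamma>) t) (Z t) (Z t)) = sqrt (g (\<gamma> t) (velocity A \<gamma> t) (velocity A \<gamma> t))"
        by (simp add: G_cmap[OF c r(1)[OF t]])
    qed
    finally show ?thesis by (simp add: d \<gamma>(5))
  qed
  ultimately have "Inf L = d" by (rule cInf_eq_minimum)
  then show "d = riemannian_distance A g U p q" by (simp add: riemannian_distance_def L_def)
qed

section \<open>The dually flat case\<close>

lemma dually_flat_divergence:
  assumes flat: "dually_flat_coordinates A g N Ns U \<theta> \<eta> \<phi> \<phi>s" and p: "p \<in> U" and q: "q \<in> U"
  shows "canonical_divergence A g N Ns U p q = bregman_divergence \<theta> \<eta> \<phi> \<phi>s p q"
proof -
  note flat' = flat[unfolded dually_flat_coordinates_def affine_coordinates_def]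
  define c e where "c = (U, \<theta>)" and "e = (U, \<eta>)"
  have c: "c \<in> A" "cdom c = U" "cmap c = \<theta>" and e: "e \<in> A" "cdom e = U" "cmap e = \<eta>"
    using flat' by (simp_all add: c_def e_def)
  have N0: "christoffel A N c r (axis i 1) (axis j 1) = 0" if "r \<in> U" for r i j
    using flat' that by (simp add: christoffel_def c_def)
  have chr: "christoffel A N c r a b = 0" if r: "r \<in> U" for r a b
  proof -
    have B: "bilinear (christoffel A N c r)" by (rule christoffel_bilinear) (use c r in auto)
    have "christoffel A N c r a b = (\<Sum>i\<in>Basis. \<Sum>j\<in>Basis. (a \<bullet> i) *\<^sub>R (b \<bullet> j) *\<^sub>R christoffel A N c r i j)"
      by (subst linear_family_expand[OF bilinear_linear1[OF B]], subst linear_family_expand[OF bilinear_linear2[OF B]])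
        (simp add: scaleR_sum_right)
    also have "\<dots> = 0"
      by (intro sum.neutral ballI) (auto simp: Basis_vec_def N0[OF r])
    finally show ?thesis .
  qed
  have straight: "cmap c (geod A N U p q t) = cmap c p + t *\<^sub>R (cmap c q - cmap c p)"
    if q: "q \<in> U" and t: "t \<in> {0..1}" for q t
  proof -
    let ?\<sigma> = "geod A N U p q" and ?X = "\<lambda>t. velocity A (geod A N U p q) t c"
    have s: "?\<sigma> t \<in> U" "?\<sigma> t \<in> cdom c" if "t \<in> {0..1}" for t using geod_in[OF p q that] c by auto
    note d = geodesic_component[OF geod_geodesic[OF p q] _ c(1) s(2)]
    have X0: "(?X has_vector_derivative 0) (at t within {0..1})" if "t \<in> {0..1}" for t
      using d(2)[OF that that] by (simp add: chr[OF s(1)[OF that]])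
    have X: "?X t = ?X 0" if "t \<in> {0..1}" for t
    proof (rule constant_on_unit_interval[where u = ?X])
      show "continuous_on {0..1} ?X" by (rule continuous_on_if_vector_derivative[OF X0])
      show "(?X has_vector_derivative 0) (at t)" if "t \<in> {0<..<1}" for t
        by (rule vector_derivative_at_interior[OF X0 that]) (use that in auto)
    qed (use that in auto)
    let ?u = "\<lambda>t. (cmap c \<circ> ?\<sigma>) t - t *\<^sub>R ?X 0"
    have u0: "(?u has_vector_derivative 0) (at t within {0..1})" if "t \<in> {0..1}" for t
    proof -
      have "((\<lambda>t. t *\<^sub>R ?X 0) has_vector_derivative ?X 0) (at t within {0..1})"
        by (auto intro!: derivative_eq_intros)
      from has_vector_derivative_diff[OF d(1)[OF that that] this] show ?thesis by (simp add: X[OF that])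
    qed
    have u: "?u t = ?u 0" if "t \<in> {0..1}" for t
    proof (rule constant_on_unit_interval[where u = ?u])
      show "continuous_on {0..1} ?u" by (rule continuous_on_if_vector_derivative[OF u0])
      show "(?u has_vector_derivative 0) (at t)" if "t \<in> {0<..<1}" for t
        by (rule vector_derivative_at_interior[OF u0 that]) (use that in auto)
    qed (use that in auto)
    have "?X 0 = cmap c q - cmap c p"
      using u[of 1] by (simp add: geod_0[OF p q] geod_1[OF p q] algebra_simps)
    then have "cmap c (?\<sigma> t) - t *\<^sub>R (cmap c q - cmap c p) = cmap c p"
      using u[OF t] by (simp add: geod_0[OF p q])
    then show ?thesis by (simp only: diff_eq_eq)
  qed
  let ?\<sigma> = "geod A N U p q" and ?\<Delta> = "\<theta> q - \<theta> p"
  have s: "?\<sigma> t \<in> U" "?\<sigma> t \<in> cdom c" "?\<sigma> t \<in> cdom e" if "t \<in> {0..1}" for t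
    using geod_in[OF p q that] c e by auto
  define E where "E t = velocity A ?\<sigma> t e" for t
  have vel: "velocity A ?\<sigma> t = coord_vec A c (?\<sigma> t) ?\<Delta>" if "t \<in> {0..1}" for t
    using straight_velocity[OF p c(1,2) straight q that] by (simp add: c)
  note d = geodesic_component[OF geod_geodesic[OF p q] _ e(1) s(3), folded E_def]
  \<comment> \<open>The frames of \<theta> and \<eta> are biorthogonal, so the metric becomes the
    Euclidean product when its two arguments are written in different frames.\<close>
  have pairing: "g r (coord_vec A c r a) (coord_vec A e r b) = a \<bullet> b" if r: "r \<in> U" for r a b
  proof -
    have rc: "r \<in> cdom c" and re: "r \<in> cdom e" using r c e by auto
    note T = coord_vec_tangent[OF c(1) rc] coord_vec_tangent[OF e(1) re]
    let ?B = "\<lambda>a b. g r (coord_vec A c r a) (coord_vec A e r b)"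
    have 1: "?B (x *\<^sub>R a + y *\<^sub>R a') b = x * ?B a b + y * ?B a' b" for x y a a' b
      unfolding coord_vec_lincomb[OF c(1) rc] by (rule g_linear[OF T(1) T(1) T(2)])
    have 2: "?B a (x *\<^sub>R b + y *\<^sub>R b') = x * ?B a b + y * ?B a b'" for x y a b b'
    proof -
      have "?B a (x *\<^sub>R b + y *\<^sub>R b') = g r (coord_vec A e r (x *\<^sub>R b + y *\<^sub>R b')) (coord_vec A c r a)"
        by (rule g_sym[OF T])
      also have "\<dots> = x * g r (coord_vec A e r b) (coord_vec A c r a) + y * g r (coord_vec A e r b') (coord_vec A c r a)"
        unfolding coord_vec_lincomb[OF e(1) re] by (rule g_linear[OF T(2) T(2) T(1)])
      finally show ?thesis by (simp only: g_sym[OF T(2) T(1)])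
    qed
    have l1: "linear (\<lambda>a. ?B a b)" for b
    proof (rule linearI)
      show "?B (a + a') b = ?B a b + ?B a' b" for a a' using 1[of 1 a 1 a' b] by simp
      show "?B (x *\<^sub>R a) b = x *\<^sub>R ?B a b" for x a using 1[of x a 0 a b] by simp
    qed
    have l2: "linear (\<lambda>b. ?B a b)" for a
    proof (rule linearI)
      show "?B a (b + b') = ?B a b + ?B a b'" for b b' using 2[of a 1 b 1 b'] by simp
      show "?B a (x *\<^sub>R b) = x *\<^sub>R ?B a b" for x b using 2[of a x b 0 b] by simp
    qed
    have "?B (axis i 1) (axis j 1) = (if i = j then 1 else 0)" for i j
      using flat' r unfolding c_def e_def by blast
    then have *: "?B i j = i \<bullet> j" if "i \<in> Basis" "j \<in> Basis" for i j
      using that by (auto simp: Basis_vec_def inner_axis_axis)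
    have "?B a b = (\<Sum>i\<in>Basis. (a \<bullet> i) *\<^sub>R (\<Sum>j\<in>Basis. (b \<bullet> j) *\<^sub>R ?B i j))"
      by (subst linear_family_expand[OF l1], subst linear_family_expand[OF l2]) (rule refl)
    also have "\<dots> = (\<Sum>i\<in>Basis. (a \<bullet> i) *\<^sub>R (\<Sum>j\<in>Basis. (b \<bullet> j) *\<^sub>R (i \<bullet> j)))"
      by (intro sum.cong refl arg_cong2[where f = scaleR]) (simp add: *)
    also have "\<dots> = (\<Sum>i\<in>Basis. (a \<bullet> i) * (b \<bullet> i))"
      by (intro sum.cong refl) (simp add: inner_Basis if_distrib cong: if_cong)
    also have "\<dots> = a \<bullet> b" by (rule euclidean_inner[symmetric])
    finally show ?thesis .
  qed
  \<comment> \<open>One velocity is kept in \<theta>-components, where it is constant, and the other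
    is read as the derivative of \<eta>; this makes integration by parts possible.\<close>
  have speed: "G c (\<theta> p + t *\<^sub>R ?\<Delta>) ?\<Delta> ?\<Delta> = ?\<Delta> \<bullet> E t" if t: "t \<in> {0..1}" for t
  proof -
    have "G c (\<theta> p + t *\<^sub>R ?\<Delta>) ?\<Delta> ?\<Delta> = g (?\<sigma> t) (coord_vec A c (?\<sigma> t) ?\<Delta>) (coord_vec A c (?\<sigma> t) ?\<Delta>)"
      using G_cmap[OF c(1) s(2)[OF t]] straight[OF q t] by (simp add: c)
    also have "coord_vec A c (?\<sigma> t) ?\<Delta> = coord_vec A e (?\<sigma> t) (E t)"
      using vel[OF t] d(3)[OF t t] by simp
    also have "g (?\<sigma> t) (coord_vec A e (?\<sigma> t) (E t)) (coord_vec A e (?\<sigma> t) (E t))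
        = g (?\<sigma> t) (coord_vec A c (?\<sigma> t) ?\<Delta>) (coord_vec A e (?\<sigma> t) (E t))"
      using vel[OF t] d(3)[OF t t] by simp
    finally show ?thesis by (simp add: pairing[OF s(1)[OF t]])
  qed
  have \<phi>d: "((\<lambda>t. \<phi> (?\<sigma> t)) has_vector_derivative ?\<Delta> \<bullet> \<eta> (?\<sigma> t)) (at t within {0..1})" if t: "t \<in> {0..1}" for t
  proof -
    let ?x = "\<theta> (?\<sigma> t)"
    have "smooth_on (cmap c ` U) (\<lambda>x. \<phi> (cinv c x))"
      using smooth_funD[of U \<phi> c] flat' c by simp
    then have f: "((\<lambda>x. \<phi> (cinv c x)) has_derivative frechet_derivative (\<lambda>x. \<phi> (cinv c x)) (at (cmap c (?\<sigma> t)))) (at (cmap c (?\<sigma> t)))"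
      (is "(_ has_derivative ?f') _") by (rule smooth_on_has_derivative) (use s(1)[OF t] in simp)
    have "?f' (axis i 1) = \<eta> (?\<sigma> t) $ i" for i
      using dir_deriv_eq[OF c(1) s(2)[OF t] coord_vec_tangent[OF c(1) s(2)[OF t]] f, of "axis i 1"]
        coord_vec_component[OF c(1) s(2)[OF t], of "axis i 1"] flat' s(1)[OF t] by (simp add: c_def)
    then have *: "?f' i = i \<bullet> \<eta> (?\<sigma> t)" if "i \<in> Basis" for i
      using that by (auto simp: Basis_vec_def inner_axis')
    have lin: "linear ?f'" by (rule has_derivative_linear[OF f])
    have "?f' v = (\<Sum>i\<in>Basis. (v \<bullet> i) *\<^sub>R ?f' i)" for v by (rule linear_family_expand[OF lin])
    also have "\<dots> v = (\<Sum>i\<in>Basis. (v \<bullet> i) * (\<eta> (?\<sigma> t) \<bullet> i))" for v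
      by (intro sum.cong refl) (simp add: * inner_commute)
    finally have f'v: "?f' v = v \<bullet> \<eta> (?\<sigma> t)" for v by (simp add: euclidean_inner[symmetric])
    have xd: "((\<lambda>t. cmap c (?\<sigma> t)) has_derivative (\<lambda>h. h *\<^sub>R ?\<Delta>)) (at t within {0..1})"
    proof -
      have "((\<lambda>t. cmap c p + t *\<^sub>R (cmap c q - cmap c p)) has_derivative (\<lambda>h. h *\<^sub>R ?\<Delta>)) (at t within {0..1})"
        unfolding c by (auto intro!: derivative_eq_intros)
      then show ?thesis by (rule has_derivative_transform[OF t, rotated]) (rule straight[OF q])
    qed
    from has_derivative_compose[OF xd f]
    have "((\<lambda>t. \<phi> (cinv c (cmap c (?\<sigma> t)))) has_derivative (\<lambda>h. ?f' (h *\<^sub>R ?\<Delta>))) (at t within {0..1})" .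
    then have "((\<lambda>t. \<phi> (?\<sigma> t)) has_derivative (\<lambda>h. ?f' (h *\<^sub>R ?\<Delta>))) (at t within {0..1})"
      by (rule has_derivative_transform[OF t, rotated]) (simp add: cinv_cmap[OF c(1) s(2)])
    then show ?thesis unfolding f'v has_vector_derivative_def by simp
  qed
  \<comment> \<open>The antiderivative comes from integration by parts: the remaining integrand is
    the derivative of \<phi> along the geodesic, because \<eta> is the gradient of \<phi> in
    \<theta>-coordinates.\<close>
  have "((\<lambda>t. t * (?\<Delta> \<bullet> E t)) has_integral
      (1 * (?\<Delta> \<bullet> \<eta> (?\<sigma> 1)) - \<phi> (?\<sigma> 1)) - (0 * (?\<Delta> \<bullet> \<eta> (?\<sigma> 0)) - \<phi> (?\<sigma> 0))) {0..1}"
  proof (rule fundamental_theorem_of_calculus)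
    fix t :: real assume t: "t \<in> {0..1}"
    have "((\<lambda>t. ?\<Delta> \<bullet> (cmap e \<circ> ?\<sigma>) t) has_vector_derivative ?\<Delta> \<bullet> E t) (at t within {0..1})"
      by (rule bounded_linear.has_vector_derivative[OF bounded_linear_inner_right d(1)[OF t t]])
    then have 1: "((\<lambda>t. ?\<Delta> \<bullet> \<eta> (?\<sigma> t)) has_vector_derivative ?\<Delta> \<bullet> E t) (at t within {0..1})" by (simp add: e)
    have 2: "((\<lambda>t. t) has_vector_derivative 1) (at t within {0..1})" by (auto intro!: derivative_eq_intros)
    show "((\<lambda>t. t * (?\<Delta> \<bullet> \<eta> (?\<sigma> t)) - \<phi> (?\<sigma> t)) has_vector_derivative t * (?\<Delta> \<bullet> E t)) (at t within {0..1})"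
      using has_vector_derivative_diff[OF has_vector_derivative_mult[OF 2 1] \<phi>d[OF t]] by simp
  qed simp
  then have "integral {0..1} (\<lambda>t. t * (?\<Delta> \<bullet> E t)) = ?\<Delta> \<bullet> \<eta> q - \<phi> q + \<phi> p"
    by (simp add: integral_unique geod_0[OF p q] geod_1[OF p q])
  moreover have "energy_divergence A g N U p q = integral {0..1} (\<lambda>t. t * (?\<Delta> \<bullet> E t))"
    by (rule trans[OF straight_energy[OF p c(1,2) straight q] integral_cong]) (simp_all add: c(3) speed)
  moreover have "canonical_divergence A g N Ns U p q = energy_divergence A g N U p q"
    by (rule straight_divergence[OF p c(1,2) straight _ q]) (simp_all add: chr dual.geod_in[OF p])
  \<comment> \<open>The Legendre relation at \<open>q\<close> replaces \<theta>(q).\<eta>(q) -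
    \<phi>(q) by the dual potential.\<close>
  moreover have "\<phi> q + \<phi>s q - \<theta> q \<bullet> \<eta> q = 0" using flat' q by (simp add: inner_vec_def)
  moreover have "(\<Sum>i\<in>UNIV. \<theta> p $ i * \<eta> q $ i) = \<theta> p \<bullet> \<eta> q" by (simp add: inner_vec_def)
  ultimately show ?thesis by (simp add: bregman_divergence_def inner_diff_left)
qed

section \<open>The case of parallel curvature\<close>

lemma parallel_curvature_divergence:
  assumes cubic: "\<forall>W X Y. open W \<and> smooth_vfield A W X \<and> smooth_vfield A W Y \<longrightarrow>
      (\<forall>p\<in>W. curvature4 A g N X Y Y Y p = 0)"
    and par: "parallel_curvature A N" and p: "p \<in> U" and q: "q \<in> U"
  shows "canonical_divergence A g N Ns U p q = energy_divergence A g N U p q"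
    "canonical_divergence A g N Ns U p q = dual_work A g N Ns U q p"
proof -
  obtain c0 where c0: "c0 \<in> A" "p \<in> cdom c0" by (rule chart_at)
  define c where "c = normal_coord p c0"
  have c: "c \<in> A" unfolding c_def by (rule normal_chart_in[OF p c0])
  have U: "cdom c = U" by (simp add: c_def normal_coord_def)
  interpret D: normal_dual_chart "cmap c ` U" "\<Gamma> c" "d\<Gamma> c" "dual.\<Gamma> c" "dual.d\<Gamma> c" "G c"
    unfolding c_def by (rule normal_dual_chart[OF p c0])
  \<comment> \<open>Both curvature hypotheses become coordinate identities by evaluating them on
    coordinate fields of the normal chart.\<close>
  interpret D: dual_symmetric_chart "cmap c ` U" "\<Gamma> c" "d\<Gamma> c" "dual.\<Gamma> c" "dual.d\<Gamma> c" "G c"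
  proof unfold_locales
    fix x a b assume x: "x \<in> cmap c ` U"
    show "((\<lambda>y. D.R y a b e) has_derivative (\<lambda>w. - \<Gamma> c x w (D.R x a b e) + D.R x (\<Gamma> c x w a) b e
        + D.R x a (\<Gamma> c x w b) e + D.R x a b (\<Gamma> c x w e))) (at x)" for e
      by (rule parallel_curvature_component[OF par c]) (use x U in simp)
    obtain r where r: "r \<in> U" "x = cmap c r" using x by blast
    then have rc: "r \<in> cdom c" using U by simp
    let ?X = "\<lambda>q. coord_vec A c q a" and ?Y = "\<lambda>q. coord_vec A c q b"
    note F = smooth_vfield_coord[OF c open_cdom[OF c] order_refl]
    have "curvature A N ?X ?Y ?Y r = coord_vec A c r (D.R x a b b)"
      using tangent_eq_coord_vec[OF smooth_vfieldD(1)[OF smooth_curvature[OF open_cdom[OF c] F F F] rc] c rc, of a b b]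
        curvature_component[OF c open_cdom[OF c] order_refl F F F rc, of a b b]
      by (simp add: r coord_vec_component[OF c rc])
    moreover have "curvature4 A g N ?X ?Y ?Y ?Y r = 0"
      by (rule cubic[rule_format, OF _ rc]) (intro conjI open_cdom c F)
    ultimately show "G c x (D.R x a b b) b = 0"
      unfolding curvature4_def by (simp add: r G_cmap[OF c rc])
  qed
  have origin: "cmap c p = 0" unfolding c_def by (rule normal_origin[OF p c0])
  have geod: "cmap c (geod A N U p q t) = t *\<^sub>R cmap c q" if "q \<in> U" "t \<in> {0..1}" for q t
    unfolding c_def by (rule normal_geod[OF p c0 that])
  have straight: "cmap c (geod A N U p q t) = cmap c p + t *\<^sub>R (cmap c q - cmap c p)"
    if "q \<in> U" "t \<in> {0..1}" for q t using geod[OF that] by (simp add: origin)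
  have vel: "velocity A (geod A N U p q) t = coord_vec A c (geod A N U p q t) (cmap c q)"
    if "q \<in> U" "t \<in> {0..1}" for q t
    using straight_velocity[OF p c U straight that] by (simp add: origin)
  have s: "geod A Ns U p q t \<in> U" "geod A Ns U p q t \<in> cdom c" if "q \<in> U" "t \<in> {0..1}" for q t
    using dual.geod_in[OF p that] U by auto
  define z Z where "z q = cmap c \<circ> geod A Ns U p q" and "Z q t = velocity A (geod A Ns U p q) t c" for q t
  note d = dual.geodesic_component[OF dual.geod_geodesic[OF p] _ c s(2), folded z_def Z_def]
  have zd: "(z q has_vector_derivative Z q t) (at t within {0..1})" if "q \<in> U" "t \<in> {0..1}" for q t
    using d(1)[OF that(1,2) that] by simp
  have Zd: "(Z q has_vector_derivative - dual.\<Gamma> c (z q t) (Z q t) (Z q t)) (at t within {0..1})"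
    if "q \<in> U" "t \<in> {0..1}" for q t
    using d(2)[OF that(1,2) that] by (simp add: z_def dual.\<Gamma>_cmap[OF c s(2)[OF that]])
  have zS: "z q t \<in> cmap c ` U" if "q \<in> U" "t \<in> {0..1}" for q t using s(1)[OF that] by (simp add: z_def)
  have z0: "z q 0 = 0" and z1: "z q 1 = cmap c q" if "q \<in> U" for q
    by (simp_all add: z_def dual.geod_0[OF p that] dual.geod_1[OF p that] origin)
  have "christoffel A N c (geod A Ns U p q t) (velocity A (geod A Ns U p q) t c) (cmap c q - cmap c p) = 0"
    if q: "q \<in> U" and t: "t \<in> {0..1}" for q t
  proof -
    have "\<Gamma> c (z q t) (Z q t) (cmap c q) = 0"
      using D.dual_geodesic_transport[OF zS[OF q] z0[OF q] zd[OF q] Zd[OF q] t] unfolding z1[OF q] .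
    then show ?thesis by (simp add: origin \<Gamma>_cmap[OF c s(2)[OF q t], symmetric] z_def Z_def)
  qed
  from straight_divergence[OF p c U straight this q]
  show div: "canonical_divergence A g N Ns U p q = energy_divergence A g N U p q" .
  have "energy_divergence A g N U p q = integral {0..1} (\<lambda>t. t * G c (t *\<^sub>R z q 1) (z q 1) (z q 1))"
    using straight_energy[OF p c U straight q] by (simp add: origin z1[OF q])
  also have "\<dots> = integral {0..1} (\<lambda>t. G c (z q t) (Z q t) (z q t))"
    by (rule D.radial_form_path_independent[OF zS[OF q] z0[OF q] zd[OF q]
          continuous_on_if_vector_derivative[OF Zd[OF q]], symmetric])
  also have "\<dots> = integral {0..1} (\<lambda>t. - g (geod A Ns U p q t) (velocity A (geod A Ns U p q) t)
      (exp_inv A N U (geod A Ns U p q t) p))"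
  proof (rule integral_cong)
    fix t :: real assume t: "t \<in> {0..1}"
    let ?r = "geod A Ns U p q t"
    note r = s[OF q t]
    \<comment> \<open>Reversing the \<nabla>-geodesic from \<open>p\<close> expresses the initial
      velocity back to \<open>p\<close> as minus the position vector in the normal chart. The sign
      in the definition of the dual work cancels it, leaving the radial form on the dual
      geodesic.\<close>
    have "exp_inv A N U ?r p = tscale (-1) (velocity A (geod A N U p ?r) 1)"
      by (rule exp_inv_reverse[OF p r(1)])
    also have "\<dots> = coord_vec A c ?r (- cmap c ?r)"
      using vel[OF r(1), of 1] coord_vec_scale[OF c r(2), of "-1" "cmap c ?r"] by (simp add: geod_1[OF p r(1)])
    finally have "exp_inv A N U ?r p = coord_vec A c ?r (- z q t)" by (simp add: z_def)
    moreover have "velocity A (geod A Ns U p q) t = coord_vec A c ?r (Z q t)" by (rule d(3)[OF q t q t])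
    moreover have "G c (z q t) (Z q t) (- z q t) = g ?r (coord_vec A c ?r (Z q t)) (coord_vec A c ?r (- z q t))"
      using G_cmap[OF c r(2)] by (simp add: z_def)
    ultimately show "G c (z q t) (Z q t) (z q t) = - g ?r (velocity A (geod A Ns U p q) t) (exp_inv A N U ?r p)"
      by (simp add: D.G_simps[OF zS[OF q t]])
  qed
  also have "\<dots> = dual_work A g N Ns U q p" by (simp add: dual_work_def Let_def)
  finally show "canonical_divergence A g N Ns U p q = dual_work A g N Ns U q p" using div by simp
qed

end

theorem mainTheorem6:
  fixes A :: "('m::{t2_space, second_countable_topology}, 'n::finite) chart set"
    and g :: "('m, 'n) metric"
    and N Ns :: "('m, 'n) connection"
    and U :: "'m set"
  assumes "statistical_manifold A g N Ns"
    and "dually_convex A N Ns U"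
    and "normal_convention A N Ns U"
  shows
    "(\<forall>LC. levi_civita A g LC \<and> same_connection A N LC \<and> same_connection A Ns LC \<longrightarrow>
        (\<forall>p\<in>U. \<forall>q\<in>U.
           let d = sqrt (g p (exp_inv A LC U p q) (exp_inv A LC U p q)) in
             canonical_divergence A g N Ns U p q = 1/2 * d\<^sup>2 \<and>
             d = riemannian_distance A g U p q)) \<and>
     (flat_connection A N \<and> flat_connection A Ns \<longrightarrow>
        (\<forall>\<theta> \<eta> \<phi> \<phi>s. dually_flat_coordinates A g N Ns U \<theta> \<eta> \<phi> \<phi>s \<longrightarrow>
           (\<forall>p\<in>U. \<forall>q\<in>U.
              canonical_divergence A g N Ns U p q = bregman_divergence \<theta> \<eta> \<phi> \<phi>s p q))) \<and>
     ((\<forall>W X Y. open W \<and> smooth_vfield A W X \<and> smooth_vfield A W Y \<longrightarrow>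
          (\<forall>p\<in>W. curvature4 A g N X Y Y Y p = 0)) \<and>
      parallel_curvature A N \<longrightarrow>
        (\<forall>p\<in>U. \<forall>q\<in>U.
           canonical_divergence A g N Ns U p q = energy_divergence A g N U p q \<and>
           canonical_divergence A g N Ns U p q = dual_work A g N Ns U q p))"
proof -
  interpret dually_convex_set A g N Ns U
    using assms by unfold_locales (simp_all add: statistical_manifold_def)
  show ?thesis
  proof (intro conjI allI impI ballI)
    fix LC p q assume LC: "levi_civita A g LC \<and> same_connection A N LC \<and> same_connection A Ns LC"
      and p: "p \<in> U" and q: "q \<in> U"
    have "christoffel A N c r = christoffel A LC c r" "christoffel A Ns c r = christoffel A LC c r"
      if "c \<in> A" "r \<in> cdom c" for c r
      using christoffel_same[OF _ that] LC by blast+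
    then have "exp_inv A LC U p q = exp_inv A N U p q"
      "\<And>c r. c \<in> A \<Longrightarrow> r \<in> cdom c \<Longrightarrow> christoffel A Ns c r = christoffel A N c r"
      using geod_cong[of LC N p q] by (simp_all add: exp_inv_def)
    then show "let d = sqrt (g p (exp_inv A LC U p q) (exp_inv A LC U p q)) in
      canonical_divergence A g N Ns U p q = 1/2 * d\<^sup>2 \<and> d = riemannian_distance A g U p q"
      using self_dual_divergence[OF _ p q] by (simp add: Let_def)
  next
    show "canonical_divergence A g N Ns U p q = bregman_divergence \<theta> \<eta> \<phi> \<phi>s p q"
      if "dually_flat_coordinates A g N Ns U \<theta> \<eta> \<phi> \<phi>s" "p \<in> U" "q \<in> U" for \<theta> \<eta> \<phi> \<phi>s p q
      by (rule dually_flat_divergence[OF that])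
  next
    fix p q assume *: "(\<forall>W X Y. open W \<and> smooth_vfield A W X \<and> smooth_vfield A W Y \<longrightarrow>
          (\<forall>p\<in>W. curvature4 A g N X Y Y Y p = 0)) \<and> parallel_curvature A N" "p \<in> U" "q \<in> U"
    show "canonical_divergence A g N Ns U p q = energy_divergence A g N U p q"
      "canonical_divergence A g N Ns U p q = dual_work A g N Ns U q p"
      by (rule parallel_curvature_divergence[OF conjunct1[OF *(1)] conjunct2[OF *(1)] *(2,3)])+
  qed
qed

end
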